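(* Let $\mathcal C_6\subset(\mathbb{R}^2)^6$ denote the space of strictly convex labeled hexagons whose vertices are listed in cyclic order. For $P\in\mathcal C_6$ put $G_P=L_P-3I$, $\mathcal S(P)=\frac12\operatorname{tr}((G_P-I)^2)$, $\mathcal R(P)=\det(G_P-I)$, $\Delta_P=4\mathcal S(P)^3-27\mathcal R(P)^2$, $F(P)=\mathcal R(P)+2\mathcal S(P)-8$, and define $$\mathcal U_6=\{P\in\mathcal C_6:\Delta_P<0\}\cup\{P\in\mathcal C_6:\Delta_P>0,\ F(P)\ne0\}.$$ Then $\mathcal U_6$ is open and dense in $\mathcal C_6$. For every $P\in\mathcal U_6$, exactly one of the following alternatives holds. (i) If $\Delta_P>0$, the eigenvalues of $G_P$ are real and can be ordered so that $|\mu_1|>|\mu_2|>|\mu_3|$. Let $X_j$ be the eigenpoint corresponding to $\mu_j$, and let $u$ be the affine direction of the line $X_1X_2$. Then, as $k\to\infty$, $$\max_i\operatorname{dist}\bigl((\widehat T^k(P))_i,\,C(P)+\mathbb{R}u\bigr)\to0\quad\text{and}\quad\operatorname{diam}\bigl(\widehat T^k(P)\bigr)\to\infty.$$ (ii) If $\Delta_P<0$, the spectrum of $G_P$ consists of one strictly dominant real eigenvalue $\lambda_1$ and a subdominant non-real conjugate pair $\lambda_2,\lambda_3=\overline{\lambda_2}$. Moreover the following elliptic asymptotics hold. The matrix $G_P$ is invertible, $T^2(P)=G_P(P)$, all forward pentagram iterates of $P$ are defined with nonzero area, and the eigenpoint $X_1=[v_1]$ of $\lambda_1$ is a finite point of $\mathbb{R}^2$.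 Let $f$ be the affine expression of $G_P$ near $X_1$, $\tau=|\lambda_2|/|\lambda_1|<1$, $\lambda_2/\lambda_1=\tau e^{\mathrm i\vartheta}$, $M=\mathrm Df_{X_1}$, $R=\tau^{-1}M$. For $r\in\{0,1\}$ put $Q_r=T^r(P)=(q_{r,1},\dots,q_{r,6})$. Then every homogeneous lift of every $q_{r,i}$ has nonzero spectral projection onto $\mathbb{R}v_1$ along the real invariant plane associated with $\lambda_2,\lambda_3$; there are vectors $\xi_{r,i}\in\mathbb{R}^2$ with $$f^q(q_{r,i})=X_1+\tau^qR^q\xi_{r,i}+O(\tau^{2q})\qquad(q\to\infty);$$ and with $w_{r,i}=\xi_{r,i}-\frac16\sum_j\xi_{r,j}$ and $B_r=\left|\frac12\sum_i\det(w_{r,i},w_{r,i+1})\right|$ one has $w_{r,i}\ne0$ for every $i$ and $B_r>0$. Consequently, for $r\in\{0,1\}$ and every $i$, $$(\widehat T^{2q+r}(P))_i-C(P)=\sqrt{\frac{\operatorname{Area}(P)}{B_r}}\,R^qw_{r,i}+o(1)\qquad(q\to\infty),$$ the matrix $R$ has eigenvalues $e^{\pm\mathrm i\vartheta}$ and determinant $1$, there is a positive definite symmetric matrix $H$, unique up to a positive scalar and independent of $r$ and $i$, with $M^\top HM=\tau^2H$, and $$\bigl((\widehat T^{2q+r}(P))_i-C(P)\bigr)^\top H\bigl((\widehat T^{2q+r}(P))_i-C(P)\bigr)\to s_{r,i}:=\frac{\operatorname{Area}(P)}{B_r}\,w_{r,i}^\top Hw_{r,i}.$$ Thus the $i$-th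 vertices of the even ($r=0$) and odd ($r=1$) area-normalized subsequences are asymptotic to the concentric homothetic ellipses $(y-C(P))^\top H(y-C(P))=s_{r,i}$.
   Context: Labeled polygons: $P=(p_1,\dots,p_n)$ with $p_i\in\mathbb{R}^2$, indices modulo $n$ (here $n=6$); $\mathbb{R}^2\subset\mathbb{RP}^2$ via $x\mapsto[x:1]$. The pentagram map is $T(P)_i=(p_ip_{i+2})\cap(p_{i+1}p_{i+3})$, with iterates $T^k$. Put $C(P)=\frac1n\sum_ip_i$ and $\operatorname{Area}(P)=\bigl|\frac12\sum_i\det(p_i,p_{i+1})\bigr|$. The area-normalized pentagram map is $$\widehat T(P)_i=C(P)+\sqrt{\tfrac{\operatorname{Area}(P)}{\operatorname{Area}(T(P))}}\,\bigl(T(P)_i-C(T(P))\bigr).$$ Glick's operator of a labeled $n$-gon with every consecutive triple of vertices noncollinear: with nonzero lifts $\widetilde p_i\in\mathbb{R}^3$, $$L_P(v)=nv-\sum_{j=1}^n\frac{\det(\widetilde p_{j-1},v,\widetilde p_{j+1})}{\det(\widetilde p_{j-1},\widetilde p_j,\widetilde p_{j+1})}\,\widetilde p_j ,\qquad v\in\mathbb{R}^3,$$ a linear operator independent of the lifts. An invertible $3\times 3$ real matrix acts on $\mathbb{RP}^2$ as a projectivity, and on polygons vertexwise; an eigenpoint is the projective class $[v]$ of an eigenvector $v$. In the equation $T^2(P)=G_P(P)$, $G_P$ is regarded as a projectivity; $f^q(q_{r,i})$ denotes the affine point $G_P^q(q_{r,i})$. "Dominant" means of strictly larger modulus. *)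

theory Defs
  imports "HOL-Analysis.Analysis" "HOL-Library.Numeral_Type" "HOL-Library.Landau_Symbols"
begin

(* The vertices are indexed by the numeral type 6, whose arithmetic is modulo 6: "i + 1" and
   "j - 1" are the cyclic neighbours, and the space of hexagons carries its Euclidean topology. *)
type_synonym hexagon = "real^2^6"

subsection \<open>Hexagons and the pentagram map\<close>

definition det2 :: "real^2 \<Rightarrow> real^2 \<Rightarrow> real" where
  "det2 a b = det (vector [a, b] :: real^2^2)"

definition det3 :: "real^3 \<Rightarrow> real^3 \<Rightarrow> real^3 \<Rightarrow> real" where
  "det3 a b c = det (vector [a, b, c] :: real^3^3)"

definition centroid :: "hexagon \<Rightarrow> real^2" where
  "centroid P = (1/6) *\<^sub>R (\<Sum>i\<in>UNIV. P $ i)"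

definition area :: "hexagon \<Rightarrow> real" where
  "area P = \<bar>(1/2) * (\<Sum>i\<in>UNIV. det2 (P $ i) (P $ (i + 1)))\<bar>"

(* For every edge, all other vertices lie strictly on the same side of its line (the left side
   for counterclockwise, the right side for clockwise labelings).  Then every segment
   p_i p_{i+1} is an edge of the convex hull and every p_i is an extreme point, so the labeling
   follows the boundary. *)
definition convex_hexagons :: "hexagon set" where
  "convex_hexagons =
    {P. (\<forall>i j. j \<noteq> i \<longrightarrow> j \<noteq> i + 1 \<longrightarrow> det2 (P $ (i + 1) - P $ i) (P $ j - P $ i) > 0) \<or>
        (\<forall>i j. j \<noteq> i \<longrightarrow> j \<noteq> i + 1 \<longrightarrow> det2 (P $ (i + 1) - P $ i) (P $ j - P $ i) < 0)}"

definition pentagram_defined :: "hexagon \<Rightarrow> bool" where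
  "pentagram_defined P \<longleftrightarrow>
    (\<forall>i. P $ i \<noteq> P $ (i + 2) \<and> P $ (i + 1) \<noteq> P $ (i + 3) \<and>
      (\<exists>!x. x \<in> affine hull {P $ i, P $ (i + 2)} \<inter> affine hull {P $ (i + 1), P $ (i + 3)}))"

(* Meaningful only if pentagram_defined P. *)
definition pentagram :: "hexagon \<Rightarrow> hexagon" where
  "pentagram P =
    (\<chi> i. THE x. x \<in> affine hull {P $ i, P $ (i + 2)} \<inter> affine hull {P $ (i + 1), P $ (i + 3)})"

definition normalized_pentagram :: "hexagon \<Rightarrow> hexagon" where
  "normalized_pentagram P =
    (\<chi> i. centroid P + sqrt (area P / area (pentagram P)) *\<^sub>R (pentagram P $ i - centroid (pentagram P)))"

definition pentagram_iterates_defined :: "hexagon \<Rightarrow> bool" where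
  "pentagram_iterates_defined P \<longleftrightarrow>
    (\<forall>k. pentagram_defined ((pentagram ^^ k) P) \<and> area ((pentagram ^^ k) P) \<noteq> 0)"

definition normalized_iterates_defined :: "hexagon \<Rightarrow> bool" where
  "normalized_iterates_defined P \<longleftrightarrow>
    (\<forall>k. pentagram_defined ((normalized_pentagram ^^ k) P) \<and>
         area (pentagram ((normalized_pentagram ^^ k) P)) \<noteq> 0)"

subsection \<open>Homogeneous coordinates\<close>

definition homog_lift :: "real^2 \<Rightarrow> real^3" where
  "homog_lift x = vector [x $ 1, x $ 2, 1]"

(* The affine point of a homogeneous vector; meaningful only if the third coordinate is nonzero. *)
definition affine_point :: "real^3 \<Rightarrow> real^2" where
  "affine_point v = vector [v $ 1 / v $ 3, v $ 2 / v $ 3]"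

definition same_projective_point :: "real^3 \<Rightarrow> real^3 \<Rightarrow> bool" where
  "same_projective_point v w \<longleftrightarrow> v \<noteq> 0 \<and> w \<noteq> 0 \<and> (\<exists>c. c \<noteq> 0 \<and> v = c *\<^sub>R w)"

definition affine_expression :: "real^3^3 \<Rightarrow> real^2 \<Rightarrow> real^2" where
  "affine_expression A x = affine_point (A *v homog_lift x)"

(* x is a direction vector of the affine line whose homogeneous points form the plane
   spanned by v and w. *)
definition line_direction :: "real^3 \<Rightarrow> real^3 \<Rightarrow> real^2 \<Rightarrow> bool" where
  "line_direction v w x \<longleftrightarrow> x \<noteq> 0 \<and> vector [x $ 1, x $ 2, 0] \<in> span {v, w}"

subsection \<open>Spectral notions for real matrices\<close>

definition complex_vec :: "real^'n \<Rightarrow> complex^'n" where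
  "complex_vec v = (\<chi> i. complex_of_real (v $ i))"

definition complex_mat :: "real^'n^'m \<Rightarrow> complex^'n^'m" where
  "complex_mat A = (\<chi> i j. complex_of_real (A $ i $ j))"

definition complex_eigenvalues :: "real^'n^'n \<Rightarrow> complex set" where
  "complex_eigenvalues A = {l. \<exists>z. z \<noteq> 0 \<and> complex_mat A *v z = l *s z}"

definition eigenvector :: "real^'n^'n \<Rightarrow> real \<Rightarrow> real^'n \<Rightarrow> bool" where
  "eigenvector A m v \<longleftrightarrow> v \<noteq> 0 \<and> A *v v = m *\<^sub>R v"

(* The real points of the sum of the complex eigenspaces of l and its conjugate. *)
definition real_invariant_subspace :: "real^'n^'n \<Rightarrow> complex \<Rightarrow> (real^'n) set" where
  "real_invariant_subspace A l =
    {w. \<exists>z z'. complex_mat A *v z = l *s z \<and> complex_mat A *v z' = cnj l *s z' \<and>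
               complex_vec w = z + z'}"

(* The projection of x onto the line through v along W; meaningful only if the space is the
   direct sum of that line and W. *)
definition projection_along :: "'a::real_vector \<Rightarrow> 'a set \<Rightarrow> 'a \<Rightarrow> 'a" where
  "projection_along v W x = (THE y. y \<in> span {v} \<and> x - y \<in> W)"

definition positive_definite_symmetric :: "real^'n^'n \<Rightarrow> bool" where
  "positive_definite_symmetric H \<longleftrightarrow> transpose H = H \<and> (\<forall>x. x \<noteq> 0 \<longrightarrow> x \<bullet> (H *v x) > 0)"

subsection \<open>Glick's operator\<close>

definition glick_of_lifts :: "real^3^6 \<Rightarrow> real^3 \<Rightarrow> real^3" where
  "glick_of_lifts p v =
    6 *\<^sub>R v - (\<Sum>j\<in>UNIV. (det3 (p $ (j - 1)) v (p $ (j + 1)) /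
                        det3 (p $ (j - 1)) (p $ j) (p $ (j + 1))) *\<^sub>R p $ j)"

lemma glick_of_lifts_rescale:
  assumes "\<And>j. c j \<noteq> 0"
  shows "glick_of_lifts (\<chi> j. c j *\<^sub>R p $ j) v = glick_of_lifts p v"
proof -
  have 1: "det3 (a *\<^sub>R x) y z = a * det3 x y z" and 2: "det3 x (a *\<^sub>R y) z = a * det3 x y z"
    and 3: "det3 x y (a *\<^sub>R z) = a * det3 x y z" for a x y z
    by (simp_all add: det3_def det_3 algebra_simps)
  show ?thesis
    unfolding glick_of_lifts_def using assms by (simp add: 1 2 3)
qed

lemma linear_glick_of_lifts: "linear (glick_of_lifts p)"
proof -
  have 1: "det3 x (v + w) y = det3 x v y + det3 x w y" for x y v w
    by (simp add: det3_def det_3 algebra_simps)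
  have 2: "det3 x (c *\<^sub>R v) y = c * det3 x v y" for x y v c
    by (simp add: det3_def det_3 algebra_simps)
  show ?thesis
    by (rule linearI)
      (simp_all add: glick_of_lifts_def 1 2 add_divide_distrib scaleR_add_left scaleR_add_right
        sum.distrib scaleR_diff_right scaleR_sum_right)
qed

definition glick_matrix :: "hexagon \<Rightarrow> real^3^3" where
  "glick_matrix P = matrix (glick_of_lifts (\<chi> i. homog_lift (P $ i)))"

definition G_mat :: "hexagon \<Rightarrow> real^3^3" where
  "G_mat P = glick_matrix P - mat 3"

definition S_inv :: "hexagon \<Rightarrow> real" where
  "S_inv P = (1/2) * trace ((G_mat P - mat 1) ** (G_mat P - mat 1))"

definition R_inv :: "hexagon \<Rightarrow> real" where
  "R_inv P = det (G_mat P - mat 1)"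

definition Discr :: "hexagon \<Rightarrow> real" where
  "Discr P = 4 * S_inv P ^ 3 - 27 * R_inv P ^ 2"

definition F_inv :: "hexagon \<Rightarrow> real" where
  "F_inv P = R_inv P + 2 * S_inv P - 8"

definition U6 :: "hexagon set" where
  "U6 = {P \<in> convex_hexagons. Discr P < 0} \<union> {P \<in> convex_hexagons. Discr P > 0 \<and> F_inv P \<noteq> 0}"

subsection \<open>The two alternatives\<close>

definition real_alternative :: "hexagon \<Rightarrow> bool" where
  "real_alternative P \<longleftrightarrow>
    normalized_iterates_defined P \<and>
    (\<exists>\<mu>1 \<mu>2 \<mu>3 :: real.
      complex_eigenvalues (G_mat P) = {of_real \<mu>1, of_real \<mu>2, of_real \<mu>3} \<and>
      \<bar>\<mu>1\<bar> > \<bar>\<mu>2\<bar> \<and> \<bar>\<mu>2\<bar> > \<bar>\<mu>3\<bar> \<and>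
      (\<forall>v1 v2. eigenvector (G_mat P) \<mu>1 v1 \<and> eigenvector (G_mat P) \<mu>2 v2 \<longrightarrow>
        \<comment> \<open>the line through the two eigenpoints is not the line at infinity\<close>
        (v1 $ 3 \<noteq> 0 \<or> v2 $ 3 \<noteq> 0) \<and>
        (\<forall>u. line_direction v1 v2 u \<longrightarrow>
          (\<lambda>k. Max (range (\<lambda>i. infdist ((normalized_pentagram ^^ k) P $ i)
                                    (range (\<lambda>t. centroid P + t *\<^sub>R u))))) \<longlonglongrightarrow> 0 \<and>
          filterlim (\<lambda>k. diameter (range (\<lambda>i. (normalized_pentagram ^^ k) P $ i)))
            at_top sequentially)))"

(* Matrix powers are iterates of the linear map, because "^" is componentwise on vectors. *)
definition elliptic_alternative :: "hexagon \<Rightarrow> bool" where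
  "elliptic_alternative P \<longleftrightarrow>
    (\<exists>(l1 :: real) (l2 :: complex).
      complex_eigenvalues (G_mat P) = {of_real l1, l2, cnj l2} \<and>
      Im l2 \<noteq> 0 \<and> cmod l2 < \<bar>l1\<bar> \<and>
      invertible (G_mat P) \<and>
      (\<forall>i. same_projective_point (homog_lift ((pentagram ^^ 2) P $ i)) (G_mat P *v homog_lift (P $ i))) \<and>
      pentagram_iterates_defined P \<and>
      normalized_iterates_defined P \<and>
      (\<forall>v1 \<theta>. let \<tau> = cmod l2 / \<bar>l1\<bar> in
        eigenvector (G_mat P) l1 v1 \<and> l2 / of_real l1 = of_real \<tau> * exp (\<i> * of_real \<theta>) \<longrightarrow>
        (let X1 = affine_point v1;
             W = real_invariant_subspace (G_mat P) l2;
             f = affine_expression (G_mat P);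
             f_iter = (\<lambda>q x. affine_point (((*v) (G_mat P) ^^ q) (homog_lift x)));
             M = jacobian f (at X1);
             R = (1 / \<tau>) *\<^sub>R M;
             Q = (\<lambda>r. (pentagram ^^ r) P)
         in
          v1 $ 3 \<noteq> 0 \<and>
          \<tau> < 1 \<and>
          f differentiable (at X1) \<and>
          subspace W \<and> dim W = 2 \<and>
          (\<forall>x. \<exists>!y. y \<in> span {v1} \<and> x - y \<in> W) \<and>
          (\<forall>r\<in>{0, 1}. \<forall>i h. same_projective_point h (homog_lift (Q r $ i)) \<longrightarrow>
            projection_along v1 W h \<noteq> 0) \<and>
          (\<forall>r\<in>{0, 1}. \<forall>i q. ((*v) (G_mat P) ^^ q) (homog_lift (Q r $ i)) $ 3 \<noteq> 0) \<and>
          complex_eigenvalues R = {exp (\<i> * of_real \<theta>), exp (- (\<i> * of_real \<theta>))} \<and>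
          det R = 1 \<and>
          (\<exists>\<xi> :: nat \<Rightarrow> real^2^6.
            (\<forall>r\<in>{0, 1}. \<forall>i.
              (\<lambda>q. norm (f_iter q (Q r $ i) - (X1 + \<tau> ^ q *\<^sub>R ((*v) R ^^ q) (\<xi> r $ i))))
                \<in> O(\<lambda>q. \<tau> ^ (2 * q))) \<and>
            (let w = (\<lambda>r. (\<chi> i. \<xi> r $ i - (1/6) *\<^sub>R (\<Sum>j\<in>UNIV. \<xi> r $ j)));
                 B = (\<lambda>r. \<bar>(1/2) * (\<Sum>i\<in>UNIV. det2 (w r $ i) (w r $ (i + 1)))\<bar>)
             in
              (\<forall>r\<in>{0, 1}. (\<forall>i. w r $ i \<noteq> 0) \<and> B r > 0) \<and>
              (\<forall>r\<in>{0, 1}. \<forall>i.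
                (\<lambda>q. (normalized_pentagram ^^ (2 * q + r)) P $ i - centroid P
                      - sqrt (area P / B r) *\<^sub>R ((*v) R ^^ q) (w r $ i)) \<longlonglongrightarrow> 0) \<and>
              (\<exists>H. positive_definite_symmetric H \<and> transpose M ** H ** M = \<tau>\<^sup>2 *\<^sub>R H \<and>
                (\<forall>H'. positive_definite_symmetric H' \<and> transpose M ** H' ** M = \<tau>\<^sup>2 *\<^sub>R H' \<longrightarrow>
                  (\<exists>c>0. H' = c *\<^sub>R H)) \<and>
                (\<forall>r\<in>{0, 1}. \<forall>i.
                  let s = area P / B r * (w r $ i \<bullet> (H *v (w r $ i)));
                      y = (\<lambda>q. (normalized_pentagram ^^ (2 * q + r)) P $ i)
                  in
                    (\<lambda>q. (y q - centroid P) \<bullet> (H *v (y q - centroid P))) \<longlonglongrightarrow> s \<and>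
                    s > 0 \<and>
                    (\<lambda>q. infdist (y q) {x. (x - centroid P) \<bullet> (H *v (x - centroid P)) = s})
                      \<longlonglongrightarrow> 0)))))))"

end

theory Submission
  imports Defs
begin

text \<open>On homogeneous lifts of the vertices of a convex hexagon, the matrix \<open>G\<close> sends \<open>p i\<close> to \<open>2 p i\<close> plus a
  combination of \<open>p (i + 2)\<close>, \<open>p (i + 3)\<close>, \<open>p (i + 4)\<close> with positive coefficients, and three-term Pluecker
  relations show that this is the lift of the \<open>i\<close>-th vertex of the twice iterated pentagram map.  Hence
  \<open>G\<close> maps the cone over the hexagon into its interior, and a Perron--Frobenius argument (fixed points from
  Brouwer's theorem) yields a dominant positive eigenvalue \<open>l\<close> with a left eigenvector \<open>\<phi>\<close> positive on
  the cone and a right eigenvector inside it, so that the dominant eigenpoint \<open>X\<close> lies in the hexagon.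

  The projective chart that sends \<open>\<phi> = 0\<close> to infinity and \<open>X\<close> to the origin conjugates \<open>G\<close> to the linear
  map \<open>M\<close>, the derivative of \<open>G\<close> at \<open>X\<close>.  The even and odd iterates become \<open>M\<close>-orbits of two fixed convex
  hexagons \<open>\<xi> 0\<close> and \<open>\<xi> 1\<close>, up to the factors \<open>1 / (1 + \<psi> y)\<close>, which tend to \<open>1\<close>.  Since the pentagram map
  commutes with similarities, the normalized iterates are homothetic images of the ordinary ones, and both
  alternatives are read off from the normal form of \<open>M\<close>: a contraction times a rotation of an invariant
  ellipse if the discriminant is negative, a real diagonal matrix if it is positive.\<close>

section \<open>The pentagram map on homogeneous lifts\<close>

text \<open>Incidence relations fix points only up to a nonzero scalar, whereas convexity, area and
  the line at infinity depend on signs. Hence lifts are tracked up to positive scalars, and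
  \<open>det (G_mat P) > 0\<close> preserves this under iteration. The invariants come from
  \<open>trace (G_mat P) = 3\<close>: the characteristic polynomial is a depressed cubic in
  \<open>k - 1\<close> with coefficients \<open>S_inv P\<close> and \<open>R_inv P\<close>,
  \<open>Discr P\<close> is its discriminant, and \<open>F_inv P\<close> is minus the product of the
  pairwise sums of the eigenvalues. Beside the dominant root \<open>l\<close>, the other two have
  sum \<open>3 - l\<close> and product \<open>det G / l\<close>; on convex hexagons
  \<open>F_inv P = 0\<close> says that these two are opposite. Areas shrink like
  \<open>det M ^ q\<close>, so normalization scales lengths by its inverse square root. This cancels
  the modulus of a conjugate pair, but turns two real rates of distinct moduli into reciprocal ones,
  one growing and one decaying. For density, the exceptional set is algebraic, so a single hexagon
  off it suffices, and that hexagon need not be convex.\<close>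

lemma exhaust_6: "x = 0 \<or> x = 1 \<or> x = 2 \<or> x = 3 \<or> x = 4 \<or> x = 5" for x :: 6
proof (induct x)
  case (of_int z)
  then have "0 \<le> z" and "z < 6" by simp_all
  then have "z = 0 \<or> z = 1 \<or> z = 2 \<or> z = 3 \<or> z = 4 \<or> z = 5" by arith
  then show ?case by auto
qed

lemma UNIV_6: "UNIV = {0, 1, 2, 3, 4, 5 :: 6}"
  using exhaust_6 by auto

lemma forall_6_shift: "(\<forall>j. Q j) \<longleftrightarrow> Q i \<and> Q (i + 1) \<and> Q (i + 2) \<and> Q (i + 3) \<and> Q (i + 4) \<and> Q (i + 5)"
  for i :: 6
proof -
  have "(\<forall>j. Q j) \<longleftrightarrow> (\<forall>k. Q (i + k))"
    by (metis diff_add_cancel add.commute)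
  also have "\<dots> \<longleftrightarrow> (\<forall>k\<in>{0, 1, 2, 3, 4, 5 :: 6}. Q (i + k))"
    by (metis UNIV_6 UNIV_I)
  finally show ?thesis by simp
qed

text \<open>Offsets from a base vertex are normalized to one literal below 6, so that a relation
  stated for \<open>i\<close> can be instantiated at \<open>i + 1\<close>, \<open>i + 2\<close> and
  so on and still match syntactically.\<close>

lemma add_6 [simp]:
  "i + 1 + 1 = i + 2" "i + 1 + 2 = i + 3" "i + 1 + 3 = i + 4" "i + 1 + 4 = i + 5" "i + 1 + 5 = i"
  "i + 2 + 1 = i + 3" "i + 2 + 2 = i + 4" "i + 2 + 3 = i + 5" "i + 2 + 4 = i" "i + 2 + 5 = i + 1"
  "i + 3 + 1 = i + 4" "i + 3 + 2 = i + 5" "i + 3 + 3 = i" "i + 3 + 4 = i + 1" "i + 3 + 5 = i + 2"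
  "i + 4 + 1 = i + 5" "i + 4 + 2 = i" "i + 4 + 3 = i + 1" "i + 4 + 4 = i + 2" "i + 4 + 5 = i + 3"
  "i + 5 + 1 = i" "i + 5 + 2 = i + 1" "i + 5 + 3 = i + 2" "i + 5 + 4 = i + 3" "i + 5 + 5 = i + 4"
  for i :: 6
  by simp_all

lemma six_eq_0 [simp]: "(6 :: 6) = 0"
  by simp

lemma sum_6_shift: "sum f UNIV = f i + f (i + 1) + f (i + 2) + f (i + 3) + f (i + 4) + f (i + 5)"
  for i :: 6 and f :: "6 \<Rightarrow> 'a::comm_monoid_add"
proof -
  have "sum f UNIV = (\<Sum>k\<in>UNIV. f (i + k))"
    by (rule sum.reindex_bij_witness[of _ "\<lambda>k. i + k" "\<lambda>j. j - i"]) auto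
  then show ?thesis
    unfolding UNIV_6 by (simp add: add_ac)
qed

lemma sum_6: "sum f UNIV = f 0 + f 1 + f 2 + f 3 + f 4 + f 5"
  for f :: "6 \<Rightarrow> 'a::comm_monoid_add"
  using sum_6_shift[of f 0] by simp

section \<open>Brackets of three vectors and their relations\<close>

lemma det2_expand: "det2 a b = a $ 1 * b $ 2 - a $ 2 * b $ 1"
  by (simp add: det2_def det_2)

lemma det3_expand:
  "det3 a b c = a $ 1 * (b $ 2 * c $ 3 - b $ 3 * c $ 2) - a $ 2 * (b $ 1 * c $ 3 - b $ 3 * c $ 1)
    + a $ 3 * (b $ 1 * c $ 2 - b $ 2 * c $ 1)"
  by (simp add: det3_def det_3 algebra_simps)

lemma det3_linear:
  "det3 (a + a') b c = det3 a b c + det3 a' b c" "det3 a (b + b') c = det3 a b c + det3 a b' c"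
  "det3 a b (c + c') = det3 a b c + det3 a b c'"
  "det3 (k *\<^sub>R a) b c = k * det3 a b c" "det3 a (k *\<^sub>R b) c = k * det3 a b c"
  "det3 a b (k *\<^sub>R c) = k * det3 a b c"
  by (simp_all add: det3_expand algebra_simps)

lemma det3_repeat [simp]: "det3 a a b = 0" "det3 a b a = 0" "det3 b a a = 0"
  by (simp_all add: det3_expand algebra_simps)

lemma det3_perm: "det3 b a c = - det3 a b c" "det3 a c b = - det3 a b c" "det3 b c a = det3 a b c" "det3 c a b = det3 a b c"
  by (simp_all add: det3_expand algebra_simps)

lemma det3_cramer: "det3 a b c *\<^sub>R x = det3 x b c *\<^sub>R a + det3 a x c *\<^sub>R b + det3 a b x *\<^sub>R c"
  unfolding vec_eq_iff forall_3 det3_expand by (simp add: algebra_simps)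

text \<open>Projection from \<open>e\<close> turns the brackets into 2x2 determinants of the images
  of \<open>a\<close>, \<open>b\<close>, \<open>c\<close>, \<open>d\<close>; this is the three-term
  relation for four vectors in a plane.\<close>

lemma det3_pluecker: "det3 e a b * det3 e c d - det3 e a c * det3 e b d + det3 e a d * det3 e b c = 0"
  unfolding det3_expand by (simp add: algebra_simps)

text \<open>The letters of each bracket are in alphabetical order. For vertices taken in cyclic
  order all these brackets have the same sign, so the signs in the relations are the true
  ones.\<close>

lemma det3_exchange:
  "det3 a b d * det3 b c e = det3 a b c * det3 b d e + det3 a b e * det3 b c d"
  "det3 a c e * det3 b c d = det3 a c d * det3 b c e - det3 a b c * det3 c d e"
proof -
  show "det3 a b d * det3 b c e = det3 a b c * det3 b d e + det3 a b e * det3 b c d"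
    using det3_pluecker[of b a d c e]
    by (simp add: det3_perm(1)[of b a] det3_perm(2)[of b d c] algebra_simps)
  show "det3 a c e * det3 b c d = det3 a c d * det3 b c e - det3 a b c * det3 c d e"
    using det3_pluecker[of c a b d e]
    by (simp add: det3_perm(1)[of c a] det3_perm(1)[of c b] det3_perm(2)[of a c b] algebra_simps)
qed

text \<open>Two points on the line through \<open>a\<close> and \<open>b\<close> span that line
  again; the factor is the determinant of their coordinates.\<close>

lemma det3_pencil:
  "det3 (k *\<^sub>R a + l *\<^sub>R b) (k' *\<^sub>R a + l' *\<^sub>R b) x = (k * l' - k' * l) * det3 a b x"
  by (simp add: det3_linear det3_perm(1)[of b a] algebra_simps)

lemma det3_matrix: "det3 (A *v a) (A *v b) (A *v c) = det A * det3 a b c"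
proof -
  have "(vector [A *v a, A *v b, A *v c] :: real^3^3) = vector [a, b, c] ** transpose A"
    by (simp add: vec_eq_iff forall_3 matrix_matrix_mult_def matrix_vector_mult_def transpose_def mult.commute)
  then show ?thesis
    by (simp add: det3_def det_mul det_transpose)
qed

lemma det3_homog_lift: "det3 (homog_lift a) (homog_lift b) (homog_lift c) = det2 (b - a) (c - a)"
  by (simp add: det3_expand det2_expand homog_lift_def algebra_simps)

section \<open>Affine points and homogeneous vectors\<close>

lemma homog_lift_nth [simp]: "homog_lift x $ 1 = x $ 1" "homog_lift x $ 2 = x $ 2" "homog_lift x $ 3 = 1"
  by (simp_all add: homog_lift_def)

lemma homog_lift_affine: "homog_lift (u *\<^sub>R a + v *\<^sub>R b) = u *\<^sub>R homog_lift a + v *\<^sub>R homog_lift b"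
  if "u + v = 1"
  using that by (simp add: vec_eq_iff forall_3)

lemma homog_lift_inject [simp]: "homog_lift x = homog_lift y \<longleftrightarrow> x = y"
  by (auto simp: vec_eq_iff forall_3 forall_2)

lemma affine_point_homog_lift [simp]: "affine_point (homog_lift x) = x"
  by (simp add: affine_point_def vec_eq_iff forall_2)

lemma homog_lift_affine_point: "v $ 3 \<noteq> 0 \<Longrightarrow> homog_lift (affine_point v) = (1 / v $ 3) *\<^sub>R v"
  by (simp add: affine_point_def vec_eq_iff forall_3)

lemma affine_point_scaleR: "c \<noteq> 0 \<Longrightarrow> affine_point (c *\<^sub>R v) = affine_point v"
  by (simp add: affine_point_def)

text \<open>The sign \<open>s = 1\<close> describes counterclockwise and \<open>s = - 1\<close> clockwise convex hexagons.\<close>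

definition oriented :: "real \<Rightarrow> (6 \<Rightarrow> real^3) \<Rightarrow> bool" where
  "oriented s p \<longleftrightarrow> (\<forall>i j. j \<noteq> i \<longrightarrow> j \<noteq> i + 1 \<longrightarrow> s * det3 (p i) (p (i + 1)) (p j) > 0)"

lemma oriented_iff:
  "oriented s p \<longleftrightarrow> (\<forall>i. s * det3 (p i) (p (i + 1)) (p (i + 2)) > 0 \<and> s * det3 (p i) (p (i + 1)) (p (i + 3)) > 0 \<and>
     s * det3 (p i) (p (i + 1)) (p (i + 4)) > 0 \<and> s * det3 (p i) (p (i + 1)) (p (i + 5)) > 0)"
  unfolding oriented_def
proof (rule iff_allI)
  fix i :: 6
  show "(\<forall>j. j \<noteq> i \<longrightarrow> j \<noteq> i + 1 \<longrightarrow> s * det3 (p i) (p (i + 1)) (p j) > 0) \<longleftrightarrow>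
    s * det3 (p i) (p (i + 1)) (p (i + 2)) > 0 \<and> s * det3 (p i) (p (i + 1)) (p (i + 3)) > 0 \<and>
     s * det3 (p i) (p (i + 1)) (p (i + 4)) > 0 \<and> s * det3 (p i) (p (i + 1)) (p (i + 5)) > 0"
    by (subst forall_6_shift[of _ i]) simp
qed

lemma convex_hexagons_iff:
  "P \<in> convex_hexagons \<longleftrightarrow> (\<exists>s. s * s = 1 \<and> oriented s (\<lambda>i. homog_lift (P $ i)))"
proof -
  have "s * s = 1 \<longleftrightarrow> s = 1 \<or> s = - 1" for s :: real
    by (simp add: square_eq_1_iff)
  then show ?thesis
    by (auto simp: convex_hexagons_def oriented_def det3_homog_lift)
qed

text \<open>\<open>oriented\<close> speaks only of triples with two adjacent vertices. The one
  triple through \<open>i\<close> without such a pair is \<open>i\<close>, \<open>i + 2\<close>,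
  \<open>i + 4\<close>; a Pluecker relation expresses its bracket by brackets that do contain
  adjacent vertices.\<close>

lemma oriented_triples:
  assumes "oriented s p"
  shows "s * det3 (p i) (p (i + 1)) (p (i + 2)) > 0" "s * det3 (p i) (p (i + 1)) (p (i + 3)) > 0"
    "s * det3 (p i) (p (i + 1)) (p (i + 4)) > 0" "s * det3 (p i) (p (i + 1)) (p (i + 5)) > 0"
    "s * det3 (p i) (p (i + 2)) (p (i + 3)) > 0" "s * det3 (p i) (p (i + 2)) (p (i + 4)) > 0"
    "s * det3 (p i) (p (i + 2)) (p (i + 5)) > 0" "s * det3 (p i) (p (i + 3)) (p (i + 4)) > 0"
    "s * det3 (p i) (p (i + 3)) (p (i + 5)) > 0" "s * det3 (p i) (p (i + 4)) (p (i + 5)) > 0"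
proof -
  have e: "s * det3 (p j) (p (j + 1)) (p (j + 2)) > 0 \<and> s * det3 (p j) (p (j + 1)) (p (j + 3)) > 0 \<and>
     s * det3 (p j) (p (j + 1)) (p (j + 4)) > 0 \<and> s * det3 (p j) (p (j + 1)) (p (j + 5)) > 0" for j
    using assms unfolding oriented_iff by blast
  show "s * det3 (p i) (p (i + 1)) (p (i + 2)) > 0" "s * det3 (p i) (p (i + 1)) (p (i + 3)) > 0"
    "s * det3 (p i) (p (i + 1)) (p (i + 4)) > 0" "s * det3 (p i) (p (i + 1)) (p (i + 5)) > 0"
    using e[of i] by auto
  show 1: "s * det3 (p i) (p (i + 2)) (p (i + 3)) > 0"
    using e[of "i + 2"] by (simp add: det3_perm(3)[of "p (i + 2)" "p (i + 3)" "p i"])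
  show 2: "s * det3 (p i) (p (i + 2)) (p (i + 5)) > 0"
    using e[of "i + 5"] by (simp add: det3_perm(4)[of "p (i + 5)" "p i" "p (i + 2)"])
  show "s * det3 (p i) (p (i + 3)) (p (i + 4)) > 0"
    using e[of "i + 3"] by (simp add: det3_perm(3)[of "p (i + 3)" "p (i + 4)" "p i"])
  show "s * det3 (p i) (p (i + 3)) (p (i + 5)) > 0"
    using e[of "i + 5"] by (simp add: det3_perm(4)[of "p (i + 5)" "p i" "p (i + 3)"])
  show "s * det3 (p i) (p (i + 4)) (p (i + 5)) > 0"
    using e[of "i + 4"] by (simp add: det3_perm(3)[of "p (i + 4)" "p (i + 5)" "p i"])
  have "(s * det3 (p i) (p (i + 2)) (p (i + 4))) * (s * det3 (p (i + 2)) (p (i + 3)) (p (i + 5))) =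
    (s * det3 (p i) (p (i + 2)) (p (i + 3))) * (s * det3 (p (i + 2)) (p (i + 4)) (p (i + 5))) +
    (s * det3 (p i) (p (i + 2)) (p (i + 5))) * (s * det3 (p (i + 2)) (p (i + 3)) (p (i + 4)))"
    using det3_exchange(1)[of "p i" "p (i + 2)" "p (i + 4)" "p (i + 3)" "p (i + 5)"]
    by algebra
  also have "\<dots> > 0"
    using 1 2 e[of "i + 2"] e[of "i + 4"]
    by (simp add: det3_perm(3)[of "p (i + 4)" "p (i + 5)" "p (i + 2)"] add_pos_pos)
  finally show "s * det3 (p i) (p (i + 2)) (p (i + 4)) > 0"
    by (rule zero_less_mult_pos2) (use e[of "i + 2"] in simp)
qed

text \<open>The intersection point of the two diagonals, scaled so that its coefficients with respect to the
  vertices are positive; this scaling keeps all lifts in the cone over the hexagon.\<close>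

definition pent_lift :: "real \<Rightarrow> (6 \<Rightarrow> real^3) \<Rightarrow> 6 \<Rightarrow> real^3" where
  "pent_lift s p i = (s * det3 (p (i + 1)) (p (i + 2)) (p (i + 3))) *\<^sub>R p i
    + (s * det3 (p i) (p (i + 1)) (p (i + 3))) *\<^sub>R p (i + 2)"

text \<open>Cramer's rule for \<open>p i\<close> in terms of the next three vertices, with its terms
  sorted by diagonal: one side lies on the first diagonal, the other on the second, so the vector
  lifts their intersection.\<close>

lemma pent_lift_alt:
  "pent_lift s p i = (s * det3 (p i) (p (i + 2)) (p (i + 3))) *\<^sub>R p (i + 1)
    + (s * det3 (p i) (p (i + 1)) (p (i + 2))) *\<^sub>R p (i + 3)"
proof -
  have "det3 (p (i + 1)) (p (i + 2)) (p (i + 3)) *\<^sub>R p i + det3 (p i) (p (i + 1)) (p (i + 3)) *\<^sub>R p (i + 2)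
    = det3 (p i) (p (i + 2)) (p (i + 3)) *\<^sub>R p (i + 1) + det3 (p i) (p (i + 1)) (p (i + 2)) *\<^sub>R p (i + 3)"
    using det3_cramer[of "p (i + 1)" "p (i + 2)" "p (i + 3)" "p i"]
    by (simp add: det3_perm(1)[of "p (i + 1)" "p i"] det3_perm(3)[of "p (i + 1)" "p (i + 2)" "p i"])
  then show ?thesis
    unfolding pent_lift_def scaleR_scaleR[symmetric] scaleR_add_right[symmetric] by simp
qed

text \<open>Consecutive vertices of the image lie on a common diagonal, so each edge line of the
  image is the line of \<open>p (i + 1)\<close> and \<open>p (i + 3)\<close>. Every other image
  vertex is a positive combination of vertices on the nonnegative side of that diagonal, at least
  one of them strictly inside.\<close>

lemma oriented_pent_lift:
  assumes o: "oriented s p" and s: "s * s = 1"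
  shows "oriented s (pent_lift s p)"
  unfolding oriented_iff
proof
  fix i
  define t where "t = pent_lift s p"
  note tr = oriented_triples[OF o]
  define k where "k = (s * det3 (p i) (p (i + 2)) (p (i + 4))) * (s * det3 (p (i + 1)) (p (i + 2)) (p (i + 3)))"
  have "k > 0"
    unfolding k_def using tr(6)[of i] tr(1)[of "i + 1"] by simp
  have edge: "det3 (t i) (t (i + 1)) x = k * det3 (p (i + 1)) (p (i + 3)) x" for x
  proof -
    have "det3 (t i) (t (i + 1)) x = s * s * (det3 (p i) (p (i + 2)) (p (i + 3)) * det3 (p (i + 1)) (p (i + 2)) (p (i + 4))
      - det3 (p i) (p (i + 1)) (p (i + 2)) * det3 (p (i + 2)) (p (i + 3)) (p (i + 4)))
      * det3 (p (i + 1)) (p (i + 3)) x"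
      \<comment> \<open>The alternative form at \<open>i\<close> and the definition at
        \<open>i + 1\<close> use the same two vertices, \<open>p (i + 1)\<close> and
        \<open>p (i + 3)\<close>; the coordinate determinant then collapses to \<open>k\<close> by
        \<open>det3_exchange(2)\<close>.\<close>
      unfolding t_def pent_lift_alt[of _ _ i] pent_lift_def[of _ _ "i + 1"]
      unfolding add_6 det3_pencil by algebra
    also have "det3 (p i) (p (i + 2)) (p (i + 3)) * det3 (p (i + 1)) (p (i + 2)) (p (i + 4))
      - det3 (p i) (p (i + 1)) (p (i + 2)) * det3 (p (i + 2)) (p (i + 3)) (p (i + 4)) =
      det3 (p i) (p (i + 2)) (p (i + 4)) * det3 (p (i + 1)) (p (i + 2)) (p (i + 3))"
      using det3_exchange(2)[of "p i" "p (i + 2)" "p (i + 4)" "p (i + 1)" "p (i + 3)"] by simp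
    finally show ?thesis unfolding k_def by (simp add: mult_ac)
  qed
  let ?D = "\<lambda>x. s * det3 (p (i + 1)) (p (i + 3)) x"
  have lin: "?D (a *\<^sub>R x + b *\<^sub>R y) = a * ?D x + b * ?D y" for a b x y
    by (simp add: det3_linear algebra_simps)
  have p13: "?D (p (i + 3)) = 0" "?D (p (i + 5)) > 0" "?D (p (i + 4)) > 0" "?D (p i) > 0" "?D (p (i + 1)) = 0"
    using tr(6)[of "i + 1"] tr(5)[of "i + 1"] tr(7)[of "i + 1"] by simp_all
  have "?D (t (i + 2)) > 0"
    unfolding t_def pent_lift_alt lin using p13 tr(1)[of "i + 2"] by simp
  moreover have "?D (t (i + 3)) > 0"
    unfolding t_def pent_lift_def lin using p13 tr(2)[of "i + 3"] by simp
  moreover have "?D (t (i + 4)) > 0"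
    unfolding t_def pent_lift_def lin using p13 tr(1)[of "i + 5"] tr(2)[of "i + 4"] by (simp add: add_pos_pos)
  moreover have "?D (t (i + 5)) > 0"
    unfolding t_def pent_lift_def lin using p13 tr(1)[of "i"] by simp
  moreover have "s * det3 (t i) (t (i + 1)) x > 0" if "?D x > 0" for x
    using mult_pos_pos[OF \<open>k > 0\<close> that] unfolding edge by (simp only: mult_ac)
  ultimately show "s * det3 (pent_lift s p i) (pent_lift s p (i + 1)) (pent_lift s p (i + 2)) > 0 \<and>
    s * det3 (pent_lift s p i) (pent_lift s p (i + 1)) (pent_lift s p (i + 3)) > 0 \<and>
    s * det3 (pent_lift s p i) (pent_lift s p (i + 1)) (pent_lift s p (i + 4)) > 0 \<and>
    s * det3 (pent_lift s p i) (pent_lift s p (i + 1)) (pent_lift s p (i + 5)) > 0"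
    unfolding t_def by blast
qed

text \<open>The scalar must be positive, not just nonzero, so that orientation and the sign of the
  third coordinate pass between lifts and vertices.\<close>

definition represents :: "hexagon \<Rightarrow> (6 \<Rightarrow> real^3) \<Rightarrow> bool" where
  "represents P p \<longleftrightarrow> (\<forall>i. \<exists>c>0. homog_lift (P $ i) = c *\<^sub>R p i)"

lemma represents_homog_lift: "represents P (\<lambda>i. homog_lift (P $ i))"
  unfolding represents_def by (intro allI exI[of _ 1]) simp

lemma oriented_rescale:
  assumes "oriented s p" "\<And>i. c i > 0"
  shows "oriented s (\<lambda>i. c i *\<^sub>R p i)"
proof -
  have *: "s * det3 (c i *\<^sub>R p i) (c (i + 1) *\<^sub>R p (i + 1)) (c j *\<^sub>R p j)
    = (c i * c (i + 1) * c j) * (s * det3 (p i) (p (i + 1)) (p j))" for i j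
    by (simp add: det3_linear)
  show ?thesis
    unfolding oriented_def * using assms unfolding oriented_def by simp
qed

lemma represents_rescale:
  assumes "represents P p" "\<And>i. c i > 0" "\<And>i. p i = c i *\<^sub>R p' i"
  shows "represents P p'"
  unfolding represents_def
proof
  fix i
  obtain d where "d > 0" "homog_lift (P $ i) = d *\<^sub>R p i"
    using assms(1) unfolding represents_def by blast
  then show "\<exists>d>0. homog_lift (P $ i) = d *\<^sub>R p' i"
    using assms(2,3) by (intro exI[of _ "d * c i"]) auto
qed

lemma oriented_represents:
  assumes "oriented s p" "represents P p"
  shows "oriented s (\<lambda>i. homog_lift (P $ i))"
proof -
  obtain c where c: "\<And>i. c i > 0" "\<And>i. homog_lift (P $ i) = c i *\<^sub>R p i"
    using assms(2) unfolding represents_def by metis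
  show ?thesis
    unfolding c(2) using assms(1) c(1) by (rule oriented_rescale)
qed

lemma represents_third: "represents P p \<Longrightarrow> p i $ 3 > 0"
proof -
  assume "represents P p"
  then obtain c where "c > 0" "homog_lift (P $ i) = c *\<^sub>R p i"
    unfolding represents_def by blast
  then have "c * p i $ 3 = 1" "c > 0"
    by (metis homog_lift_nth(3) real_scaleR_def vector_scaleR_component)+
  then show ?thesis
    by (metis mult_pos_pos zero_less_mult_pos zero_less_one)
qed

lemma represents_affine_point: "represents P p \<Longrightarrow> P $ i = affine_point (p i)"
  unfolding represents_def
  by (metis affine_point_homog_lift affine_point_scaleR less_irrefl)

text \<open>Positivity of the four coefficients keeps the third coordinate positive and makes the
  point a convex combination along either diagonal, so it is a finite common point of the two affine
  lines.\<close>

lemma represents_pentagram_homog_lift: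
  fixes P :: hexagon
  defines "h \<equiv> \<lambda>i. homog_lift (P $ i)"
  assumes o: "oriented s h"
  shows "pentagram_defined P" "represents (pentagram P) (pent_lift s h)"
proof -
  note tr = oriented_triples[OF o]
  have main: "pent_lift s h i $ 3 > 0 \<and>
    (\<forall>y. y \<in> affine hull {P $ i, P $ (i + 2)} \<inter> affine hull {P $ (i + 1), P $ (i + 3)} \<longleftrightarrow>
      y = affine_point (pent_lift s h i))" for i
  proof -
    define t where "t = pent_lift s h i"
    define a where "a = s * det3 (h (i + 1)) (h (i + 2)) (h (i + 3))"
    define b where "b = s * det3 (h i) (h (i + 1)) (h (i + 3))"
    define c where "c = s * det3 (h i) (h (i + 2)) (h (i + 3))"
    define d where "d = s * det3 (h i) (h (i + 1)) (h (i + 2))"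
    have pos: "a > 0" "b > 0" "c > 0" "d > 0"
      using tr[of i] tr(1)[of "i + 1"] by (simp_all add: a_def b_def c_def d_def)
    have t1: "t = a *\<^sub>R h i + b *\<^sub>R h (i + 2)"
      by (simp add: t_def pent_lift_def a_def b_def)
    have t2: "t = c *\<^sub>R h (i + 1) + d *\<^sub>R h (i + 3)"
      by (simp add: t_def pent_lift_alt c_def d_def)
    have t3: "t $ 3 = a + b"
      unfolding t1 by (simp add: h_def)
    have t3': "t $ 3 = c + d"
      unfolding t2 by (simp add: h_def)
    have "t $ 3 > 0" using t3 pos by simp
    have lift: "homog_lift (affine_point t) = (1 / t $ 3) *\<^sub>R t"
      using \<open>t $ 3 > 0\<close> by (simp add: homog_lift_affine_point)
    have "affine_point t = (a / (a + b)) *\<^sub>R P $ i + (b / (a + b)) *\<^sub>R P $ (i + 2)"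
    proof -
      have "homog_lift (affine_point t) = homog_lift ((a / (a + b)) *\<^sub>R P $ i + (b / (a + b)) *\<^sub>R P $ (i + 2))"
        using pos unfolding lift t3
        by (subst homog_lift_affine) (simp_all add: t1 h_def scaleR_add_right flip: add_divide_distrib)
      then show ?thesis by simp
    qed
    moreover have "a / (a + b) + b / (a + b) = 1"
      using pos by (simp flip: add_divide_distrib)
    ultimately have in1: "affine_point t \<in> affine hull {P $ i, P $ (i + 2)}"
      unfolding affine_hull_2 by blast
    have "affine_point t = (c / (c + d)) *\<^sub>R P $ (i + 1) + (d / (c + d)) *\<^sub>R P $ (i + 3)"
    proof -
      have "homog_lift (affine_point t) = homog_lift ((c / (c + d)) *\<^sub>R P $ (i + 1) + (d / (c + d)) *\<^sub>R P $ (i + 3))"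
        using pos unfolding lift t3'
        by (subst homog_lift_affine) (simp_all add: t2 h_def scaleR_add_right flip: add_divide_distrib)
      then show ?thesis by simp
    qed
    moreover have "c / (c + d) + d / (c + d) = 1"
      using pos by (simp flip: add_divide_distrib)
    ultimately have in2: "affine_point t \<in> affine hull {P $ (i + 1), P $ (i + 3)}"
      unfolding affine_hull_2 by blast
    have uniq: "y = affine_point t"
      if y: "y \<in> affine hull {P $ i, P $ (i + 2)} \<inter> affine hull {P $ (i + 1), P $ (i + 3)}" for y
    proof -
      obtain u v where uv: "u + v = 1" "y = u *\<^sub>R P $ i + v *\<^sub>R P $ (i + 2)"
        using y unfolding affine_hull_2 by blast
      obtain u' v' where uv': "u' + v' = 1" "y = u' *\<^sub>R P $ (i + 1) + v' *\<^sub>R P $ (i + 3)"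
        using y unfolding affine_hull_2 by blast
      have y1: "homog_lift y = u *\<^sub>R h i + v *\<^sub>R h (i + 2)"
        unfolding uv(2) using uv(1) by (simp add: homog_lift_affine h_def)
      have y2: "homog_lift y = u' *\<^sub>R h (i + 1) + v' *\<^sub>R h (i + 3)"
        unfolding uv'(2) using uv'(1) by (simp add: homog_lift_affine h_def)
      \<comment> \<open>This bracket vanishes on the second diagonal; evaluated on the first one it
        fixes the ratio \<open>u : v\<close>, hence the point.\<close>
      have "s * det3 (homog_lift y) (h (i + 1)) (h (i + 3)) = 0"
        unfolding y2 by (simp add: det3_linear)
      then have "u * b = v * a"
        unfolding y1 a_def b_def
        unfolding det3_linear det3_perm(1)[of "h (i + 2)" "h (i + 1)"] by algebra
      then have "(a + b) * u = a" "(a + b) * v = b"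
        using uv(1) by algebra+
      then have "u = a / (a + b)" "v = b / (a + b)"
        using pos by (simp_all add: field_simps)
      then have "homog_lift y = homog_lift (affine_point t)"
        unfolding lift y1 t3 unfolding t1 by (simp add: scaleR_add_right)
      then show ?thesis by simp
    qed
    show ?thesis
      using \<open>t $ 3 > 0\<close> in1 in2 uniq unfolding t_def by blast
  qed
  have ne: "P $ i \<noteq> P $ (i + 2)" for i
    using tr(1)[of i] unfolding h_def by auto
  have "P $ (i + 1) \<noteq> P $ (i + 3)" for i
    using ne[of "i + 1"] by simp
  then show "pentagram_defined P"
    unfolding pentagram_defined_def using ne main by auto
  have "pentagram P $ i = affine_point (pent_lift s h i)" for i
    unfolding pentagram_def using main[of i] by simp
  then have "homog_lift (pentagram P $ i) = (1 / pent_lift s h i $ 3) *\<^sub>R pent_lift s h i" for i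
    using main[of i] by (simp add: homog_lift_affine_point)
  then show "represents (pentagram P) (pent_lift s h)"
    unfolding represents_def using main by (metis zero_less_divide_1_iff)
qed

text \<open>\<open>pent_lift\<close> is homogeneous of degree one in each of the four vertices
  involved, so positive rescaling of the lifts does not affect the represented hexagon.\<close>

lemma pent_lift_rescale:
  "pent_lift s (\<lambda>i. c i *\<^sub>R p i) i = (c i * c (i + 1) * c (i + 2) * c (i + 3)) *\<^sub>R pent_lift s p i"
  by (simp add: pent_lift_def det3_linear scaleR_add_right mult_ac)

theorem represents_pentagram:
  assumes o: "oriented s p" and r: "represents P p"
  shows "pentagram_defined P" "represents (pentagram P) (pent_lift s p)"
proof -
  note o' = oriented_represents[OF o r]
  show "pentagram_defined P"
    using represents_pentagram_homog_lift(1)[OF o'] .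
  obtain c where c: "\<And>i. c i > 0" "\<And>i. homog_lift (P $ i) = c i *\<^sub>R p i"
    using r unfolding represents_def by metis
  show "represents (pentagram P) (pent_lift s p)"
    by (rule represents_rescale[OF represents_pentagram_homog_lift(2)[OF o'],
        of "\<lambda>i. c i * c (i + 1) * c (i + 2) * c (i + 3)"])
      (simp_all add: c pent_lift_rescale)
qed

text \<open>Projective equivariance of the pentagram map; the factor \<open>det A\<close> is
  harmless exactly when it is positive, which is why the sign of \<open>det G\<close> matters
  later.\<close>

lemma pent_lift_matrix: "pent_lift s (\<lambda>i. A *v p i) i = det A *\<^sub>R (A *v pent_lift s p i)"
  by (simp add: pent_lift_def det3_matrix matrix_vector_mult_scaleR matrix_vector_right_distrib scaleR_add_right mult_ac)

lemma oriented_matrix: "oriented s p \<Longrightarrow> det A > 0 \<Longrightarrow> oriented s (\<lambda>i. A *v p i)"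
  unfolding oriented_def det3_matrix
  using mult_pos_pos[of "det A"] by (simp add: mult.left_commute[of s])

section \<open>Glick's operator and the twice iterated pentagram map\<close>

text \<open>Two distinct planes through the origin meet in a line, so \<open>x\<close> and
  \<open>y\<close> are proportional. Cross-multiplication by a coordinate states this without
  excluding zero vectors.\<close>

lemma det3_concurrent:
  assumes "det3 a b x = 0" "det3 c d x = 0" "det3 a b y = 0" "det3 c d y = 0"
    and "det3 a b c \<noteq> 0" "det3 c d a \<noteq> 0"
  shows "y $ k *\<^sub>R x = x $ k *\<^sub>R y"
proof -
  define D where "D = det3 a b c"
  define \<alpha> \<beta> \<alpha>' \<beta>' where "\<alpha> = det3 x b c" "\<beta> = det3 a x c" "\<alpha>' = det3 y b c" "\<beta>' = det3 a y c"
  have x: "D *\<^sub>R x = \<alpha> *\<^sub>R a + \<beta> *\<^sub>R b"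
    using det3_cramer[of a b c x] assms(1) by (simp add: D_def \<alpha>_\<beta>_\<alpha>'_\<beta>'_def)
  have y: "D *\<^sub>R y = \<alpha>' *\<^sub>R a + \<beta>' *\<^sub>R b"
    using det3_cramer[of a b c y] assms(3) by (simp add: D_def \<alpha>_\<beta>_\<alpha>'_\<beta>'_def)
  have "det3 c d (D *\<^sub>R x) = 0" "det3 c d (D *\<^sub>R y) = 0"
    using assms by (simp_all add: det3_linear)
  then have "\<alpha> * det3 c d a + \<beta> * det3 c d b = 0" "\<alpha>' * det3 c d a + \<beta>' * det3 c d b = 0"
    unfolding x y by (simp_all add: det3_linear)
  then have "det3 c d a * (\<alpha> * \<beta>' - \<alpha>' * \<beta>) = 0"
    by algebra
  then have cross: "\<alpha> * \<beta>' = \<alpha>' * \<beta>"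
    using assms(6) by simp
  have "D * D * (y $ k * x $ j) = D * D * (x $ k * y $ j)" for j
  proof -
    have xs: "D * x $ l = \<alpha> * a $ l + \<beta> * b $ l" and ys: "D * y $ l = \<alpha>' * a $ l + \<beta>' * b $ l" for l
      using arg_cong[OF x, of "\<lambda>v. v $ l"] arg_cong[OF y, of "\<lambda>v. v $ l"] by simp_all
    show ?thesis
      using xs[of j] xs[of k] ys[of j] ys[of k] cross by algebra
  qed
  then show ?thesis
    using assms(5) by (simp add: vec_eq_iff D_def)
qed

lemma sub_6 [simp]:
  "i - 1 = i + 5" "i + 2 - 1 = i + 1" "i + 3 - 1 = i + 2" "i + 4 - 1 = i + 3" "i + 5 - 1 = i + 4" for i :: 6
  by (simp_all add: diff_eq_eq)

lemma G_mat_mult: "G_mat P *v x = glick_of_lifts (\<chi> i. homog_lift (P $ i)) x - 3 *\<^sub>R x"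
proof -
  have "mat 3 *v x = 3 *\<^sub>R x"
    by (simp add: vec_eq_iff matrix_vector_mult_def mat_def if_distrib[of "\<lambda>a. a * _"] cong: if_cong)
  then show ?thesis
    by (simp add: G_mat_def glick_matrix_def matrix_vector_mult_diff_rdistrib matrix_works linear_glick_of_lifts)
qed

text \<open>At \<open>v = h i\<close> the summands of the neighbours have a repeated vertex and
  vanish, and the summand of \<open>i\<close> is \<open>h i\<close> itself, which gives the
  coefficient \<open>6 - 1 - 3 = 2\<close>. Sorting the remaining brackets turns the minus signs
  into plus.\<close>

lemma G_mat_vertex:
  fixes P :: hexagon
  defines "h \<equiv> \<lambda>i. homog_lift (P $ i)"
  assumes "oriented s h"
  shows "G_mat P *v h i = 2 *\<^sub>R h i
    + (det3 (h i) (h (i + 1)) (h (i + 3)) / det3 (h (i + 1)) (h (i + 2)) (h (i + 3))) *\<^sub>R h (i + 2)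
    + (det3 (h i) (h (i + 2)) (h (i + 4)) / det3 (h (i + 2)) (h (i + 3)) (h (i + 4))) *\<^sub>R h (i + 3)
    + (det3 (h i) (h (i + 3)) (h (i + 5)) / det3 (h (i + 3)) (h (i + 4)) (h (i + 5))) *\<^sub>R h (i + 4)"
proof -
  have "det3 (h (i + 5)) (h i) (h (i + 1)) \<noteq> 0"
    using oriented_triples(1)[OF assms(2), of "i + 5"] by auto
  then have "(\<Sum>j\<in>UNIV. (det3 (h (j - 1)) (h i) (h (j + 1)) / det3 (h (j - 1)) (h j) (h (j + 1))) *\<^sub>R h j) =
    h i - (det3 (h i) (h (i + 1)) (h (i + 3)) / det3 (h (i + 1)) (h (i + 2)) (h (i + 3))) *\<^sub>R h (i + 2)
    - (det3 (h i) (h (i + 2)) (h (i + 4)) / det3 (h (i + 2)) (h (i + 3)) (h (i + 4))) *\<^sub>R h (i + 3)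
    - (det3 (h i) (h (i + 3)) (h (i + 5)) / det3 (h (i + 3)) (h (i + 4)) (h (i + 5))) *\<^sub>R h (i + 4)"
    by (subst sum_6_shift[of _ i])
      (simp add: det3_perm(1)[of "h (i + 1)" "h i"] det3_perm(1)[of "h (i + 2)" "h i"] det3_perm(1)[of "h (i + 3)" "h i"])
  moreover have "6 *\<^sub>R v - (v - x - y - z) - 3 *\<^sub>R v = 2 *\<^sub>R v + x + y + z" for v x y z :: "real^3"
    by (simp add: vec_eq_iff)
  ultimately show ?thesis
    unfolding G_mat_mult glick_of_lifts_def vec_lambda_beta h_def[symmetric] by simp
qed

lemma G_mat_vertex_pos:
  fixes P :: hexagon
  defines "h \<equiv> \<lambda>i. homog_lift (P $ i)"
  assumes "oriented s h"
  obtains a b c where "a > 0" "b > 0" "c > 0"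
    "G_mat P *v h i = 2 *\<^sub>R h i + a *\<^sub>R h (i + 2) + b *\<^sub>R h (i + 3) + c *\<^sub>R h (i + 4)"
proof -
  note tr = oriented_triples[OF assms(2)]
  have "x / y > 0" if "s * x > 0" "s * y > 0" for x y :: real
    using that by (auto simp: zero_less_mult_iff zero_less_divide_iff)
  then show ?thesis
    using G_mat_vertex[OF assms(2)[unfolded h_def], of i]
      tr(2)[of i] tr(6)[of i] tr(9)[of i] tr(1)[of "i + 1"] tr(1)[of "i + 2"] tr(1)[of "i + 3"]
    unfolding add_6 by (intro that) (auto simp: h_def)
qed

text \<open>The image of \<open>p0\<close> under \<open>G\<close> lies on a diagonal of the
  pentagram image. Expansion leaves one Pluecker relation centred at \<open>p3\<close>. The
  quotients enter as \<open>a\<close>, \<open>b\<close>, \<open>c\<close> with cleared denominators,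
  which makes the claim a polynomial consequence of the hypotheses.\<close>

lemma glick_on_diagonal:
  assumes a: "a * det3 p1 p2 p3 = det3 p0 p1 p3" and b: "b * det3 p2 p3 p4 = det3 p0 p2 p4"
    and c: "c * det3 p3 p4 p5 = det3 p0 p3 p5"
  shows "det3 (det3 p1 p2 p3 *\<^sub>R p0 + det3 p0 p1 p3 *\<^sub>R p2) (det3 p3 p4 p5 *\<^sub>R p2 + det3 p2 p3 p5 *\<^sub>R p4)
    (2 *\<^sub>R p0 + a *\<^sub>R p2 + b *\<^sub>R p3 + c *\<^sub>R p4) = 0"
proof -
  have "det3 p0 p2 p3 * det3 p3 p4 p5 - det3 p0 p3 p4 * det3 p2 p3 p5 + det3 p0 p3 p5 * det3 p2 p3 p4 = 0"
    using det3_pluecker[of p3 p0 p2 p4 p5]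
    by (simp add: det3_perm(1)[of p3 p0] det3_perm(1)[of p3 p2] det3_perm(2)[of p0 p3 p2])
  then show ?thesis
    using a b c
    by (simp add: det3_linear det3_perm(1)[of p2 p0] det3_perm(2)[of p0 p4 p2] det3_perm(2)[of p0 p4 p3]
        det3_perm(3)[of p2 p4 p0] det3_perm(2)[of p2 p4 p3]) algebra
qed

text \<open>The left side is the intersection of the lines \<open>t i t (i + 2)\<close> and
  \<open>t (i + 1) t (i + 3)\<close>; it is enough that \<open>G\<close> sends \<open>h i\<close> to
  a point on both.\<close>

lemma pent_lift_twice:
  fixes P :: hexagon
  defines "h \<equiv> \<lambda>i. homog_lift (P $ i)"
  assumes o: "oriented s h" and s: "s * s = 1"
  shows "\<exists>k>0. pent_lift s (pent_lift s h) i = k *\<^sub>R (G_mat P *v h i)"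
proof -
  define t where "t = pent_lift s h"
  define u where "u = pent_lift s t i"
  define g where "g = G_mat P *v h i"
  note tr = oriented_triples[OF o]
  have ot: "oriented s t" and ou: "oriented s (pent_lift s t)"
    unfolding t_def using o s by (simp_all add: oriented_pent_lift)
  have ne: "det3 (h (i + 1)) (h (i + 2)) (h (i + 3)) \<noteq> 0" "det3 (h (i + 2)) (h (i + 3)) (h (i + 4)) \<noteq> 0"
    "det3 (h (i + 3)) (h (i + 4)) (h (i + 5)) \<noteq> 0"
    using tr(1)[of "i + 1"] tr(1)[of "i + 2"] tr(1)[of "i + 3"] by auto
  have g_eq: "g = 2 *\<^sub>R h i
    + (det3 (h i) (h (i + 1)) (h (i + 3)) / det3 (h (i + 1)) (h (i + 2)) (h (i + 3))) *\<^sub>R h (i + 2)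
    + (det3 (h i) (h (i + 2)) (h (i + 4)) / det3 (h (i + 2)) (h (i + 3)) (h (i + 4))) *\<^sub>R h (i + 3)
    + (det3 (h i) (h (i + 3)) (h (i + 5)) / det3 (h (i + 3)) (h (i + 4)) (h (i + 5))) *\<^sub>R h (i + 4)"
    unfolding g_def h_def by (rule G_mat_vertex[OF o[unfolded h_def]])
  have g1: "det3 (t i) (t (i + 2)) g = 0"
  proof -
    have "t i = s *\<^sub>R (det3 (h (i + 1)) (h (i + 2)) (h (i + 3)) *\<^sub>R h i + det3 (h i) (h (i + 1)) (h (i + 3)) *\<^sub>R h (i + 2))"
      "t (i + 2) = s *\<^sub>R (det3 (h (i + 3)) (h (i + 4)) (h (i + 5)) *\<^sub>R h (i + 2) + det3 (h (i + 2)) (h (i + 3)) (h (i + 5)) *\<^sub>R h (i + 4))"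
      by (simp_all add: t_def pent_lift_def scaleR_add_right)
    then show ?thesis
      unfolding g_eq by (simp add: det3_linear(4,5) glick_on_diagonal ne)
  qed
  \<comment> \<open>This is the previous incidence for the hexagon read backwards from
    \<open>i\<close>: the roles of \<open>p1\<close> to \<open>p5\<close> are played by
    \<open>h (i + 5)\<close> down to \<open>h (i + 1)\<close>. Reversal flips every bracket, whence
    the factors \<open>- s\<close>.\<close>
  have g2: "det3 (t (i + 1)) (t (i + 3)) g = 0"
  proof -
    have t1: "t (i + 1) = (- s) *\<^sub>R (det3 (h (i + 3)) (h (i + 2)) (h (i + 1)) *\<^sub>R h (i + 4) + det3 (h (i + 4)) (h (i + 3)) (h (i + 1)) *\<^sub>R h (i + 2))"
      by (simp add: t_def pent_lift_alt scaleR_add_right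
          det3_expand[of "h (i + 1)"] det3_expand[of "h (i + 3)"] det3_expand[of "h (i + 4)"]) (simp add: algebra_simps)
    have t3: "t (i + 3) = (- s) *\<^sub>R (det3 (h (i + 5)) (h (i + 4)) (h (i + 3)) *\<^sub>R h i + det3 (h i) (h (i + 5)) (h (i + 3)) *\<^sub>R h (i + 4))"
      by (simp add: t_def pent_lift_alt scaleR_add_right
          det3_expand[of "h i"] det3_expand[of "h (i + 5)"] det3_expand[of "h (i + 3)"]) (simp add: algebra_simps)
    have g': "g = 2 *\<^sub>R h i
      + (det3 (h i) (h (i + 3)) (h (i + 5)) / det3 (h (i + 3)) (h (i + 4)) (h (i + 5))) *\<^sub>R h (i + 4)
      + (det3 (h i) (h (i + 2)) (h (i + 4)) / det3 (h (i + 2)) (h (i + 3)) (h (i + 4))) *\<^sub>R h (i + 3)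
      + (det3 (h i) (h (i + 1)) (h (i + 3)) / det3 (h (i + 1)) (h (i + 2)) (h (i + 3))) *\<^sub>R h (i + 2)"
      unfolding g_eq by simp
    have rev: "det3 x y z = - det3 z y x" for x y z
      by (simp add: det3_expand algebra_simps)
    have "det3 (det3 (h (i + 5)) (h (i + 4)) (h (i + 3)) *\<^sub>R h i + det3 (h i) (h (i + 5)) (h (i + 3)) *\<^sub>R h (i + 4))
      (det3 (h (i + 3)) (h (i + 2)) (h (i + 1)) *\<^sub>R h (i + 4) + det3 (h (i + 4)) (h (i + 3)) (h (i + 1)) *\<^sub>R h (i + 2)) g = 0"
      unfolding g'
      by (rule glick_on_diagonal)
        (use ne in \<open>simp_all add: rev[of "h (i + 5)" "h (i + 4)"] rev[of "h (i + 4)" "h (i + 3)"] rev[of "h (i + 3)" "h (i + 2)"]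
          det3_perm(2)[of "h i" "h (i + 5)" "h (i + 3)"] det3_perm(2)[of "h i" "h (i + 4)" "h (i + 2)"]
          det3_perm(2)[of "h i" "h (i + 3)" "h (i + 1)"]\<close>)
    then have "det3 (t (i + 3)) (t (i + 1)) g = 0"
      unfolding t1 t3 det3_linear(4,5) by simp
    then show ?thesis
      by (simp add: det3_perm(1)[of "t (i + 1)"])
  qed
  have u1: "det3 (t i) (t (i + 2)) u = 0"
    unfolding u_def pent_lift_def by (simp add: det3_linear)
  have u2: "det3 (t (i + 1)) (t (i + 3)) u = 0"
    unfolding u_def pent_lift_alt by (simp add: det3_linear)
  have "det3 (t i) (t (i + 2)) (t (i + 1)) \<noteq> 0" "det3 (t (i + 1)) (t (i + 3)) (t i) \<noteq> 0"
    using oriented_triples(1,2)[OF ot, of i]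
    by (auto simp: det3_perm(2)[of "t i" "t (i + 2)"] det3_perm(3)[of "t (i + 1)"])
  \<comment> \<open>The third coordinate is used because it is positive on both vectors, so that the
    factor of proportionality is positive.\<close>
  from det3_concurrent[OF g1 g2 u1 u2 this, of 3]
  have *: "u $ 3 *\<^sub>R g = g $ 3 *\<^sub>R u" .
  have pos: "represents (pentagram P) t"
    unfolding t_def h_def using represents_pentagram(2)[OF o[unfolded h_def] represents_homog_lift] .
  have "u $ 3 > 0"
    unfolding u_def by (rule represents_third[OF represents_pentagram(2)[OF ot pos]])
  moreover have "g $ 3 > 0"
    by (rule G_mat_vertex_pos[OF o[unfolded h_def], of i]) (simp add: g_def h_def add_pos_pos)
  moreover have "u = (u $ 3 / g $ 3) *\<^sub>R g"
    using arg_cong[OF *, of "\<lambda>v. (1 / g $ 3) *\<^sub>R v"] \<open>g $ 3 > 0\<close> by simp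
  ultimately show ?thesis
    unfolding u_def t_def g_def by (metis divide_pos_pos)
qed

text \<open>Fan triangulation from vertex 0: each bracket is twice the signed area of one
  triangle.\<close>

lemma double_signed_area:
  fixes P :: hexagon
  defines "h \<equiv> \<lambda>i. homog_lift (P $ i)"
  shows "(\<Sum>i\<in>UNIV. det2 (P $ i) (P $ (i + 1))) =
    det3 (h 0) (h 1) (h 2) + det3 (h 0) (h 2) (h 3) + det3 (h 0) (h 3) (h 4) + det3 (h 0) (h 4) (h 5)"
  by (subst sum_6_shift[of _ 0]) (simp add: h_def det3_homog_lift det2_expand algebra_simps)

lemma area_pos:
  assumes "oriented s (\<lambda>i. homog_lift (P $ i))"
  shows "area P > 0"
proof -
  define S where "S = (\<Sum>i\<in>UNIV. det2 (P $ i) (P $ (i + 1)))"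
  have "s * S > 0"
    unfolding S_def double_signed_area
    using oriented_triples(1,5,8,10)[OF assms, of 0] by (simp add: distrib_left add_pos_pos)
  then show ?thesis
    by (auto simp: area_def S_def[symmetric])
qed

section \<open>The dominant eigenvalue\<close>

text \<open>The field is arbitrary since the lemma serves complex eigenvectors, complex left
  eigenvectors and real eigenvectors.\<close>

lemma eigenvector_exists_iff_det:
  fixes B :: "'a::field^'n^'n"
  shows "(\<exists>z. z \<noteq> 0 \<and> B *v z = k *s z) \<longleftrightarrow> det (B - mat k) = 0"
proof -
  have "mat k *v z = k *s z" for z :: "'a^'n"
    by (simp add: vec_eq_iff matrix_vector_mult_def mat_def if_distrib[of "\<lambda>a. a * _"] cong: if_cong)
  then have "(B - mat k) *v z = B *v z - k *s z" for z
    by (simp add: matrix_vector_mult_diff_rdistrib)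
  then have "(\<exists>z. z \<noteq> 0 \<and> B *v z = k *s z) \<longleftrightarrow> \<not> (\<forall>z. (B - mat k) *v z = 0 \<longrightarrow> z = 0)"
    by auto
  also have "\<dots> \<longleftrightarrow> det (B - mat k) = 0"
    using matrix_left_invertible_ker[of "B - mat k"] invertible_left_inverse[of "B - mat k"]
      invertible_det_nz[of "B - mat k"] by metis
  finally show ?thesis .
qed

lemma complex_eigenvalues_det: "complex_eigenvalues A = {k. det (complex_mat A - mat k) = 0}"
  unfolding complex_eigenvalues_def eigenvector_exists_iff_det ..

text \<open>Only the signs of the vertex formula for \<open>G\<close> are kept. As
  \<open>p i\<close>, \<open>p (i + 2)\<close>, \<open>p (i + 3)\<close> form a basis, the positive
  coefficients at the latter two take the place of irreducibility in the Perron-Frobenius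
  arguments.\<close>

definition cone_positive :: "real^3^3 \<Rightarrow> (6 \<Rightarrow> real^3) \<Rightarrow> bool" where
  "cone_positive A p \<longleftrightarrow> (\<forall>i. \<exists>a>0. \<exists>b>0. \<exists>c>0.
    A *v p i = 2 *\<^sub>R p i + a *\<^sub>R p (i + 2) + b *\<^sub>R p (i + 3) + c *\<^sub>R p (i + 4))"

lemma inner_basis_eq_0:
  fixes x :: "real^3"
  assumes "det3 a b c \<noteq> 0" "x \<bullet> a = 0" "x \<bullet> b = 0" "x \<bullet> c = 0"
  shows "x = 0"
proof -
  have "det3 a b c * (x \<bullet> x) = 0"
    using arg_cong[OF det3_cramer[of a b c x], of "\<lambda>y. x \<bullet> y"] assms(2-4) by (simp add: inner_add_right)
  then show ?thesis using assms(1) by simp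
qed

text \<open>The normalized transpose of \<open>A\<close> maps a compact slice of the dual cone to
  itself, and Brouwer's theorem gives a fixed point. If it vanished at some \<open>p i\<close>, the
  eigenvalue equation would make it vanish at \<open>p (i + 2)\<close> and \<open>p (i + 3)\<close>
  too, hence everywhere.\<close>

lemma positive_left_eigenvector:
  assumes o: "oriented s p" and third: "\<And>i. p i $ 3 > 0" and A: "cone_positive A p"
  obtains \<phi> l where "l > 0" "\<And>i. \<phi> \<bullet> p i > 0" "\<And>x. \<phi> \<bullet> (A *v x) = l * (\<phi> \<bullet> x)"
proof -
  \<comment> \<open>Pairing with the sum of the vertices is the normalization: on \<open>S\<close>
    it bounds each pairing with a vertex by 1, and three such pairings determine \<open>x\<close>,
    so \<open>S\<close> is bounded.\<close>
  define m where "m = (\<Sum>i\<in>UNIV. p i)"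
  define S where "S = {x. (\<forall>i. x \<bullet> p i \<ge> 0) \<and> x \<bullet> m = 1}"
  have ne: "det3 (p i) (p (i + 2)) (p (i + 3)) \<noteq> 0" for i
    using oriented_triples(5)[OF o, of i] by auto
  have inner_m: "x \<bullet> m = (\<Sum>i\<in>UNIV. x \<bullet> p i)" for x
    by (simp add: m_def inner_sum_right)
  have S_le: "x \<bullet> p i \<le> 1" if "x \<in> S" for x i
  proof -
    have "x \<bullet> p i \<le> (\<Sum>i\<in>UNIV. x \<bullet> p i)"
      using that by (intro member_le_sum) (auto simp: S_def)
    then show ?thesis using that by (simp add: S_def inner_m)
  qed
  have "closed S"
    unfolding S_def Collect_conj_eq Collect_all_eq
    by (intro closed_Int closed_INT ballI closed_Collect_le closed_Collect_eq continuous_intros)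
  moreover have "bounded S"
  proof -
    define L :: "real^3 \<Rightarrow> real^3" where "L x = vector [x \<bullet> p 0, x \<bullet> p 2, x \<bullet> p 3]" for x
    have "linear L"
      by (rule linearI) (simp_all add: L_def vec_eq_iff forall_3 inner_add_left)
    moreover have "inj L"
    proof -
      have "x = 0" if "L x = 0" for x
        using that inner_basis_eq_0[of "p 0" "p 2" "p 3" x] ne[of 0] by (simp add: L_def vec_eq_iff forall_3)
      then show ?thesis
        using \<open>linear L\<close> by (simp add: linear_injective_0)
    qed
    ultimately obtain B where B: "B > 0" "\<And>x. B * norm x \<le> norm (L x)"
      using linear_inj_bounded_below_pos by blast
    have "norm x \<le> 3 / B" if "x \<in> S" for x
    proof -
      have "norm (L x) \<le> (\<Sum>i\<in>UNIV. \<bar>L x $ i\<bar>)"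
        by (rule norm_le_l1_cart)
      also have "\<dots> \<le> 3"
        using S_le[OF that, of 0] S_le[OF that, of 2] S_le[OF that, of 3] that
        by (simp add: sum_3 L_def S_def)
      finally show ?thesis
        using B(1) B(2)[of x] by (simp add: field_simps)
    qed
    then show ?thesis unfolding bounded_iff by blast
  qed
  ultimately have "compact S"
    by (simp add: compact_eq_bounded_closed)
  have "convex S"
    unfolding convex_def S_def by (auto simp: inner_add_left)
  have "S \<noteq> {}"
  proof -
    define e :: "real^3" where "e = axis 3 1"
    have e: "e \<bullet> p i > 0" for i
      using third by (simp add: e_def inner_axis')
    then have "e \<bullet> m > 0"
      unfolding inner_m by (intro sum_pos) auto
    then have "(1 / (e \<bullet> m)) *\<^sub>R e \<in> S"
      using e by (auto simp: S_def less_imp_le)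
    then show ?thesis by blast
  qed
  have adj: "(transpose A *v x) \<bullet> y = x \<bullet> (A *v y)" for x y
    by (simp add: dot_lmul_matrix)
  have grow: "x \<bullet> (A *v p i) \<ge> 2 * (x \<bullet> p i)" if "\<And>i. x \<bullet> p i \<ge> 0" for x i
  proof -
    obtain a b c where "a > 0" "b > 0" "c > 0"
      "A *v p i = 2 *\<^sub>R p i + a *\<^sub>R p (i + 2) + b *\<^sub>R p (i + 3) + c *\<^sub>R p (i + 4)"
      using A unfolding cone_positive_def by blast
    then show ?thesis using that by (simp add: inner_add_right)
  qed
  have "x \<bullet> (A *v m) = (\<Sum>i\<in>UNIV. x \<bullet> (A *v p i))" for x
    by (simp add: m_def linear_sum[OF matrix_vector_mul_linear] inner_sum_right)
  \<comment> \<open>The coefficient 2 of \<open>p i\<close> keeps the normalizing denominator away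
    from zero.\<close>
  then have den: "x \<bullet> (A *v m) \<ge> 2" if "x \<in> S" for x
    using sum_mono[of UNIV "\<lambda>i. 2 * (x \<bullet> p i)" "\<lambda>i. x \<bullet> (A *v p i)"] grow[of x] that
    by (simp add: S_def inner_m flip: sum_distrib_left)
  define F where "F x = (1 / (x \<bullet> (A *v m))) *\<^sub>R (transpose A *v x)" for x
  have "continuous_on S F"
    unfolding F_def using den
    by (intro continuous_intros matrix_vector_mult_linear_continuous_on) force
  moreover have "F \<in> S \<rightarrow> S"
  proof
    fix x assume "x \<in> S"
    then have "x \<bullet> (A *v p i) \<ge> 0" for i
      using grow[of x i] by (auto simp: S_def) (smt (verit, best))
    then show "F x \<in> S"
      using den[OF \<open>x \<in> S\<close>] by (simp add: S_def F_def adj del: transpose_matrix_vector)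
  qed
  ultimately obtain \<phi> where \<phi>: "\<phi> \<in> S" "F \<phi> = \<phi>"
    using brouwer[OF \<open>compact S\<close> \<open>convex S\<close> \<open>S \<noteq> {}\<close>] by blast
  define l where "l = \<phi> \<bullet> (A *v m)"
  have "l > 0" using den[OF \<phi>(1)] by (simp add: l_def)
  have "transpose A *v \<phi> = l *\<^sub>R F \<phi>"
    using \<open>l > 0\<close> by (simp add: F_def l_def)
  then have eig: "\<phi> \<bullet> (A *v x) = l * (\<phi> \<bullet> x)" for x
    unfolding \<phi>(2) adj[symmetric] by simp
  have "\<phi> \<bullet> p i > 0" for i
  proof (rule ccontr)
    assume "\<not> \<phi> \<bullet> p i > 0"
    then have 0: "\<phi> \<bullet> p i = 0" and nn: "\<And>j. \<phi> \<bullet> p j \<ge> 0"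
      using \<phi>(1) by (auto simp: S_def not_less intro: antisym)
    obtain a b c where abc: "a > 0" "b > 0" "c > 0"
      "A *v p i = 2 *\<^sub>R p i + a *\<^sub>R p (i + 2) + b *\<^sub>R p (i + 3) + c *\<^sub>R p (i + 4)"
      using A unfolding cone_positive_def by blast
    then have "a * (\<phi> \<bullet> p (i + 2)) + b * (\<phi> \<bullet> p (i + 3)) + c * (\<phi> \<bullet> p (i + 4)) = 0"
      using eig[of "p i"] 0 by (simp add: inner_add_right)
    moreover have "a * (\<phi> \<bullet> p (i + 2)) \<ge> 0" "b * (\<phi> \<bullet> p (i + 3)) \<ge> 0" "c * (\<phi> \<bullet> p (i + 4)) \<ge> 0"
      using abc nn by simp_all
    ultimately have "a * (\<phi> \<bullet> p (i + 2)) = 0" "b * (\<phi> \<bullet> p (i + 3)) = 0"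
      by linarith+
    then have "\<phi> = 0"
      using 0 abc by (intro inner_basis_eq_0[OF ne[of i]]) auto
    then show False using \<phi>(1) by (simp add: S_def)
  qed
  then show ?thesis using that \<open>l > 0\<close> eig by blast
qed

text \<open>Brouwer's theorem again, now on the hexagon at height 1 with \<open>A\<close> followed
  by rescaling to height 1. Pairing the fixed point with \<phi>, which is positive there, identifies
  its eigenvalue as \<open>l\<close>.\<close>

lemma positive_right_eigenvector:
  assumes A: "cone_positive A p" and third: "\<And>i. p i $ 3 = 1"
    and \<phi>: "\<And>i. \<phi> \<bullet> p i > 0" "\<And>x. \<phi> \<bullet> (A *v x) = l * (\<phi> \<bullet> x)"
  obtains v where "v $ 3 = 1" "A *v v = l *\<^sub>R v" "\<phi> \<bullet> v > 0"
proof -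
  define K where "K = convex hull (range p)"
  define cone where "cone = {y. \<exists>\<kappa>>0. \<exists>z\<in>K. y = \<kappa> *\<^sub>R z}"
  have "convex K" by (simp add: K_def convex_convex_hull)
  have scale: "\<kappa> *\<^sub>R x \<in> cone" if "x \<in> cone" "\<kappa> > 0" for x \<kappa>
  proof -
    obtain a z where "a > 0" "z \<in> K" "x = a *\<^sub>R z"
      using \<open>x \<in> cone\<close> by (auto simp: cone_def)
    then show ?thesis
      unfolding cone_def using \<open>\<kappa> > 0\<close> by (auto intro!: exI[of _ "\<kappa> * a"])
  qed
  have add: "x + y \<in> cone" if xy: "x \<in> cone" "y \<in> cone" for x y
  proof -
    obtain a z b w where x: "a > 0" "z \<in> K" "x = a *\<^sub>R z" and y: "b > 0" "w \<in> K" "y = b *\<^sub>R w"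
      using xy by (auto simp: cone_def)
    have "(a / (a + b)) *\<^sub>R z + (b / (a + b)) *\<^sub>R w \<in> K"
      using x y by (intro convexD[OF \<open>convex K\<close>]) (auto simp flip: add_divide_distrib)
    moreover have "x + y = (a + b) *\<^sub>R ((a / (a + b)) *\<^sub>R z + (b / (a + b)) *\<^sub>R w)"
      using x y by (simp add: scaleR_add_right)
    ultimately show ?thesis
      using x y unfolding cone_def by (metis (mono_tags, lifting) add_pos_pos mem_Collect_eq)
  qed
  have p: "p i \<in> cone" for i
    unfolding cone_def K_def by (auto intro!: exI[of _ 1] bexI[of _ "p i"] hull_inc)
  have K3: "K \<subseteq> {y. y $ 3 = 1}"
    unfolding K_def by (rule hull_minimal) (auto simp: third convex_def)
  have K\<phi>: "K \<subseteq> {y. \<phi> \<bullet> y > 0}"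
    unfolding K_def by (rule hull_minimal) (auto simp: \<phi>(1) convex_halfspace_gt)
  have AK: "A *v y \<in> cone" if "y \<in> K" for y
  proof -
    have "A *v p i \<in> cone" for i
    proof -
      obtain a b c where "a > 0" "b > 0" "c > 0"
        "A *v p i = 2 *\<^sub>R p i + a *\<^sub>R p (i + 2) + b *\<^sub>R p (i + 3) + c *\<^sub>R p (i + 4)"
        using A unfolding cone_positive_def by blast
      then show ?thesis by (simp add: add scale p)
    qed
    moreover have "convex {y. A *v y \<in> cone}"
    proof (rule convexI)
      fix x y and u v :: real
      assume h: "x \<in> {y. A *v y \<in> cone}" "y \<in> {y. A *v y \<in> cone}" "u \<ge> 0" "v \<ge> 0" "u + v = 1"
      \<comment> \<open>\<open>cone\<close> omits the apex, so it is closed under positive scaling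
        only and zero weights are treated separately.\<close>
      then show "u *\<^sub>R x + v *\<^sub>R y \<in> {y. A *v y \<in> cone}"
        by (cases "u = 0"; cases "v = 0")
          (auto simp: matrix_vector_right_distrib matrix_vector_mult_scaleR intro!: add scale)
    qed
    ultimately have "K \<subseteq> {y. A *v y \<in> cone}"
      unfolding K_def by (intro hull_minimal) auto
    then show ?thesis using that by blast
  qed
  define F where "F y = (1 / (A *v y) $ 3) *\<^sub>R (A *v y)" for y
  have F: "(A *v y) $ 3 > 0 \<and> F y \<in> K" if "y \<in> K" for y
  proof -
    obtain \<kappa> z where "\<kappa> > 0" "z \<in> K" "A *v y = \<kappa> *\<^sub>R z"
      using AK[OF \<open>y \<in> K\<close>] by (auto simp: cone_def)
    moreover have "z $ 3 = 1" using K3 \<open>z \<in> K\<close> by auto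
    ultimately show ?thesis by (simp add: F_def)
  qed
  have "continuous_on K F"
    unfolding F_def using F
    by (intro continuous_intros matrix_vector_mult_linear_continuous_on) force
  moreover have "compact K"
    unfolding K_def by (intro finite_imp_compact_convex_hull) simp
  moreover have "K \<noteq> {}" by (simp add: K_def)
  ultimately obtain v where v: "v \<in> K" "F v = v"
    using brouwer[OF _ \<open>convex K\<close>, of F] F by blast
  define \<kappa> where "\<kappa> = (A *v v) $ 3"
  have "A *v v = \<kappa> *\<^sub>R F v"
    using F[OF v(1)] by (simp add: F_def \<kappa>_def)
  then have Av: "A *v v = \<kappa> *\<^sub>R v" by (simp add: v(2))
  have "\<phi> \<bullet> v > 0" "v $ 3 = 1" using v(1) K\<phi> K3 by auto
  moreover have "\<kappa> = l"
    using \<phi>(2)[of v] \<open>\<phi> \<bullet> v > 0\<close> unfolding Av by simp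
  ultimately show ?thesis using that Av by blast
qed

text \<open>For a left eigenvector \<open>\<Psi>\<close> of another eigenvalue, compare \<open>|\<Psi> (A p)|\<close> with \<open>\<phi> (A p)\<close> at the vertex where
  \<open>|\<Psi>| / \<phi>\<close> is maximal; equality in the triangle inequality would make \<open>\<Psi>\<close> a multiple of \<open>\<phi>\<close>.\<close>

lemma dominant_eigenvalue:
  assumes o: "oriented s p" and A: "cone_positive A p"
    and \<phi>: "\<And>i. \<phi> \<bullet> p i > 0" "\<And>x. \<phi> \<bullet> (A *v x) = l * (\<phi> \<bullet> x)" and "l > 0"
    and k: "k \<in> complex_eigenvalues A" "k \<noteq> of_real l"
  shows "cmod k < l"
proof (rule ccontr)
  assume "\<not> cmod k < l"
  \<comment> \<open>An eigenvector of the transpose is a left eigenvector of \<open>A\<close>, that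
    is, a complex functional that \<open>A\<close> scales by \<open>k\<close>.\<close>
  have "transpose (complex_mat A - mat k) = transpose (complex_mat A) - mat k"
    by (simp add: vec_eq_iff transpose_def mat_def)
  then have "det (transpose (complex_mat A) - mat k) = 0"
    using k(1) det_transpose[of "complex_mat A - mat k"] by (simp add: complex_eigenvalues_det)
  from iffD2[OF eigenvector_exists_iff_det this]
  obtain \<psi> where \<psi>: "\<psi> \<noteq> 0" "transpose (complex_mat A) *v \<psi> = k *s \<psi>"
    by blast
  define \<Psi> where "\<Psi> x = (\<Sum>j\<in>UNIV. \<psi> $ j * of_real (x $ j))" for x :: "real^3"
  have lin: "\<Psi> (x + y) = \<Psi> x + \<Psi> y" "\<Psi> (t *\<^sub>R x) = of_real t * \<Psi> x" for x y t
    by (simp_all add: \<Psi>_def algebra_simps sum.distrib sum_distrib_left)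
  have eig: "\<Psi> (A *v x) = k * \<Psi> x" for x
  proof -
    have "(\<Sum>i\<in>UNIV. \<psi> $ i * complex_of_real (A $ i $ j)) = k * \<psi> $ j" for j
      using arg_cong[OF \<psi>(2), of "\<lambda>v. v $ j"]
      by (simp add: complex_mat_def vector_matrix_mult_def mult.commute)
    then have "k * \<Psi> x = (\<Sum>j\<in>UNIV. (\<Sum>i\<in>UNIV. \<psi> $ i * complex_of_real (A $ i $ j)) * of_real (x $ j))"
      by (simp add: \<Psi>_def sum_distrib_left mult.assoc)
    also have "\<dots> = \<Psi> (A *v x)"
      by (simp add: \<Psi>_def matrix_vector_mult_def sum_3 algebra_simps)
    finally show ?thesis by simp
  qed
  \<comment> \<open>Real-linear maps to the complex numbers that agree on a basis agree everywhere,
    put as a contradiction.\<close>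
  have unique: "\<exists>x. f x \<noteq> g x \<Longrightarrow> det3 a b c \<noteq> 0 \<Longrightarrow> f a = g a \<Longrightarrow> f b = g b \<Longrightarrow> f c = g c \<Longrightarrow> False"
    if f: "\<And>x y. f (x + y) = f x + f y" "\<And>t x. f (t *\<^sub>R x) = of_real t * f x"
      and g: "\<And>x y. g (x + y) = g x + g y" "\<And>t x. g (t *\<^sub>R x) = of_real t * g x"
    for f g :: "real^3 \<Rightarrow> complex" and a b c
  proof -
    assume h: "\<exists>x. f x \<noteq> g x" "det3 a b c \<noteq> 0" "f a = g a" "f b = g b" "f c = g c"
    obtain x where "f x \<noteq> g x" using h(1) by blast
    moreover have "f (det3 a b c *\<^sub>R x) = g (det3 a b c *\<^sub>R x)"
      unfolding det3_cramer[of a b c x] f g using h(3-5) by simp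
    ultimately show False using h(2) f(2) g(2) by simp
  qed
  have ne: "det3 (p i) (p (i + 2)) (p (i + 3)) \<noteq> 0" for i
    using oriented_triples(5)[OF o, of i] by auto
  define r where "r i = cmod (\<Psi> (p i)) / (\<phi> \<bullet> p i)" for i
  define m where "m = Max (range r)"
  have "m \<in> range r"
    unfolding m_def by (rule Max_in) auto
  then obtain i where i: "r i = m"
    by blast
  have le: "cmod (\<Psi> (p j)) \<le> m * (\<phi> \<bullet> p j)" for j
  proof -
    have "r j \<le> m" by (simp add: m_def)
    then show ?thesis using \<phi>(1)[of j] by (simp add: r_def field_simps)
  qed
  have eq: "cmod (\<Psi> (p i)) = m * (\<phi> \<bullet> p i)"
    using i \<phi>(1)[of i] by (simp add: r_def field_simps)
  have "m > 0"
  proof (rule ccontr)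
    assume "\<not> m > 0"
    then have "m * (\<phi> \<bullet> p j) \<le> 0" for j
      using \<phi>(1)[of j] by (simp add: mult_nonpos_nonneg)
    then have "\<Psi> (p j) = 0" for j
      using le[of j] by (metis norm_le_zero_iff order_trans)
    moreover have "\<exists>x. \<Psi> x \<noteq> 0"
    proof -
      obtain j where "\<psi> $ j \<noteq> 0" using \<psi>(1) by (auto simp: vec_eq_iff)
      then have "\<Psi> (axis j 1) \<noteq> 0"
        by (simp add: \<Psi>_def axis_def if_distrib cong: if_cong)
      then show ?thesis by blast
    qed
    ultimately show False
      using unique[of \<Psi> "\<lambda>x. 0", OF lin _ _ _ ne[of 0]] by simp
  qed
  obtain a b c where abc: "a > 0" "b > 0" "c > 0"
    "A *v p i = 2 *\<^sub>R p i + a *\<^sub>R p (i + 2) + b *\<^sub>R p (i + 3) + c *\<^sub>R p (i + 4)"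
    using A unfolding cone_positive_def by blast
  define z where "z = k * \<Psi> (p i)"
  have z_ge: "cmod z \<ge> l * (m * (\<phi> \<bullet> p i))"
    unfolding z_def norm_mult eq using \<open>\<not> cmod k < l\<close> \<open>m > 0\<close> \<phi>(1)[of i]
    by (intro mult_right_mono) auto
  then have "cmod z > 0"
    using \<open>l > 0\<close> \<open>m > 0\<close> \<phi>(1)[of i] by (smt (verit) mult_pos_pos)
  \<comment> \<open>The unit complex number that turns \<open>z\<close> to the positive real axis;
    then \<rho> attains the full modulus at \<open>A *v p i\<close> and nowhere exceeds the bound by
    \<open>m\<close> and \<phi> at the vertices.\<close>
  define \<omega> where "\<omega> = cnj z / of_real (cmod z)"
  define \<rho> where "\<rho> x = Re (\<omega> * \<Psi> x)" for x
  have "cmod \<omega> = 1"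
    using \<open>cmod z > 0\<close> by (simp add: \<omega>_def norm_divide)
  have \<rho>_le: "\<rho> (p j) \<le> m * (\<phi> \<bullet> p j)" for j
  proof -
    have "\<rho> (p j) \<le> cmod (\<omega> * \<Psi> (p j))"
      unfolding \<rho>_def by (rule complex_Re_le_cmod)
    then show ?thesis using le[of j] by (simp add: norm_mult \<open>cmod \<omega> = 1\<close>)
  qed
  have "\<omega> * z = of_real (cmod z)"
    using \<open>cmod z > 0\<close> complex_norm_square[of z]
    by (simp add: \<omega>_def power2_eq_square mult.commute divide_eq_eq)
  then have "\<rho> (A *v p i) = cmod z"
    unfolding \<rho>_def eig z_def[symmetric] by simp
  moreover have "\<rho> (A *v p i) = 2 * \<rho> (p i) + a * \<rho> (p (i + 2)) + b * \<rho> (p (i + 3)) + c * \<rho> (p (i + 4))"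
    unfolding abc(4) \<rho>_def by (simp only: lin distrib_left) (simp add: algebra_simps)
  moreover have "l * (m * (\<phi> \<bullet> p i)) = m * (\<phi> \<bullet> (A *v p i))"
    unfolding \<phi>(2) by simp
  moreover have "\<phi> \<bullet> (A *v p i) = 2 * (\<phi> \<bullet> p i) + a * (\<phi> \<bullet> p (i + 2)) + b * (\<phi> \<bullet> p (i + 3)) + c * (\<phi> \<bullet> p (i + 4))"
    unfolding abc(4) by (simp add: inner_add_right)
  ultimately have "2 * \<rho> (p i) + a * \<rho> (p (i + 2)) + b * \<rho> (p (i + 3)) + c * \<rho> (p (i + 4)) \<ge>
    2 * (m * (\<phi> \<bullet> p i)) + a * (m * (\<phi> \<bullet> p (i + 2))) + b * (m * (\<phi> \<bullet> p (i + 3))) + c * (m * (\<phi> \<bullet> p (i + 4)))"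
    using z_ge by (simp add: algebra_simps)
  moreover have "a * \<rho> (p (i + 2)) \<le> a * (m * (\<phi> \<bullet> p (i + 2)))" "b * \<rho> (p (i + 3)) \<le> b * (m * (\<phi> \<bullet> p (i + 3)))"
    "c * \<rho> (p (i + 4)) \<le> c * (m * (\<phi> \<bullet> p (i + 4)))"
    using abc \<rho>_le by (simp_all add: mult_left_mono)
  moreover note \<rho>_le[of i]
  \<comment> \<open>A sum of termwise upper bounds that is attained forces equality in each
    term.\<close>
  ultimately have "\<rho> (p i) = m * (\<phi> \<bullet> p i)" "a * \<rho> (p (i + 2)) = a * (m * (\<phi> \<bullet> p (i + 2)))"
    "b * \<rho> (p (i + 3)) = b * (m * (\<phi> \<bullet> p (i + 3)))"
    by linarith+
  then have \<rho>_eq: "\<rho> (p i) = m * (\<phi> \<bullet> p i)" "\<rho> (p (i + 2)) = m * (\<phi> \<bullet> p (i + 2))"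
    "\<rho> (p (i + 3)) = m * (\<phi> \<bullet> p (i + 3))"
    using abc by simp_all
  have real: "\<omega> * \<Psi> (p j) = of_real (m * (\<phi> \<bullet> p j))" if "\<rho> (p j) = m * (\<phi> \<bullet> p j)" for j
  proof -
    have "cmod (\<omega> * \<Psi> (p j)) \<le> Re (\<omega> * \<Psi> (p j))"
      using that le[of j] by (simp add: norm_mult \<open>cmod \<omega> = 1\<close> \<rho>_def)
    then have "(cmod (\<omega> * \<Psi> (p j)))\<^sup>2 \<le> (Re (\<omega> * \<Psi> (p j)))\<^sup>2"
      by (intro power_mono) auto
    then have "(Im (\<omega> * \<Psi> (p j)))\<^sup>2 \<le> 0"
      unfolding cmod_power2 by linarith
    then have "Im (\<omega> * \<Psi> (p j)) = 0" by simp
    then show ?thesis using that by (simp add: complex_eq_iff \<rho>_def)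
  qed
  have "\<omega> * \<Psi> x = of_real (m * (\<phi> \<bullet> x))" for x
  proof (rule ccontr)
    assume "\<omega> * \<Psi> x \<noteq> of_real (m * (\<phi> \<bullet> x))"
    then have "\<exists>x. \<omega> * \<Psi> x \<noteq> of_real (m * (\<phi> \<bullet> x))" by blast
    from unique[of "\<lambda>x. \<omega> * \<Psi> x" "\<lambda>x. of_real (m * (\<phi> \<bullet> x))", OF _ _ _ _ this ne[of i]]
    show False
      using real[OF \<rho>_eq(1)] real[OF \<rho>_eq(2)] real[OF \<rho>_eq(3)] by (simp add: lin algebra_simps inner_add_right)
  qed
  note all = this
  have "k * (\<omega> * \<Psi> (p i)) = \<omega> * \<Psi> (A *v p i)"
    by (simp add: eig)
  then have "k * of_real (m * (\<phi> \<bullet> p i)) = of_real (m * (l * (\<phi> \<bullet> p i)))"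
    unfolding all \<phi>(2) .
  then have "k = of_real l"
    using \<open>m > 0\<close> \<phi>(1)[of i] by (simp add: mult.left_commute)
  then show False using k(2) by simp
qed

section \<open>Iterates and normalized iterates\<close>

lemma funpow_matrix_linear:
  fixes A :: "real^'n^'n"
  shows "((*v) A ^^ q) (x + y) = ((*v) A ^^ q) x + ((*v) A ^^ q) y"
    and "((*v) A ^^ q) (c *\<^sub>R x) = c *\<^sub>R ((*v) A ^^ q) x"
  by (induction q) (simp_all add: matrix_vector_right_distrib matrix_vector_mult_scaleR)

lemma oriented_funpow_matrix:
  "oriented s p \<Longrightarrow> det A > 0 \<Longrightarrow> oriented s (\<lambda>i. ((*v) A ^^ q) (p i))"
  by (induction q) (simp_all add: oriented_matrix)

lemma pent_lift_funpow_matrix: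
  "pent_lift s (\<lambda>i. ((*v) A ^^ q) (p i)) i = det A ^ q *\<^sub>R ((*v) A ^^ q) (pent_lift s p i)"
proof (induction q)
  case (Suc q)
  have "pent_lift s (\<lambda>i. ((*v) A ^^ Suc q) (p i)) i = pent_lift s (\<lambda>i. A *v ((*v) A ^^ q) (p i)) i"
    by simp
  also have "\<dots> = det A *\<^sub>R (A *v (det A ^ q *\<^sub>R ((*v) A ^^ q) (pent_lift s p i)))"
    unfolding pent_lift_matrix Suc ..
  finally show ?case by (simp add: matrix_vector_mult_scaleR)
qed simp

lemma represents_iterates:
  assumes "oriented s p" "s * s = 1" "represents P p"
  shows "\<exists>p'. oriented s p' \<and> represents ((pentagram ^^ k) P) p'"
proof (induction k)
  case (Suc k)
  then show ?case
    using represents_pentagram(2) oriented_pent_lift[OF _ assms(2)] by simp blast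
qed (use assms in auto)

lemma iterates_defined:
  assumes "oriented s (\<lambda>i. homog_lift (P $ i))" "s * s = 1"
  shows "pentagram_defined ((pentagram ^^ k) P)" "area ((pentagram ^^ k) P) > 0"
    "oriented s (\<lambda>i. homog_lift ((pentagram ^^ k) P $ i))"
proof -
  obtain p where p: "oriented s p" "represents ((pentagram ^^ k) P) p"
    using represents_iterates[OF assms represents_homog_lift] by blast
  show o: "oriented s (\<lambda>i. homog_lift ((pentagram ^^ k) P $ i))"
    using oriented_represents[OF p] .
  show "pentagram_defined ((pentagram ^^ k) P)"
    using represents_pentagram(1)[OF p] .
  show "area ((pentagram ^^ k) P) > 0"
    using area_pos[OF o] .
qed

lemma represents_unique:
  assumes "represents P p" "represents Q q" "\<And>i. \<exists>c\<noteq>0. p i = c *\<^sub>R q i"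
  shows "P = Q"
proof -
  have "P $ i = Q $ i" for i
  proof -
    obtain c where "c \<noteq> 0" "p i = c *\<^sub>R q i" using assms(3) by blast
    then show ?thesis
      unfolding represents_affine_point[OF assms(1)] represents_affine_point[OF assms(2)]
      by (simp add: affine_point_scaleR)
  qed
  then show ?thesis by (simp add: vec_eq_iff)
qed

section \<open>Pentagram iterates as orbits of the matrix\<close>

lemma cone_positive_G_mat:
  assumes "oriented s (\<lambda>i. homog_lift (P $ i))"
  shows "cone_positive (G_mat P) (\<lambda>i. homog_lift (P $ i))"
  unfolding cone_positive_def using G_mat_vertex_pos[OF assms] by metis

text \<open>The hexagon and its second pentagram image have the same orientation, while the matrix
  multiplies every bracket by its determinant; one triple decides the sign.\<close>

lemma det_G_mat_pos:
  assumes o: "oriented s (\<lambda>i. homog_lift (P $ i))" and s: "s * s = 1"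
  shows "det (G_mat P) > 0"
proof -
  define h where "h = (\<lambda>i. homog_lift (P $ i))"
  define u where "u = pent_lift s (pent_lift s h)"
  have oh: "oriented s h" using o by (simp add: h_def)
  have ou: "oriented s u"
    unfolding u_def using oh s by (simp add: oriented_pent_lift)
  have "\<exists>k>0. u i = k *\<^sub>R (G_mat P *v h i)" for i
    using pent_lift_twice[OF o s, of i] by (simp add: u_def h_def)
  then obtain k where k: "\<And>i. k i > 0" "\<And>i. u i = k i *\<^sub>R (G_mat P *v h i)"
    by metis
  have "0 < s * det3 (u 0) (u 1) (u 2)"
    using oriented_triples(1)[OF ou, of 0] by simp
  also have "\<dots> = (k 0 * k 1 * k 2 * det (G_mat P)) * (s * det3 (h 0) (h 1) (h 2))"
    unfolding k(2) by (simp add: det3_linear det3_matrix)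
  finally have "0 < k 0 * k 1 * k 2 * det (G_mat P)"
    by (rule zero_less_mult_pos2) (use oriented_triples(1)[OF oh, of 0] in simp)
  then show ?thesis
    by (rule zero_less_mult_pos) (simp add: k(1))
qed

text \<open>\<open>pent_lift\<close> commutes with the powers of \<open>G\<close> up to the positive
  factor \<open>det G ^ q\<close>, so the double step from the \<open>q\<close>-th image is the
  \<open>q\<close>-th image of the first double step.\<close>

theorem represents_even_odd_iterates:
  fixes P :: hexagon
  defines "h \<equiv> \<lambda>i. homog_lift (P $ i)" and "G \<equiv> G_mat P"
  assumes o: "oriented s h" and s: "s * s = 1"
  shows "represents ((pentagram ^^ (2 * q)) P) (\<lambda>i. ((*v) G ^^ q) (h i))"
    and "represents ((pentagram ^^ (2 * q + 1)) P) (\<lambda>i. ((*v) G ^^ q) (pent_lift s h i))"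
proof -
  have detG: "det G > 0"
    unfolding G_def using det_G_mat_pos[OF o[unfolded h_def] s] .
  have odd: "represents ((pentagram ^^ (2 * q + 1)) P) (\<lambda>i. ((*v) G ^^ q) (pent_lift s h i))"
    if "represents ((pentagram ^^ (2 * q)) P) (\<lambda>i. ((*v) G ^^ q) (h i))" for q
  proof -
    have "represents (pentagram ((pentagram ^^ (2 * q)) P)) (pent_lift s (\<lambda>i. ((*v) G ^^ q) (h i)))"
      using that oriented_funpow_matrix[OF o detG] by (rule represents_pentagram(2)[rotated])
    then have "represents ((pentagram ^^ (2 * q + 1)) P) (pent_lift s (\<lambda>i. ((*v) G ^^ q) (h i)))"
      by simp
    then show ?thesis
      by (rule represents_rescale[where c = "\<lambda>_. det G ^ q"]) (simp_all add: detG pent_lift_funpow_matrix)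
  qed
  have even: "represents ((pentagram ^^ (2 * q)) P) (\<lambda>i. ((*v) G ^^ q) (h i))" for q
  proof (induction q)
    case 0
    then show ?case by (simp add: h_def represents_homog_lift)
  next
    case (Suc q)
    have "represents (pentagram ((pentagram ^^ (2 * q + 1)) P)) (pent_lift s (\<lambda>i. ((*v) G ^^ q) (pent_lift s h i)))"
      using odd[OF Suc] oriented_funpow_matrix[OF oriented_pent_lift[OF o s] detG]
      by (rule represents_pentagram(2)[rotated])
    then have *: "represents ((pentagram ^^ (2 * Suc q)) P) (pent_lift s (\<lambda>i. ((*v) G ^^ q) (pent_lift s h i)))"
      by simp
    obtain k where k: "\<And>i. k i > 0" "\<And>i. pent_lift s (pent_lift s h) i = k i *\<^sub>R (G *v h i)"
      using pent_lift_twice[OF o[unfolded h_def] s] unfolding h_def G_def by metis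
    have "((*v) G ^^ q) (G *v x) = ((*v) G ^^ Suc q) x" for x
      unfolding funpow_Suc_right by simp
    then have "pent_lift s (\<lambda>i. ((*v) G ^^ q) (pent_lift s h i)) i = (det G ^ q * k i) *\<^sub>R ((*v) G ^^ Suc q) (h i)" for i
      unfolding pent_lift_funpow_matrix k(2) funpow_matrix_linear(2) by simp
    then show ?case
      by (rule represents_rescale[OF *, where c = "\<lambda>i. det G ^ q * k i", rotated]) (simp add: detG k(1))
  qed
  show "represents ((pentagram ^^ (2 * q)) P) (\<lambda>i. ((*v) G ^^ q) (h i))"
    by (rule even)
  show "represents ((pentagram ^^ (2 * q + 1)) P) (\<lambda>i. ((*v) G ^^ q) (pent_lift s h i))"
    by (rule odd[OF even])
qed

section \<open>Similarities and area normalization\<close>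

definition homothetic_hexagon :: "real^2 \<Rightarrow> real \<Rightarrow> hexagon \<Rightarrow> hexagon" where
  "homothetic_hexagon b c P = (\<chi> i. b + c *\<^sub>R P $ i)"

lemma homothetic_hexagon_nth [simp]: "homothetic_hexagon b c P $ i = b + c *\<^sub>R P $ i"
  by (simp add: homothetic_hexagon_def)

lemma centroid_homothetic: "centroid (homothetic_hexagon b c P) = b + c *\<^sub>R centroid P"
  by (simp add: centroid_def vec_eq_iff sum.distrib algebra_simps flip: sum_distrib_left)

lemma area_homothetic: "area (homothetic_hexagon b c P) = c\<^sup>2 * area P"
proof -
  have "(\<Sum>i\<in>UNIV. det2 (b + c *\<^sub>R P $ i) (b + c *\<^sub>R P $ (i + 1))) = c\<^sup>2 * (\<Sum>i\<in>UNIV. det2 (P $ i) (P $ (i + 1)))"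
    by (simp add: sum_6_shift[of _ 0] det2_expand power2_eq_square algebra_simps)
  then show ?thesis
    by (simp add: area_def abs_mult)
qed

lemma represents_homothetic:
  fixes b :: "real^2" and c :: real
  defines "A \<equiv> vector [vector [c, 0, b $ 1], vector [0, c, b $ 2], vector [0, 0, 1]] :: real^3^3"
  assumes "represents P p"
  shows "represents (homothetic_hexagon b c P) (\<lambda>i. A *v p i)" "det A = c\<^sup>2"
proof -
  have lift: "homog_lift (b + c *\<^sub>R x) = A *v homog_lift x" for x
    by (simp add: A_def vec_eq_iff forall_3 matrix_vector_mult_def sum_3)
  show "represents (homothetic_hexagon b c P) (\<lambda>i. A *v p i)"
    unfolding represents_def
  proof
    fix i
    obtain d where "d > 0" "homog_lift (P $ i) = d *\<^sub>R p i"
      using assms(2) unfolding represents_def by blast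
    then show "\<exists>d>0. homog_lift (homothetic_hexagon b c P $ i) = d *\<^sub>R (A *v p i)"
      by (intro exI[of _ d]) (simp add: lift matrix_vector_mult_scaleR)
  qed
  show "det A = c\<^sup>2"
    by (simp add: A_def det_3 power2_eq_square)
qed

lemma pentagram_homothetic:
  assumes o: "oriented s (\<lambda>i. homog_lift (P $ i))" and "c > 0"
  shows "oriented s (\<lambda>i. homog_lift (homothetic_hexagon b c P $ i))"
    and "pentagram (homothetic_hexagon b c P) = homothetic_hexagon b c (pentagram P)"
proof -
  define A where "A = (vector [vector [c, 0, b $ 1], vector [0, c, b $ 2], vector [0, 0, 1]] :: real^3^3)"
  define h where "h = (\<lambda>i. homog_lift (P $ i))"
  have rh: "represents P h" "oriented s h"
    unfolding h_def by (fact represents_homog_lift, fact o)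
  have r: "represents (homothetic_hexagon b c P) (\<lambda>i. A *v h i)" and d: "det A > 0"
    using represents_homothetic[OF rh(1), where b = b and c = c] \<open>c > 0\<close> by (simp_all add: A_def)
  have oA: "oriented s (\<lambda>i. A *v h i)"
    by (rule oriented_matrix[OF rh(2) d])
  show "oriented s (\<lambda>i. homog_lift (homothetic_hexagon b c P $ i))"
    by (rule oriented_represents[OF oA r])
  have "represents (homothetic_hexagon b c (pentagram P)) (\<lambda>i. A *v pent_lift s h i)"
    unfolding A_def by (rule represents_homothetic(1)[OF represents_pentagram(2)[OF rh(2,1)]])
  then show "pentagram (homothetic_hexagon b c P) = homothetic_hexagon b c (pentagram P)"
    by (rule represents_unique[OF represents_pentagram(2)[OF oA r]])
      (use d in \<open>auto simp: pent_lift_matrix intro!: exI[of _ "det A"]\<close>)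
qed

lemma normalized_pentagram_homothetic:
  "normalized_pentagram P = homothetic_hexagon
    (centroid P - sqrt (area P / area (pentagram P)) *\<^sub>R centroid (pentagram P))
    (sqrt (area P / area (pentagram P))) (pentagram P)"
  by (simp add: normalized_pentagram_def vec_eq_iff algebra_simps)

text \<open>Normalization preserves centroid and area and the pentagram map commutes with
  homotheties, so the successive scaling factors telescope to the single quotient in
  \<open>c k\<close>.\<close>

theorem normalized_iterate:
  fixes P :: hexagon
  defines "c \<equiv> \<lambda>k. sqrt (area P / area ((pentagram ^^ k) P))"
  assumes o: "oriented s (\<lambda>i. homog_lift (P $ i))" and s: "s * s = 1"
  shows "(normalized_pentagram ^^ k) P = homothetic_hexagon
    (centroid P - c k *\<^sub>R centroid ((pentagram ^^ k) P)) (c k) ((pentagram ^^ k) P)"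
proof (induction k)
  case 0
  have "c 0 = 1" using area_pos[OF o] by (simp add: c_def)
  then show ?case by (simp add: vec_eq_iff)
next
  case (Suc k)
  define Q where "Q = (pentagram ^^ k) P"
  define b where "b = centroid P - c k *\<^sub>R centroid Q"
  have area: "area P > 0" "area Q > 0" "area (pentagram Q) > 0"
    using iterates_defined(2)[OF o s, of 0] iterates_defined(2)[OF o s, of k]
      iterates_defined(2)[OF o s, of "Suc k"] by (simp_all add: Q_def)
  have ck: "c k > 0" "(c k)\<^sup>2 = area P / area Q"
    using area by (simp_all add: c_def Q_def[symmetric])
  have IH: "(normalized_pentagram ^^ k) P = homothetic_hexagon b (c k) Q"
    using Suc by (simp add: b_def Q_def)
  have pent: "pentagram (homothetic_hexagon b (c k) Q) = homothetic_hexagon b (c k) (pentagram Q)"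
    using pentagram_homothetic(2)[OF iterates_defined(3)[OF o s, of k] ck(1)] by (simp add: Q_def)
  have areaQ: "area (homothetic_hexagon b (c k) Q) = area P"
    using area ck by (simp add: area_homothetic)
  have cen: "centroid (homothetic_hexagon b (c k) Q) = centroid P"
    by (simp add: centroid_homothetic b_def)
  \<comment> \<open>The factor of the next single step; its product with the accumulated
    \<open>c k\<close> is \<open>c (Suc k)\<close>.\<close>
  define d where "d = sqrt (area P / ((c k)\<^sup>2 * area (pentagram Q)))"
  have "d * c k = sqrt (area P / ((c k)\<^sup>2 * area (pentagram Q)) * (c k)\<^sup>2)"
    unfolding d_def real_sqrt_mult using ck(1) by simp
  also have "area P / ((c k)\<^sup>2 * area (pentagram Q)) * (c k)\<^sup>2 = area P / area (pentagram Q)"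
    using ck(1) by simp
  finally have dc: "d * c k = c (Suc k)"
    by (simp add: c_def Q_def)
  have "(normalized_pentagram ^^ Suc k) P = normalized_pentagram (homothetic_hexagon b (c k) Q)"
    by (simp add: IH)
  also have "\<dots> = homothetic_hexagon (centroid P - d *\<^sub>R (b + c k *\<^sub>R centroid (pentagram Q))) d
      (homothetic_hexagon b (c k) (pentagram Q))"
    unfolding normalized_pentagram_homothetic pent areaQ cen
    unfolding area_homothetic centroid_homothetic d_def ..
  also have "\<dots> = homothetic_hexagon (centroid P - c (Suc k) *\<^sub>R centroid (pentagram Q)) (c (Suc k)) (pentagram Q)"
    unfolding dc[symmetric] by (simp add: vec_eq_iff algebra_simps)
  finally show ?case by (simp add: Q_def)
qed

lemma normalized_iterates_defined:
  assumes o: "oriented s (\<lambda>i. homog_lift (P $ i))" and s: "s * s = 1"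
  shows "normalized_iterates_defined P"
  unfolding normalized_iterates_defined_def
proof
  fix k
  define c where "c = sqrt (area P / area ((pentagram ^^ k) P))"
  define Q where "Q = (normalized_pentagram ^^ k) P"
  have "c > 0"
    using iterates_defined(2)[OF o s, of 0] iterates_defined(2)[OF o s, of k] by (simp add: c_def)
  then have oQ: "oriented s (\<lambda>i. homog_lift (Q $ i))"
    unfolding Q_def normalized_iterate[OF o s] c_def[symmetric]
    by (rule pentagram_homothetic(1)[OF iterates_defined(3)[OF o s]])
  then show "pentagram_defined Q \<and> area (pentagram Q) \<noteq> 0"
    using iterates_defined(1)[OF oQ s, of 0] iterates_defined(2)[OF oQ s, of 1] by simp
qed

text \<open>If a vertex were the centroid, the vectors from it to the others would sum to zero.
  Pairing that sum with an edge at this vertex gives four positive numbers with sum zero.\<close>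

lemma centroid_ne_vertex:
  assumes o: "oriented s (\<lambda>i. homog_lift (P $ i))"
  shows "P $ i \<noteq> centroid P"
proof
  assume *: "P $ i = centroid P"
  have "(\<Sum>j\<in>UNIV. P $ j) = 6 *\<^sub>R P $ i"
    unfolding * by (simp add: centroid_def)
  then have "P $ i + P $ (i + 1) + P $ (i + 2) + P $ (i + 3) + P $ (i + 4) + P $ (i + 5) = 6 *\<^sub>R P $ i"
    by (simp add: sum_6_shift[of _ i])
  then have "s * det2 (P $ (i + 1) - P $ i) (P $ (i + 2) - P $ i) + s * det2 (P $ (i + 1) - P $ i) (P $ (i + 3) - P $ i)
    + s * det2 (P $ (i + 1) - P $ i) (P $ (i + 4) - P $ i) + s * det2 (P $ (i + 1) - P $ i) (P $ (i + 5) - P $ i) = 0"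
    unfolding vec_eq_iff forall_2 det2_expand vector_minus_component vector_add_component vector_scaleR_component real_scaleR_def
    by algebra
  then show False
    using oriented_triples(1-4)[OF o, of i] unfolding det3_homog_lift by linarith
qed

section \<open>The linearizing chart\<close>

locale pentagram_chart =
  fixes P :: hexagon and s l :: real and \<phi> v :: "real^3"
  assumes o: "oriented s (\<lambda>i. homog_lift (P $ i))" and s: "s * s = 1"
    and l: "l > 0" and \<phi>_pos: "\<And>i. \<phi> \<bullet> homog_lift (P $ i) > 0"
    and \<phi>: "\<And>x. \<phi> \<bullet> (G_mat P *v x) = l * (\<phi> \<bullet> x)"
    and v3: "v $ 3 = 1" and v: "G_mat P *v v = l *\<^sub>R v" and \<phi>v: "\<phi> \<bullet> v > 0"
begin

abbreviation "G \<equiv> G_mat P"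

definition X :: "real^2" where "X = affine_point v"

text \<open>The projection onto the plane of directions along the eigenvector \<open>v\<close>; it intertwines \<open>G\<close> and \<open>l M\<close>.\<close>

definition \<pi> :: "real^3 \<Rightarrow> real^2" where
  "\<pi> y = vector [y $ 1 - y $ 3 * X $ 1, y $ 2 - y $ 3 * X $ 2]"

text \<open>\<open>G\<close> induces a map on the quotient by the line of \<open>v\<close>, which
  \<pi> identifies with the plane; the columns of \<open>l *\<^sub>R M\<close> are the \<pi>-images
  of the first two columns of \<open>G\<close>.\<close>

definition M :: "real^2^2" where
  "M = (1 / l) *\<^sub>R vector [vector [G $ 1 $ 1 - X $ 1 * G $ 3 $ 1, G $ 1 $ 2 - X $ 1 * G $ 3 $ 2],
                     vector [G $ 2 $ 1 - X $ 2 * G $ 3 $ 1, G $ 2 $ 2 - X $ 2 * G $ 3 $ 2]]"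

text \<open>In the chart the original line at infinity has the equation
  \<open>1 + \<psi> z = 0\<close>, so this is the denominator of the inverse chart.\<close>

definition \<psi> :: "real^2 \<Rightarrow> real" where
  "\<psi> z = - (\<phi> $ 1 / (\<phi> \<bullet> v)) * z $ 1 - (\<phi> $ 2 / (\<phi> \<bullet> v)) * z $ 2"

text \<open>The factor \<open>\<phi> \<bullet> v\<close> makes the inverse
  \<open>z \<mapsto> X + (1 / (1 + \<psi> z)) *\<^sub>R z\<close>, whose derivative at the origin is
  the identity; thus the linear map in the chart is the derivative at \<open>X\<close> and not
  merely conjugate to it.\<close>

definition chart :: "real^3 \<Rightarrow> real^2" where
  "chart y = ((\<phi> \<bullet> v) / (\<phi> \<bullet> y)) *\<^sub>R \<pi> y"

lemma v_eq: "v = homog_lift X"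
  using v3 by (simp add: X_def affine_point_def vec_eq_iff forall_3)

lemma v_nth [simp]: "v $ 1 = X $ 1" "v $ 2 = X $ 2" "v $ 3 = 1"
  using arg_cong[OF v_eq, of "\<lambda>y. y $ 1"] arg_cong[OF v_eq, of "\<lambda>y. y $ 2"] v3 by simp_all

lemma G_row: "G $ i $ 1 * X $ 1 + G $ i $ 2 * X $ 2 + G $ i $ 3 = l * v $ i"
  using arg_cong[OF v, of "\<lambda>y. y $ i"] by (simp add: matrix_vector_mult_def sum_3)

lemma \<pi>_linear: "\<pi> (x + y) = \<pi> x + \<pi> y" "\<pi> (c *\<^sub>R x) = c *\<^sub>R \<pi> x"
  by (simp_all add: \<pi>_def vec_eq_iff forall_2 algebra_simps)

lemma linear_\<psi>: "linear \<psi>"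
  by (rule linearI) (simp_all only: \<psi>_def vector_add_component vector_scaleR_component real_scaleR_def, simp_all add: algebra_simps add_divide_distrib)

lemma \<pi>_G: "\<pi> (G *v y) = l *\<^sub>R (M *v \<pi> y)"
proof -
  \<comment> \<open>The eigenvector equation for \<open>v\<close> eliminates the third column of
    \<open>G\<close>.\<close>
  have e: "G $ 1 $ 3 = l * X $ 1 - G $ 1 $ 1 * X $ 1 - G $ 1 $ 2 * X $ 2"
    "G $ 2 $ 3 = l * X $ 2 - G $ 2 $ 1 * X $ 1 - G $ 2 $ 2 * X $ 2"
    "G $ 3 $ 3 = l - G $ 3 $ 1 * X $ 1 - G $ 3 $ 2 * X $ 2"
    using G_row[of 1] G_row[of 2] G_row[of 3] by simp_all
  have "l *\<^sub>R (M *v \<pi> y) = vector [vector [G $ 1 $ 1 - X $ 1 * G $ 3 $ 1, G $ 1 $ 2 - X $ 1 * G $ 3 $ 2],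
                     vector [G $ 2 $ 1 - X $ 2 * G $ 3 $ 1, G $ 2 $ 2 - X $ 2 * G $ 3 $ 2]] *v \<pi> y"
    using l by (simp add: M_def scaleR_matrix_vector_assoc[symmetric])
  also have "\<dots> = \<pi> (G *v y)"
    unfolding vec_eq_iff forall_2 \<pi>_def matrix_vector_mult_def sum_2 sum_3 vec_lambda_beta vector_2
    by (simp add: e algebra_simps)
  finally show ?thesis ..
qed

lemma funpow_G:
  "\<phi> \<bullet> ((*v) G ^^ q) y = l ^ q * (\<phi> \<bullet> y)" "\<pi> (((*v) G ^^ q) y) = l ^ q *\<^sub>R ((*v) M ^^ q) (\<pi> y)"
  by (induction q) (simp_all add: \<phi> \<pi>_G matrix_vector_mult_scaleR)

lemma chart_funpow_G: "chart (((*v) G ^^ q) y) = ((*v) M ^^ q) (chart y)"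
  using l by (simp add: chart_def funpow_G funpow_matrix_linear)

lemma third_chart:
  assumes "\<phi> \<bullet> y > 0"
  shows "y $ 3 = ((\<phi> \<bullet> y) / (\<phi> \<bullet> v)) * (1 + \<psi> (chart y))"
proof -
  have "\<phi> \<bullet> y = y $ 3 * (\<phi> \<bullet> v) + (\<phi> $ 1 * \<pi> y $ 1 + \<phi> $ 2 * \<pi> y $ 2)"
    by (simp add: inner_vec_def sum_3 \<pi>_def algebra_simps)
  also have "\<phi> $ 1 * \<pi> y $ 1 + \<phi> $ 2 * \<pi> y $ 2 = - ((\<phi> \<bullet> v) * \<psi> (\<pi> y))"
    using \<phi>v by (simp add: \<psi>_def right_diff_distrib)
  finally have "y $ 3 = (\<phi> \<bullet> y) / (\<phi> \<bullet> v) + \<psi> (\<pi> y)"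
    using \<phi>v by (simp add: diff_divide_distrib)
  moreover have "\<psi> (chart y) = ((\<phi> \<bullet> v) / (\<phi> \<bullet> y)) * \<psi> (\<pi> y)"
    using linear_\<psi> by (simp add: chart_def linear_scale)
  ultimately show ?thesis
    using assms \<phi>v by (simp add: distrib_left)
qed

lemma affine_point_chart:
  assumes "\<phi> \<bullet> y > 0" "y $ 3 > 0"
  shows "affine_point y = X + (1 / (1 + \<psi> (chart y))) *\<^sub>R chart y" "1 + \<psi> (chart y) > 0"
proof -
  have 3: "y $ 3 = ((\<phi> \<bullet> y) / (\<phi> \<bullet> v)) * (1 + \<psi> (chart y))"
    by (rule third_chart[OF assms(1)])
  have "(\<phi> \<bullet> y) / (\<phi> \<bullet> v) > 0" using assms \<phi>v by simp
  then show pos: "1 + \<psi> (chart y) > 0"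
    using 3 assms(2) by (metis zero_less_mult_pos)
  have "affine_point y = X + (1 / y $ 3) *\<^sub>R \<pi> y"
    using assms(2) by (simp add: affine_point_def \<pi>_def vec_eq_iff forall_2 field_simps)
  also have "(1 / y $ 3) *\<^sub>R \<pi> y = (1 / (1 + \<psi> (chart y))) *\<^sub>R chart y"
  proof -
    have "chart y = (1 / ((\<phi> \<bullet> y) / (\<phi> \<bullet> v))) *\<^sub>R \<pi> y"
      by (simp add: chart_def)
    then show ?thesis
      unfolding 3 by (simp add: mult.commute)
  qed
  finally show "affine_point y = X + (1 / (1 + \<psi> (chart y))) *\<^sub>R chart y" .
qed

text \<open>In a basis containing \<open>v\<close> the matrix \<open>G\<close> is block triangular
  with diagonal blocks \<open>l\<close> and \<open>l *\<^sub>R M\<close>.\<close>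

lemma det_M: "det M = det G / l ^ 3" "trace M = (trace G - l) / l"
proof -
  have e: "G $ 1 $ 3 = l * X $ 1 - G $ 1 $ 1 * X $ 1 - G $ 1 $ 2 * X $ 2"
    "G $ 2 $ 3 = l * X $ 2 - G $ 2 $ 1 * X $ 1 - G $ 2 $ 2 * X $ 2"
    "G $ 3 $ 3 = l - G $ 3 $ 1 * X $ 1 - G $ 3 $ 2 * X $ 2"
    using G_row[of 1] G_row[of 2] G_row[of 3] by simp_all
  define m11 m12 m21 m22 where "m11 = G $ 1 $ 1 - X $ 1 * G $ 3 $ 1" "m12 = G $ 1 $ 2 - X $ 1 * G $ 3 $ 2"
    "m21 = G $ 2 $ 1 - X $ 2 * G $ 3 $ 1" "m22 = G $ 2 $ 2 - X $ 2 * G $ 3 $ 2"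
  note m = m11_m12_m21_m22_def
  have M: "M $ 1 $ 1 = m11 / l" "M $ 1 $ 2 = m12 / l" "M $ 2 $ 1 = m21 / l" "M $ 2 $ 2 = m22 / l"
    by (simp_all add: M_def m)
  have "l * (m11 * m22 - m12 * m21) = det G"
    unfolding m det_3 e by (simp add: algebra_simps)
  then show "det M = det G / l ^ 3"
    using l by (simp add: det_2 M field_simps power3_eq_cube)
  have "m11 + m22 = trace G - l"
    unfolding m trace_def sum_3 e by (simp add: algebra_simps)
  then show "trace M = (trace G - l) / l"
    by (simp add: trace_def sum_2 M flip: add_divide_distrib)
qed

lemma det_M_pos: "det M > 0"
  using det_M(1) det_G_mat_pos[OF o s] l by simp

section \<open>The two base hexagons and their orbits in the chart\<close>

definition base_lift :: "nat \<Rightarrow> 6 \<Rightarrow> real^3" where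
  "base_lift r = (if r = 0 then \<lambda>i. homog_lift (P $ i) else pent_lift s (\<lambda>i. homog_lift (P $ i)))"

definition \<xi> :: "nat \<Rightarrow> hexagon" where
  "\<xi> r = (\<chi> i. chart (base_lift r i))"

lemma oriented_base_lift: "oriented s (base_lift r)"
  using o s by (simp add: base_lift_def oriented_pent_lift)

lemma \<phi>_base_lift: "\<phi> \<bullet> base_lift r i > 0"
proof (cases "r = 0")
  case False
  then show ?thesis
    using oriented_triples(2)[OF o, of i] oriented_triples(1)[OF o, of "i + 1"] \<phi>_pos
    by (simp add: base_lift_def pent_lift_def inner_add_right add_pos_pos)
qed (simp add: base_lift_def \<phi>_pos)

lemma represents_iterate:
  assumes "r \<in> {0, 1}"
  shows "represents ((pentagram ^^ (2 * q + r)) P) (\<lambda>i. ((*v) G ^^ q) (base_lift r i))"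
  using assms represents_even_odd_iterates[OF o s, of q] by (auto simp: base_lift_def)

lemma third_iterate: "r \<in> {0, 1} \<Longrightarrow> (((*v) G ^^ q) (base_lift r i)) $ 3 > 0"
  using represents_third[OF represents_iterate] .

lemma iterate_nth:
  assumes "r \<in> {0, 1}"
  shows "(pentagram ^^ (2 * q + r)) P $ i =
    X + (1 / (1 + \<psi> (((*v) M ^^ q) (\<xi> r $ i)))) *\<^sub>R ((*v) M ^^ q) (\<xi> r $ i)"
    "1 + \<psi> (((*v) M ^^ q) (\<xi> r $ i)) > 0"
proof -
  have "\<phi> \<bullet> ((*v) G ^^ q) (base_lift r i) > 0"
    using \<phi>_base_lift l by (simp add: funpow_G)
  from affine_point_chart[OF this third_iterate[OF assms]]
  show "(pentagram ^^ (2 * q + r)) P $ i =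
    X + (1 / (1 + \<psi> (((*v) M ^^ q) (\<xi> r $ i)))) *\<^sub>R ((*v) M ^^ q) (\<xi> r $ i)"
    "1 + \<psi> (((*v) M ^^ q) (\<xi> r $ i)) > 0"
    unfolding represents_affine_point[OF represents_iterate[OF assms]]
    by (simp_all add: chart_funpow_G \<xi>_def)
qed

lemma oriented_\<xi>: "oriented s (\<lambda>i. homog_lift (\<xi> r $ i))"
proof -
  \<comment> \<open>The matrix of the chart as a projective map. Its determinant is 1, so the base
    hexagons keep their orientation in the chart.\<close>
  define B :: "real^3^3" where
    "B = vector [vector [1, 0, - X $ 1], vector [0, 1, - X $ 2], (1 / (\<phi> \<bullet> v)) *\<^sub>R \<phi>]"
  have B: "B *v y = vector [\<pi> y $ 1, \<pi> y $ 2, (\<phi> \<bullet> y) / (\<phi> \<bullet> v)]" for y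
    by (simp add: B_def vec_eq_iff forall_3 matrix_vector_mult_def sum_3 \<pi>_def inner_vec_def add_divide_distrib mult.commute)
  have "det B = (\<phi> $ 1 * X $ 1 + \<phi> $ 2 * X $ 2 + \<phi> $ 3) / (\<phi> \<bullet> v)"
    by (simp add: B_def det_3 add_divide_distrib mult.commute)
  also have "\<dots> = 1"
    using \<phi>v by (simp add: inner_vec_def sum_3)
  finally have "oriented s (\<lambda>i. B *v base_lift r i)"
    by (intro oriented_matrix oriented_base_lift) simp
  then have "oriented s (\<lambda>i. ((\<phi> \<bullet> v) / (\<phi> \<bullet> base_lift r i)) *\<^sub>R (B *v base_lift r i))"
    by (rule oriented_rescale) (simp add: \<phi>v \<phi>_base_lift)
  moreover have "((\<phi> \<bullet> v) / (\<phi> \<bullet> base_lift r i)) *\<^sub>R (B *v base_lift r i) = homog_lift (\<xi> r $ i)" for i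
    using \<phi>v \<phi>_base_lift[of r i] by (simp add: B vec_eq_iff forall_3 \<xi>_def chart_def)
  ultimately show ?thesis by simp
qed

lemma area_\<xi>: "area (\<xi> r) > 0"
  using area_pos[OF oriented_\<xi>] .

lemma det2_funpow: "det2 (((*v) M ^^ q) x) (((*v) M ^^ q) y) = det M ^ q * det2 x y"
proof (induction q)
  case (Suc q)
  have "det2 (M *v x) (M *v y) = det M * det2 x y" for x y
    by (simp add: det2_expand det_2 matrix_vector_mult_def sum_2 algebra_simps)
  then show ?case using Suc by simp
qed simp

lemma area_diff: "area Q = \<bar>(1/2) * (\<Sum>i\<in>UNIV. det2 (Q $ i - b) (Q $ (i + 1) - b))\<bar>"
proof -
  have "(\<Sum>i\<in>UNIV. det2 (Q $ i) (Q $ (i + 1))) = (\<Sum>i\<in>UNIV. det2 (Q $ i - b) (Q $ (i + 1) - b))"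
    by (simp add: sum_6_shift[of _ 0] det2_expand algebra_simps)
  then show ?thesis by (simp add: area_def)
qed

definition correction :: "nat \<Rightarrow> nat \<Rightarrow> 6 \<Rightarrow> real" where
  "correction r q i = 1 / (1 + \<psi> (((*v) M ^^ q) (\<xi> r $ i)))"

lemma correction_tendsto:
  assumes lim: "\<And>z. (\<lambda>q. ((*v) M ^^ q) z) \<longlonglongrightarrow> 0"
  shows "(\<lambda>q. correction r q i) \<longlonglongrightarrow> 1"
proof -
  have "(\<lambda>q. \<psi> (((*v) M ^^ q) (\<xi> r $ i))) \<longlonglongrightarrow> \<psi> 0"
    using linear_\<psi> by (intro isCont_tendsto_compose[OF _ lim] linear_continuous_at) (simp add: linear_conv_bounded_linear)
  then have "(\<lambda>q. correction r q i) \<longlonglongrightarrow> 1 / (1 + \<psi> 0)"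
    unfolding correction_def using linear_0[OF linear_\<psi>] by (intro tendsto_intros) auto
  then show ?thesis using linear_0[OF linear_\<psi>] by simp
qed

text \<open>Measured from \<open>X\<close>, every term of the area formula is scaled exactly by
  \<open>det M ^ q\<close>, apart from two correction factors that tend to 1.\<close>

lemma area_iterate_tendsto:
  assumes r: "r \<in> {0, 1}" and lim: "\<And>z. (\<lambda>q. ((*v) M ^^ q) z) \<longlonglongrightarrow> 0"
  shows "(\<lambda>q. area ((pentagram ^^ (2 * q + r)) P) / det M ^ q) \<longlonglongrightarrow> area (\<xi> r)"
proof -
  define D where "D q = (\<Sum>i\<in>UNIV. correction r q i * correction r q (i + 1) * det2 (\<xi> r $ i) (\<xi> r $ (i + 1)))" for q
  have "area ((pentagram ^^ (2 * q + r)) P) / det M ^ q = \<bar>(1/2) * D q\<bar>" for q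
  proof -
    have sc: "det2 (a *\<^sub>R x) (b *\<^sub>R y) = a * b * det2 x y" for a b x y
      by (simp add: det2_expand algebra_simps)
    have "area ((pentagram ^^ (2 * q + r)) P) = \<bar>(1/2) * (\<Sum>i\<in>UNIV. det M ^ q *
        (correction r q i * correction r q (i + 1) * det2 (\<xi> r $ i) (\<xi> r $ (i + 1))))\<bar>"
      unfolding area_diff[of _ X] iterate_nth(1)[OF r] add_diff_cancel_left' sc det2_funpow correction_def
      by (simp only: mult_ac)
    also have "\<dots> = det M ^ q * \<bar>(1/2) * D q\<bar>"
      using det_M_pos by (simp add: D_def abs_mult flip: sum_distrib_left)
    finally show ?thesis using det_M_pos by simp
  qed
  moreover have "(\<lambda>q. \<bar>(1/2) * D q\<bar>) \<longlonglongrightarrow> \<bar>(1/2) * (\<Sum>i\<in>UNIV. 1 * 1 * det2 (\<xi> r $ i) (\<xi> r $ (i + 1)))\<bar>"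
    unfolding D_def by (intro tendsto_intros correction_tendsto lim)
  ultimately show ?thesis
    by (simp only: area_def[of "\<xi> r"] mult_1)
qed

lemma normalized_nth:
  "(normalized_pentagram ^^ k) P $ i - centroid P =
    sqrt (area P / area ((pentagram ^^ k) P)) *\<^sub>R ((pentagram ^^ k) P $ i - centroid ((pentagram ^^ k) P))"
  by (simp add: normalized_iterate[OF o s] scaleR_diff_right)

end

section \<open>The spectrum and the invariants\<close>

lemma complex_mat_nth [simp]: "complex_mat A $ i $ j = of_real (A $ i $ j)"
  by (simp add: complex_mat_def)

lemma complex_vec_nth [simp]: "complex_vec x $ i = of_real (x $ i)"
  by (simp add: complex_vec_def)

lemma complex_mat_mult: "complex_mat A *v complex_vec x = complex_vec (A *v x)"
  by (simp add: vec_eq_iff matrix_vector_mult_def)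

lemma mat_nth: "(mat k :: 'a::zero^'n^'n) $ i $ j = (if i = j then k else 0)"
  by (simp add: mat_def)

lemma eigenvector_complex_eigenvalue:
  assumes "eigenvector A m x"
  shows "of_real m \<in> complex_eigenvalues A"
proof -
  have "complex_vec x \<noteq> 0" "complex_mat A *v complex_vec x = of_real m *s complex_vec x"
    using assms by (auto simp: eigenvector_def complex_mat_mult vec_eq_iff)
  then show ?thesis unfolding complex_eigenvalues_def by blast
qed

lemma complex_eigenvalue_eigenvector:
  fixes A :: "real^3^3"
  assumes "of_real m \<in> complex_eigenvalues A"
  obtains x where "eigenvector A m x"
proof -
  have "det (complex_mat A - mat (of_real m)) = of_real (det (A - mat m))"
    by (simp add: det_3 mat_nth)
  then have "det (A - mat m) = 0"
    using assms by (simp add: complex_eigenvalues_det)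
  from iffD2[OF eigenvector_exists_iff_det this]
  obtain x where "x \<noteq> 0" "A *v x = m *s x" by blast
  then show ?thesis
    using that by (simp add: eigenvector_def scalar_mult_eq_scaleR)
qed

lemma complex_eigenvalues_2:
  fixes A :: "real^2^2"
  shows "complex_eigenvalues A = {k. k\<^sup>2 - of_real (trace A) * k + of_real (det A) = 0}"
  by (simp add: complex_eigenvalues_det det_2 trace_def sum_2 mat_nth power2_eq_square algebra_simps)

text \<open>\<open>A - mat 1\<close> is traceless, so the cubic in \<open>k - 1\<close> has no
  quadratic term and its other coefficients are \<open>S\<close> and \<open>R\<close>. The proof
  eliminates the entry \<open>A $ 3 $ 3\<close> and expands.\<close>

lemma charpoly_3:
  fixes A :: "real^3^3"
  assumes "trace A = 3"
  defines "S \<equiv> (1/2) * trace ((A - mat 1) ** (A - mat 1))" and "R \<equiv> det (A - mat 1)"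
  shows "det (complex_mat A - mat k) = - ((k - 1) ^ 3 - of_real S * (k - 1) - of_real R)"
    and "det A = 1 - S + R"
proof -
  have 33: "A $ 3 $ 3 = 3 - A $ 1 $ 1 - A $ 2 $ 2"
    using assms(1) by (simp add: trace_def sum_3)
  define a b c d e f g h where "a = A $ 1 $ 1" "b = A $ 1 $ 2" "c = A $ 1 $ 3"
    "d = A $ 2 $ 1" "e = A $ 2 $ 2" "f = A $ 2 $ 3" "g = A $ 3 $ 1" "h = A $ 3 $ 2"
  note n = this[symmetric]
  have S: "S = (1/2) * ((a - 1)\<^sup>2 + (e - 1)\<^sup>2 + (2 - a - e)\<^sup>2 + 2 * b * d + 2 * c * g + 2 * f * h)"
    by (simp add: S_def trace_def sum_3 matrix_matrix_mult_def mat_nth 33 n power2_eq_square algebra_simps)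
  have R: "R = (a - 1) * ((e - 1) * (2 - a - e) - f * h) - b * (d * (2 - a - e) - f * g) + c * (d * h - (e - 1) * g)"
    by (simp add: R_def det_3 mat_nth 33 n algebra_simps)
  have "det (complex_mat A - mat k) = (of_real a - k) * ((of_real e - k) * (3 - of_real a - of_real e - k) - of_real f * of_real h)
    - of_real b * (of_real d * (3 - of_real a - of_real e - k) - of_real f * of_real g)
    + of_real c * (of_real d * of_real h - (of_real e - k) * of_real g)"
    by (simp add: det_3 mat_nth 33 n algebra_simps)
  also have "\<dots> = - ((k - 1) ^ 3 - of_real S * (k - 1) - of_real R)"
    by (simp add: S R power2_eq_square power3_eq_cube) (simp add: field_simps)
  finally show "det (complex_mat A - mat k) = - ((k - 1) ^ 3 - of_real S * (k - 1) - of_real R)" .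
  have "det A = a * (e * (3 - a - e) - f * h) - b * (d * (3 - a - e) - f * g) + c * (d * h - e * g)"
    by (simp add: det_3 33 n algebra_simps)
  then show "det A = 1 - S + R"
    by (simp add: S R power2_eq_square) (simp add: field_simps)
qed

lemma G_mat_nth:
  fixes P :: hexagon
  defines "h \<equiv> \<lambda>i. homog_lift (P $ i)"
  shows "G_mat P $ i $ k = (if i = k then 3 else 0)
    - (\<Sum>j\<in>UNIV. (det3 (h (j - 1)) (axis k 1) (h (j + 1)) / det3 (h (j - 1)) (h j) (h (j + 1))) * h j $ i)"
proof -
  have "G_mat P $ i $ k = (G_mat P *v axis k 1) $ i"
    by (simp add: matrix_vector_mul_component inner_axis)
  then show ?thesis
    by (simp add: G_mat_mult glick_of_lifts_def h_def axis_def)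
qed

text \<open>Each summand of Glick's operator is a rank one projection, of trace 1. The six of them
  are subtracted from 3 times the identity, of trace 9.\<close>

lemma trace_G_mat:
  assumes "oriented s (\<lambda>i. homog_lift (P $ i))"
  shows "trace (G_mat P) = 3"
proof -
  define h where "h = (\<lambda>i. homog_lift (P $ i))"
  define D where "D j = det3 (h (j - 1)) (h j) (h (j + 1))" for j
  have D: "D j \<noteq> 0" for j
    using oriented_triples(1)[OF assms, of "j - 1"] by (auto simp: D_def h_def)
  have expand: "(\<Sum>k\<in>UNIV. det3 a (axis k 1) b * c $ k) = det3 a c b" for a b c
    by (simp add: sum_3 det3_expand axis_def algebra_simps)
  have "trace (G_mat P) = (\<Sum>k\<in>UNIV. 3 - (\<Sum>j\<in>UNIV. (det3 (h (j - 1)) (axis k 1) (h (j + 1)) / D j) * h j $ k))"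
    by (simp add: trace_def G_mat_nth h_def D_def)
  also have "\<dots> = 9 - (\<Sum>k\<in>UNIV. \<Sum>j\<in>UNIV. (det3 (h (j - 1)) (axis k 1) (h (j + 1)) * h j $ k) / D j)"
    by (simp add: sum_subtractf)
  also have "(\<Sum>k\<in>UNIV. \<Sum>j\<in>UNIV. (det3 (h (j - 1)) (axis k 1) (h (j + 1)) * h j $ k) / D j) =
    (\<Sum>j\<in>UNIV. D j / D j)"
    by (subst sum.swap) (simp add: expand D_def flip: sum_divide_distrib)
  also have "\<dots> = 6"
    using D by simp
  finally show ?thesis by simp
qed

lemma pentagram_chart_exists:
  assumes "P \<in> convex_hexagons"
  obtains s l \<phi> v where "pentagram_chart P s l \<phi> v"
proof -
  obtain s where s: "s * s = 1" "oriented s (\<lambda>i. homog_lift (P $ i))"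
    using assms unfolding convex_hexagons_iff by blast
  note cone = cone_positive_G_mat[OF s(2)]
  have third: "homog_lift (P $ i) $ 3 > 0" for i by simp
  obtain \<phi> l where \<phi>: "l > 0" "\<And>i. \<phi> \<bullet> homog_lift (P $ i) > 0" "\<And>x. \<phi> \<bullet> (G_mat P *v x) = l * (\<phi> \<bullet> x)"
    by (rule positive_left_eigenvector[OF s(2) third cone], rule that)
  obtain v where "v $ 3 = 1" "G_mat P *v v = l *\<^sub>R v" "\<phi> \<bullet> v > 0"
    by (rule positive_right_eigenvector[OF cone _ \<phi>(2,3)]) simp_all
  then show ?thesis
    using that s \<phi> unfolding pentagram_chart_def by blast
qed

section \<open>The invariants expressed by the dominant eigenvalue\<close>

context pentagram_chart
begin

lemma dominant: "k \<in> complex_eigenvalues G \<Longrightarrow> k \<noteq> of_real l \<Longrightarrow> cmod k < l"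
  by (rule dominant_eigenvalue[OF o cone_positive_G_mat[OF o] \<phi>_pos \<phi> l])

lemma eigenvector_v: "eigenvector G l v"
proof -
  have "v \<noteq> 0" using v3 by (metis zero_index zero_neq_one)
  then show ?thesis using v by (simp add: eigenvector_def)
qed

lemma S_R_inv:
  "S_inv P = 1 - (l - 1) + (l - 1)\<^sup>2 - det G / l" "R_inv P = (l - 1) ^ 3 - S_inv P * (l - 1)"
proof -
  note cp = charpoly_3[OF trace_G_mat[OF o]]
  have "of_real ((l - 1) ^ 3 - S_inv P * (l - 1) - R_inv P) = (0 :: complex)"
    using eigenvector_complex_eigenvalue[OF eigenvector_v]
    by (simp add: complex_eigenvalues_det cp(1) S_inv_def R_inv_def)
  then show R: "R_inv P = (l - 1) ^ 3 - S_inv P * (l - 1)"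
    unfolding of_real_eq_0_iff by simp
  have "det G = 1 - S_inv P + R_inv P"
    unfolding S_inv_def R_inv_def by (rule cp(2))
  also have "\<dots> = l * (1 - (l - 1) + (l - 1)\<^sup>2 - S_inv P)"
    unfolding R by (simp add: power2_eq_square power3_eq_cube algebra_simps)
  finally show "S_inv P = 1 - (l - 1) + (l - 1)\<^sup>2 - det G / l"
    using l by simp
qed

text \<open>With the subdominant eigenvalues \<open>a\<close>, \<open>b\<close> given by their sum
  \<open>3 - l\<close> and product \<open>det G / l\<close>, the factors are
  \<open>(a - b)\<^sup>2\<close> and \<open>((l - a) * (l - b))\<^sup>2\<close>.\<close>

lemma Discr_eq: "Discr P = ((3 - l)\<^sup>2 - 4 * (det G / l)) * (l\<^sup>2 - l * (3 - l) + det G / l)\<^sup>2"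
proof -
  define e where "e = det G / l"
  show ?thesis
    unfolding Discr_def S_R_inv(2) S_R_inv(1) e_def[symmetric]
    by (simp add: power2_eq_square power3_eq_cube algebra_simps)
qed

text \<open>Here \<open>3 - l\<close> is the sum of the subdominant eigenvalues and
  \<open>3 * l + det G / l\<close> the product of their sums with \<open>l\<close>. The latter is
  positive, so \<open>F_inv P\<close> vanishes only when the subdominant pair is opposite.\<close>

lemma F_inv_eq: "F_inv P = - ((3 - l) * (3 * l + det G / l))"
proof -
  define e where "e = det G / l"
  show ?thesis
    unfolding F_inv_def S_R_inv(2) S_R_inv(1) e_def[symmetric]
    by (simp add: power2_eq_square power3_eq_cube algebra_simps)
qed

lemma complex_eigenvalues_G:
  assumes "k2 + k3 = of_real (3 - l)" "k2 * k3 = of_real (det G / l)"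
  shows "complex_eigenvalues G = {of_real l, k2, k3}"
proof -
  define e where "e = det G / l"
  have "det (complex_mat G - mat k) = - ((k - of_real l) * (k - k2) * (k - k3))" for k
  proof -
    have "(k - k2) * (k - k3) = k\<^sup>2 - (k2 + k3) * k + k2 * k3"
      by (simp add: power2_eq_square algebra_simps)
    then have "(k - of_real l) * (k - k2) * (k - k3) = (k - of_real l) * (k\<^sup>2 - of_real (3 - l) * k + of_real e)"
      unfolding assms e_def by (simp only: mult.assoc)
    also have "\<dots> = (k - 1) ^ 3 - of_real (S_inv P) * (k - 1) - of_real (R_inv P)"
      unfolding S_R_inv(2) S_R_inv(1) e_def[symmetric]
      by (simp add: power2_eq_square power3_eq_cube algebra_simps)
    finally show ?thesis
      unfolding charpoly_3(1)[OF trace_G_mat[OF o]] S_inv_def R_inv_def by simp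
  qed
  then show ?thesis
    by (auto simp: complex_eigenvalues_det)
qed

text \<open>Quotient rule for a numerator \<open>K *v x + k0\<close> and a denominator
  \<open>D x\<close>; at the fixed point these are \<open>l *\<^sub>R X\<close> and
  \<open>l\<close>, which produces the entries of \<open>M\<close>.\<close>

lemma has_derivative_affine_expression: "(affine_expression G has_derivative (*v) M) (at X)"
proof -
  define K :: "real^2^2" where "K = vector [vector [G $ 1 $ 1, G $ 1 $ 2], vector [G $ 2 $ 1, G $ 2 $ 2]]"
  define k0 :: "real^2" where "k0 = vector [G $ 1 $ 3, G $ 2 $ 3]"
  define d :: "real^2" where "d = vector [G $ 3 $ 1, G $ 3 $ 2]"
  define D where "D x = d \<bullet> x + G $ 3 $ 3" for x
  have f: "affine_expression G = (\<lambda>x. inverse (D x) *\<^sub>R (K *v x + k0))"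
    by (simp add: fun_eq_iff affine_expression_def affine_point_def vec_eq_iff forall_2 matrix_vector_mult_def
        sum_3 sum_2 K_def k0_def D_def d_def inner_vec_def divide_inverse mult.commute algebra_simps)
  have DX: "D X = l"
    using G_row[of 3] by (simp add: D_def d_def inner_vec_def sum_2)
  have KX: "K *v X + k0 = l *\<^sub>R X"
    using G_row[of 1] G_row[of 2] by (simp add: K_def k0_def vec_eq_iff forall_2 matrix_vector_mult_def sum_2)
  have dD: "(D has_derivative (\<lambda>h. d \<bullet> h)) (at X)"
    unfolding D_def by (auto intro!: derivative_eq_intros)
  have dN: "((\<lambda>x. K *v x + k0) has_derivative (\<lambda>h. K *v h)) (at X)"
    by (auto intro!: derivative_eq_intros bounded_linear_imp_has_derivative matrix_vector_mul_bounded_linear)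
  have "D X \<noteq> 0" using DX l by simp
  have deriv: "((\<lambda>x. inverse (D x) *\<^sub>R (K *v x + k0)) has_derivative
    (\<lambda>h. inverse (D X) *\<^sub>R (K *v h) + (- (inverse (D X) * (d \<bullet> h) * inverse (D X))) *\<^sub>R (K *v X + k0))) (at X)"
    by (rule has_derivative_scaleR[OF Deriv.has_derivative_inverse[OF \<open>D X \<noteq> 0\<close> dD] dN])
  have "inverse (D X) *\<^sub>R (K *v h) + (- (inverse (D X) * (d \<bullet> h) * inverse (D X))) *\<^sub>R (K *v X + k0)
    = M *v h" for h
  proof -
    have "inverse (D X) *\<^sub>R (K *v h) + (- (inverse (D X) * (d \<bullet> h) * inverse (D X))) *\<^sub>R (K *v X + k0)
      = (1 / l) *\<^sub>R (K *v h - (d \<bullet> h) *\<^sub>R X)"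
      unfolding KX DX using l by (simp add: scaleR_diff_right divide_inverse)
    also have "K *v h - (d \<bullet> h) *\<^sub>R X = (l *\<^sub>R M) *v h"
      using l by (simp add: M_def vec_eq_iff forall_2 matrix_vector_mult_def sum_2 K_def d_def inner_vec_def algebra_simps)
    finally show ?thesis
      using l by (simp add: scaleR_matrix_vector_assoc[symmetric])
  qed
  then show ?thesis
    using deriv unfolding f by simp
qed

lemma jacobian_affine_expression: "jacobian (affine_expression G) (at X) = M"
  unfolding jacobian_def frechet_derivative_at[OF has_derivative_affine_expression, symmetric]
  by (rule matrix_of_matrix_vector_mul)

lemma \<pi>_\<phi>_eq_0:
  assumes "\<pi> y = 0" "\<phi> \<bullet> y = 0"
  shows "y = 0"
proof -
  have y: "y = y $ 3 *\<^sub>R v"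
    using assms(1) by (simp add: \<pi>_def vec_eq_iff forall_2 forall_3)
  then have "y $ 3 * (\<phi> \<bullet> v) = 0"
    using assms(2) by (metis inner_scaleR_right)
  then show ?thesis using y \<phi>v by simp
qed

text \<open>An eigenvector of \<open>l\<close> projects to a fixed vector of \<open>M\<close>; since
  all orbits of \<open>M\<close> tend to zero, the projection is zero and only multiples of
  \<open>v\<close> remain.\<close>

lemma eigenvector_dominant:
  assumes lim: "\<And>z. (\<lambda>q. ((*v) M ^^ q) z) \<longlonglongrightarrow> 0" and x: "eigenvector G l x"
  shows "x $ 3 \<noteq> 0" "x = x $ 3 *\<^sub>R v"
proof -
  have "l *\<^sub>R (M *v \<pi> x) = l *\<^sub>R \<pi> x"
    using x unfolding \<pi>_G[symmetric] by (simp add: eigenvector_def \<pi>_linear)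
  then have "M *v \<pi> x = \<pi> x" using l by simp
  then have "((*v) M ^^ q) (\<pi> x) = \<pi> x" for q
    by (induction q) auto
  then have "\<pi> x = 0"
    using lim[of "\<pi> x"] by (simp add: LIMSEQ_const_iff)
  then show *: "x = x $ 3 *\<^sub>R v"
    by (simp add: \<pi>_def vec_eq_iff forall_2 forall_3)
  show "x $ 3 \<noteq> 0"
    using x * by (auto simp: eigenvector_def)
qed

lemma normalized_chart:
  assumes "r \<in> {0, 1}"
  shows "(normalized_pentagram ^^ (2 * q + r)) P $ i - centroid P =
    sqrt (area P / area ((pentagram ^^ (2 * q + r)) P)) *\<^sub>R
      (correction r q i *\<^sub>R ((*v) M ^^ q) (\<xi> r $ i)
        - (1/6) *\<^sub>R (\<Sum>j\<in>UNIV. correction r q j *\<^sub>R ((*v) M ^^ q) (\<xi> r $ j)))"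
proof -
  have "centroid ((pentagram ^^ (2 * q + r)) P) = X + (1/6) *\<^sub>R (\<Sum>j\<in>UNIV. correction r q j *\<^sub>R ((*v) M ^^ q) (\<xi> r $ j))"
    by (simp add: centroid_def iterate_nth(1)[OF assms] correction_def sum.distrib scaleR_add_right
        sum_constant_scaleR del: sum_constant)
  then show ?thesis
    unfolding normalized_nth iterate_nth(1)[OF assms] correction_def by simp
qed

text \<open>The scalar \<open>c\<close> is there because the elliptic statement ranges over every
  eigenvector of \<open>l\<close>, and these are the nonzero multiples of \<open>v\<close>.\<close>

lemma hyperplane_facts:
  defines "W \<equiv> {w. \<phi> \<bullet> w = 0}"
  assumes "c \<noteq> 0"
  shows "subspace W" "dim W = 2" "\<exists>!y. y \<in> span {c *\<^sub>R v} \<and> x - y \<in> W"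
    "projection_along (c *\<^sub>R v) W x = (\<phi> \<bullet> x / (\<phi> \<bullet> v)) *\<^sub>R v"
proof -
  have "\<phi> \<noteq> 0" using \<phi>v by auto
  show "subspace W" unfolding W_def by (rule subspace_hyperplane)
  show "dim W = 2" unfolding W_def using dim_hyperplane[OF \<open>\<phi> \<noteq> 0\<close>] by simp
  have "y \<in> span {c *\<^sub>R v} \<and> x - y \<in> W \<longleftrightarrow> y = (\<phi> \<bullet> x / (\<phi> \<bullet> v)) *\<^sub>R v" for y
  proof
    assume "y \<in> span {c *\<^sub>R v} \<and> x - y \<in> W"
    then obtain k where "y = (k * c) *\<^sub>R v" "\<phi> \<bullet> x = \<phi> \<bullet> y"
      by (auto simp: span_singleton W_def inner_diff_right)
    then show "y = (\<phi> \<bullet> x / (\<phi> \<bullet> v)) *\<^sub>R v" using \<phi>v by simp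
  next
    assume y: "y = (\<phi> \<bullet> x / (\<phi> \<bullet> v)) *\<^sub>R v"
    then have "y = (\<phi> \<bullet> x / (\<phi> \<bullet> v) / c) *\<^sub>R (c *\<^sub>R v)"
      using \<open>c \<noteq> 0\<close> by simp
    then have "y \<in> span {c *\<^sub>R v}" by (metis rangeI span_singleton)
    then show "y \<in> span {c *\<^sub>R v} \<and> x - y \<in> W"
      using y \<phi>v by (simp add: W_def inner_diff_right)
  qed
  note * = this
  show "\<exists>!y. y \<in> span {c *\<^sub>R v} \<and> x - y \<in> W"
    unfolding * by simp
  show "projection_along (c *\<^sub>R v) W x = (\<phi> \<bullet> x / (\<phi> \<bullet> v)) *\<^sub>R v"
    unfolding projection_along_def * by simp
qed

text \<open>The left eigenvector \<phi> kills all eigenvectors of eigenvalues other than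
  \<open>l\<close>, which is one inclusion. Conversely, on the plane where \<phi> vanishes
  \<open>G\<close> satisfies the quadratic with roots \<open>k\<close> and \<open>cnj k\<close>, so
  vectors there split into eigenvectors.\<close>

lemma real_invariant_subspace_G:
  assumes k: "k + cnj k = of_real (3 - l)" "k * cnj k = of_real (det G / l)" and im: "Im k \<noteq> 0"
  shows "real_invariant_subspace G k = {w. \<phi> \<bullet> w = 0}"
proof (intro equalityI subsetI)
  fix w assume "w \<in> real_invariant_subspace G k"
  then obtain z z' where z: "complex_mat G *v z = k *s z" "complex_mat G *v z' = cnj k *s z'" "complex_vec w = z + z'"
    unfolding real_invariant_subspace_def by blast
  define \<Phi> :: "complex^3 \<Rightarrow> complex" where "\<Phi> z = (\<Sum>j\<in>UNIV. of_real (\<phi> $ j) * z $ j)" for z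
  have col: "(\<Sum>i\<in>UNIV. \<phi> $ i * G $ i $ j) = l * \<phi> $ j" for j
    using \<phi>[of "axis j 1"] by (simp add: inner_vec_def[of \<phi> "G *v _"] matrix_vector_mul_component inner_axis)
  have \<Phi>: "\<Phi> (complex_mat G *v z) = of_real l * \<Phi> z" for z
  proof -
    have "\<Phi> (complex_mat G *v z) = (\<Sum>j\<in>UNIV. of_real (\<Sum>i\<in>UNIV. \<phi> $ i * G $ i $ j) * z $ j)"
      by (simp add: \<Phi>_def matrix_vector_mult_def sum_3 algebra_simps)
    then show ?thesis
      unfolding col by (simp add: \<Phi>_def sum_distrib_left mult.assoc)
  qed
  have scale: "\<Phi> (m *s z) = m * \<Phi> z" for m z
    by (simp add: \<Phi>_def sum_distrib_left mult.left_commute)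
  have "k \<noteq> of_real l" "cnj k \<noteq> of_real l" using im by (auto simp: complex_eq_iff)
  then have "\<Phi> z = 0" "\<Phi> z' = 0"
    using \<Phi>[of z] \<Phi>[of z'] unfolding z scale by auto
  then have "\<Phi> (complex_vec w) = 0"
    unfolding z(3) by (simp add: \<Phi>_def distrib_left sum.distrib)
  moreover have "\<Phi> (complex_vec w) = of_real (\<phi> \<bullet> w)"
    by (simp add: \<Phi>_def inner_vec_def)
  ultimately show "w \<in> {w. \<phi> \<bullet> w = 0}" by simp
next
  fix w assume "w \<in> {w. \<phi> \<bullet> w = 0}"
  then have w: "\<phi> \<bullet> w = 0" by simp
  define e where "e = det G / l"
  \<comment> \<open>The quadratic applied to \<open>w\<close>. It is zero because both \<phi> and
    \<pi> annihilate it, the latter by Cayley-Hamilton for \<open>M\<close>.\<close>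
  define u where "u = G *v (G *v w) - (3 - l) *\<^sub>R (G *v w) + e *\<^sub>R w"
  have "\<phi> \<bullet> u = 0"
    by (simp add: u_def inner_add_right inner_diff_right \<phi> w)
  moreover have "\<pi> u = 0"
  proof -
    have CH: "M *v (M *v y) = trace M *\<^sub>R (M *v y) - det M *\<^sub>R y" for y
      by (simp add: vec_eq_iff forall_2 matrix_vector_mult_def sum_2 trace_def det_2 algebra_simps)
    have diff: "\<pi> (x - y) = \<pi> x - \<pi> y" for x y
      by (simp add: \<pi>_def vec_eq_iff forall_2 algebra_simps)
    have "\<pi> u = (l * l) *\<^sub>R (M *v (M *v \<pi> w)) - ((3 - l) * l) *\<^sub>R (M *v \<pi> w) + e *\<^sub>R \<pi> w"
      by (simp add: u_def \<pi>_linear diff \<pi>_G matrix_vector_mult_scaleR)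
    also have "\<dots> = (l * l * trace M - (3 - l) * l) *\<^sub>R (M *v \<pi> w) + (e - l * l * det M) *\<^sub>R \<pi> w"
      unfolding CH by (simp add: algebra_simps)
    also have "\<dots> = 0"
      using l by (simp add: det_M trace_G_mat[OF o] e_def power3_eq_cube)
    finally show ?thesis .
  qed
  ultimately have "u = 0" using \<pi>_\<phi>_eq_0 by blast
  then have GG: "G *v (G *v w) = (3 - l) *\<^sub>R (G *v w) - e *\<^sub>R w"
    by (simp add: u_def algebra_simps)
  define \<delta> where "\<delta> = k - cnj k"
  have "\<delta> \<noteq> 0" using im by (simp add: \<delta>_def complex_eq_iff)
  \<comment> \<open>The Lagrange spectral projections \<open>(G - cnj k) / (k - cnj k)\<close> and
    \<open>(k - G) / (k - cnj k)\<close> applied to \<open>w\<close>.\<close>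
  define z where "z = (1 / \<delta>) *s (complex_vec (G *v w) - cnj k *s complex_vec w)"
  define z' where "z' = (1 / \<delta>) *s (k *s complex_vec w - complex_vec (G *v w))"
  have GGc: "complex_mat G *v complex_vec (G *v w) = (k + cnj k) *s complex_vec (G *v w) - (k * cnj k) *s complex_vec w"
    unfolding k e_def[symmetric] complex_mat_mult GG by (simp add: vec_eq_iff algebra_simps)
  have "complex_mat G *v z = k *s z"
    unfolding z_def vector_scalar_commute matrix_vector_mult_diff_distrib GGc
    unfolding complex_mat_mult
    by (simp add: vec_eq_iff algebra_simps)
  moreover have "complex_mat G *v z' = cnj k *s z'"
    unfolding z'_def vector_scalar_commute matrix_vector_mult_diff_distrib GGc
    unfolding complex_mat_mult
    by (simp add: vec_eq_iff algebra_simps)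
  moreover have "z + z' = complex_vec w"
  proof -
    have "z + z' = (1 / \<delta>) *s (\<delta> *s complex_vec w)"
      by (simp add: z_def z'_def \<delta>_def vec_eq_iff algebra_simps)
    then show ?thesis using \<open>\<delta> \<noteq> 0\<close> by (simp add: vec_eq_iff)
  qed
  ultimately show "w \<in> real_invariant_subspace G k"
    unfolding real_invariant_subspace_def by (intro CollectI exI[of _ z] exI[of _ z']) simp
qed

end

section \<open>The elliptic alternative\<close>

lemma positive_definite_coercive:
  fixes H :: "real^'n^'n"
  assumes "positive_definite_symmetric H"
  obtains m where "m > 0" "\<And>x. m * (norm x)\<^sup>2 \<le> x \<bullet> (H *v x)"
proof -
  have cont: "continuous_on (sphere 0 1) (\<lambda>x. x \<bullet> (H *v x))"
    by (intro continuous_intros matrix_vector_mult_linear_continuous_on)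
  have "axis undefined 1 \<in> sphere (0 :: real^'n) 1"
    by (simp add: norm_axis_1)
  then have ne: "sphere (0 :: real^'n) 1 \<noteq> {}" by blast
  obtain y where y: "y \<in> sphere 0 1" "\<And>x. x \<in> sphere 0 1 \<Longrightarrow> y \<bullet> (H *v y) \<le> x \<bullet> (H *v x)"
    using continuous_attains_inf[OF compact_sphere ne cont] by blast
  have "y \<bullet> (H *v y) * (norm x)\<^sup>2 \<le> x \<bullet> (H *v x)" for x
  proof (cases "x = 0")
    case False
    then have "(1 / norm x) *\<^sub>R x \<in> sphere 0 1" by simp
    from y(2)[OF this] have "y \<bullet> (H *v y) \<le> (x \<bullet> (H *v x)) / (norm x)\<^sup>2"
      by (simp add: matrix_vector_mult_scaleR power2_eq_square)
    then show ?thesis using False by (simp add: field_simps)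
  qed simp
  moreover have "y \<noteq> 0" using y(1) by auto
  then have "y \<bullet> (H *v y) > 0"
    using assms unfolding positive_definite_symmetric_def by blast
  ultimately show ?thesis using that by blast
qed

text \<open>The form of \<open>H\<close> is \<open>x \<mapsto> 2 * sgn c * det2 x (M *v x)\<close>,
  and \<open>det2\<close> of two \<open>M\<close>-images gains the factor \<open>det M\<close>. It
  is definite because \<open>M\<close> has no real eigenvector.\<close>

lemma invariant_ellipse:
  fixes M :: "real^2^2"
  assumes neg: "(trace M)\<^sup>2 < 4 * det M"
  obtains H where "positive_definite_symmetric H" "transpose M ** H ** M = det M *\<^sub>R H"
    "\<And>H'. positive_definite_symmetric H' \<Longrightarrow> transpose M ** H' ** M = det M *\<^sub>R H' \<Longrightarrow> \<exists>c>0. H' = c *\<^sub>R H"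
proof -
  define a b c d where "a = M $ 1 $ 1" "b = M $ 1 $ 2" "c = M $ 2 $ 1" "d = M $ 2 $ 2"
  note n = this[symmetric]
  have neg': "(d - a)\<^sup>2 + 4 * b * c < 0"
    using neg by (simp add: trace_def sum_2 det_2 n power2_eq_square algebra_simps)
  then have "b * c < 0" using zero_le_power2[of "d - a"] by linarith
  then have "c \<noteq> 0" by auto
  have det: "det M = a * d - b * c" by (simp add: det_2 n)
  have "det M > 0" using neg by (smt (verit) zero_le_power2)
  \<comment> \<open>Completing the square below shows that the form without this factor has the sign
    of \<open>c\<close>.\<close>
  define \<sigma> where "\<sigma> = sgn c"
  have \<sigma>: "\<sigma> * c = \<bar>c\<bar>" "\<sigma> \<noteq> 0" using \<open>c \<noteq> 0\<close> by (simp_all add: \<sigma>_def abs_sgn mult.commute sgn_if)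
  define H :: "real^2^2" where "H = \<sigma> *\<^sub>R vector [vector [2 * c, d - a], vector [d - a, - 2 * b]]"
  have form: "c * (x \<bullet> (H *v x)) = \<sigma> * (2 * ((c * x $ 1 + (d - a) / 2 * x $ 2)\<^sup>2 - ((d - a)\<^sup>2 + 4 * b * c) / 4 * (x $ 2)\<^sup>2))" for x
    by (simp add: H_def inner_vec_def matrix_vector_mult_def sum_2 power2_eq_square field_simps)
  have "x \<bullet> (H *v x) > 0" if "x \<noteq> 0" for x
  proof -
    define Z where "Z = (c * x $ 1 + (d - a) / 2 * x $ 2)\<^sup>2 - ((d - a)\<^sup>2 + 4 * b * c) / 4 * (x $ 2)\<^sup>2"
    have "Z > 0"
    proof (cases "x $ 2 = 0")
      case True
      then have "x $ 1 \<noteq> 0" using that by (auto simp: vec_eq_iff forall_2)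
      then show ?thesis using True \<open>c \<noteq> 0\<close> by (simp add: Z_def)
    next
      case False
      then have "((d - a)\<^sup>2 + 4 * b * c) / 4 * (x $ 2)\<^sup>2 < 0"
        using neg' by (intro mult_neg_pos) auto
      then show ?thesis
        unfolding Z_def using zero_le_power2[of "c * x $ 1 + (d - a) / 2 * x $ 2"] by linarith
    qed
    have "\<sigma> * \<sigma> = 1" using \<open>c \<noteq> 0\<close> by (simp add: \<sigma>_def sgn_if)
    then have "\<sigma> * (c * (x \<bullet> (H *v x))) = 2 * Z"
      unfolding form Z_def[symmetric] by algebra
    then have "\<bar>c\<bar> * (x \<bullet> (H *v x)) > 0"
      using \<open>Z > 0\<close> unfolding \<sigma>(1)[symmetric] by (simp add: mult.assoc)
    then show ?thesis
      by (rule zero_less_mult_pos) (simp add: \<open>c \<noteq> 0\<close>)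
  qed
  moreover have "transpose H = H"
    by (simp add: H_def transpose_def vec_eq_iff forall_2)
  ultimately have pd: "positive_definite_symmetric H"
    by (simp add: positive_definite_symmetric_def)
  have inv: "transpose M ** H ** M = det M *\<^sub>R H"
    by (simp add: H_def det vec_eq_iff forall_2 matrix_matrix_mult_def transpose_def sum_2 n algebra_simps)
  have "\<exists>k>0. H' = k *\<^sub>R H"
    if pd': "positive_definite_symmetric H'" and inv': "transpose M ** H' ** M = det M *\<^sub>R H'" for H'
  proof -
    define p q r where "p = H' $ 1 $ 1" "q = H' $ 1 $ 2" "r = H' $ 2 $ 2"
    note m = this[symmetric]
    have sym: "H' $ 2 $ 1 = q"
    proof -
      have "transpose H' $ 2 $ 1 = H' $ 2 $ 1"
        using pd' by (simp add: positive_definite_symmetric_def)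
      then show ?thesis by (simp add: transpose_def m)
    qed
    have "(axis 1 1 :: real^2) \<noteq> 0" by (simp add: axis_eq_0_iff)
    then have "(axis 1 1 :: real^2) \<bullet> (H' *v axis 1 1) > 0"
      using pd' unfolding positive_definite_symmetric_def by blast
    then have "p > 0"
      by (simp add: inner_axis' matrix_vector_mul_component inner_axis m)
    have e11: "(a * p + c * q) * a + (a * q + c * r) * c = (a * d - b * c) * p"
      and e12: "(a * p + c * q) * b + (a * q + c * r) * d = (a * d - b * c) * q"
      using arg_cong[OF inv', of "\<lambda>A. A $ 1 $ 1"] arg_cong[OF inv', of "\<lambda>A. A $ 1 $ 2"]
      by (simp_all add: det matrix_matrix_mult_def transpose_def sum_2 n m sym algebra_simps)
    \<comment> \<open>The invariance equations are linear in the entries \<open>p\<close>,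
      \<open>q\<close>, \<open>r\<close>; the first row already determines \<open>q\<close> and
      \<open>r\<close> from \<open>p\<close>.\<close>
    have "det M * ((a - d) * p + 2 * c * q) = 0" "det M * (c * r + b * p) = 0"
      unfolding det using e11 e12 by algebra+
    then have "(a - d) * p + 2 * c * q = 0" "c * r + b * p = 0"
      using \<open>det M > 0\<close> by simp_all
    then have qr: "q * (2 * c) = p * (d - a)" "r * (2 * c) = p * (- 2 * b)"
      by algebra+
    have cancel: "p / (2 * (\<sigma> * c)) * (\<sigma> * t) = p * t / (2 * c)" for t
      using \<sigma>(2) by simp
    have "H' $ 1 $ 1 = p * (2 * c) / (2 * c)" "H' $ 1 $ 2 = p * (d - a) / (2 * c)"
      "H' $ 2 $ 1 = p * (d - a) / (2 * c)" "H' $ 2 $ 2 = p * (- 2 * b) / (2 * c)"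
      unfolding qr[symmetric] m sym using \<open>c \<noteq> 0\<close> by simp_all
    then have "H' = (p / (2 * \<bar>c\<bar>)) *\<^sub>R H"
      unfolding \<sigma>(1)[symmetric] H_def vec_eq_iff forall_2 vector_scaleR_component real_scaleR_def vector_2 cancel
      by simp
    then show ?thesis
      using \<open>p > 0\<close> \<open>c \<noteq> 0\<close> by (intro exI[of _ "p / (2 * \<bar>c\<bar>)"]) auto
  qed
  then show ?thesis using that pd inv by blast
qed

context pentagram_chart
begin

lemma base_lift_vertex:
  assumes "r \<in> {0, 1}"
  obtains c where "c > 0" "homog_lift ((pentagram ^^ r) P $ i) = c *\<^sub>R base_lift r i"
  using represents_iterate[OF assms, of 0] unfolding represents_def by auto

lemma iterate_G_vertex:
  assumes r: "r \<in> {0, 1}"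
  shows "(((*v) G ^^ q) (homog_lift ((pentagram ^^ r) P $ i))) $ 3 \<noteq> 0"
    and "affine_point (((*v) G ^^ q) (homog_lift ((pentagram ^^ r) P $ i))) =
      X + correction r q i *\<^sub>R ((*v) M ^^ q) (\<xi> r $ i)"
proof -
  obtain c where c: "c > 0" "homog_lift ((pentagram ^^ r) P $ i) = c *\<^sub>R base_lift r i"
    using base_lift_vertex[OF r] .
  show "(((*v) G ^^ q) (homog_lift ((pentagram ^^ r) P $ i))) $ 3 \<noteq> 0"
    using third_iterate[OF r, of q i] c by (simp add: funpow_matrix_linear)
  have "affine_point (((*v) G ^^ q) (homog_lift ((pentagram ^^ r) P $ i))) = affine_point (((*v) G ^^ q) (base_lift r i))"
    using c by (simp add: funpow_matrix_linear affine_point_scaleR)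
  also have "\<dots> = (pentagram ^^ (2 * q + r)) P $ i"
    using represents_affine_point[OF represents_iterate[OF r]] by simp
  finally show "affine_point (((*v) G ^^ q) (homog_lift ((pentagram ^^ r) P $ i))) =
      X + correction r q i *\<^sub>R ((*v) M ^^ q) (\<xi> r $ i)"
    by (simp add: iterate_nth(1)[OF r] correction_def)
qed

end

section \<open>Bounded orbits and their limits\<close>

lemma norm_funpow_isometry_bound:
  fixes R H :: "real^'n^'n"
  assumes pd: "positive_definite_symmetric H" and inv: "\<And>x. (R *v x) \<bullet> (H *v (R *v x)) = x \<bullet> (H *v x)"
  obtains C where "\<And>q. norm (((*v) R ^^ q) x) \<le> C"
proof -
  obtain m where m: "m > 0" "\<And>x. m * (norm x)\<^sup>2 \<le> x \<bullet> (H *v x)"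
    using positive_definite_coercive[OF pd] by blast
  have "norm (((*v) R ^^ q) x) \<le> sqrt (x \<bullet> (H *v x) / m)" for q
  proof -
    have "((*v) R ^^ q) x \<bullet> (H *v ((*v) R ^^ q) x) = x \<bullet> (H *v x)"
      by (induction q) (simp_all add: inv)
    then have "(norm (((*v) R ^^ q) x))\<^sup>2 \<le> x \<bullet> (H *v x) / m"
      using m(1) m(2)[of "((*v) R ^^ q) x"] by (simp add: field_simps)
    then show ?thesis by (simp add: real_le_rsqrt)
  qed
  then show ?thesis using that by blast
qed

lemma tendsto_bounded_scaleR_zero:
  fixes f :: "nat \<Rightarrow> 'a::real_normed_vector"
  assumes "a \<longlonglongrightarrow> 0" "\<And>q. norm (f q) \<le> C"
  shows "(\<lambda>q. a q *\<^sub>R f q) \<longlonglongrightarrow> 0"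
proof (rule Lim_null_comparison)
  show "\<forall>\<^sub>F q in sequentially. norm (a q *\<^sub>R f q) \<le> \<bar>a q\<bar> * C"
    using assms(2) by (simp add: mult_left_mono)
  show "(\<lambda>q. \<bar>a q\<bar> * C) \<longlonglongrightarrow> 0"
    using tendsto_mult[OF tendsto_rabs[OF assms(1)] tendsto_const[of C]] by simp
qed

text \<open>Neither sequence has to converge: \<open>y\<close> only approaches a bounded
  \<open>z\<close> that runs on a level set of the form.\<close>

lemma tendsto_quadratic_form:
  fixes H :: "real^'n^'n"
  assumes "(\<lambda>q. y q - z q) \<longlonglongrightarrow> 0" "\<And>q. norm (z q) \<le> C" "\<And>q. z q \<bullet> (H *v z q) = s"
  shows "(\<lambda>q. y q \<bullet> (H *v y q)) \<longlonglongrightarrow> s"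
proof -
  define d where "d = (\<lambda>q. y q - z q)"
  have d: "d \<longlonglongrightarrow> 0" using assms(1) by (simp add: d_def)
  have Hd: "(\<lambda>q. H *v d q) \<longlonglongrightarrow> H *v 0"
    by (rule bounded_linear.tendsto[OF matrix_vector_mul_bounded_linear d])
  have null: "(\<lambda>q. a q \<bullet> b q) \<longlonglongrightarrow> 0"
    if "b \<longlonglongrightarrow> 0" "\<And>q. norm (a q) \<le> K" for a b :: "nat \<Rightarrow> real^'n" and K
  proof (rule Lim_null_comparison)
    have "norm (a q \<bullet> b q) \<le> K * norm (b q)" for q
    proof -
      have "norm (a q \<bullet> b q) \<le> norm (a q) * norm (b q)"
        by (simp add: Cauchy_Schwarz_ineq2)
      also have "\<dots> \<le> K * norm (b q)"
        using that(2) by (intro mult_right_mono) auto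
      finally show ?thesis .
    qed
    then show "\<forall>\<^sub>F q in sequentially. norm (a q \<bullet> b q) \<le> K * norm (b q)"
      by simp
    show "(\<lambda>q. K * norm (b q)) \<longlonglongrightarrow> 0"
      using tendsto_mult[OF tendsto_const[of K] tendsto_norm[OF that(1)]] by simp
  qed
  obtain K where K: "\<And>x. norm (H *v x) \<le> norm x * K"
    using bounded_linear.bounded[OF matrix_vector_mul_bounded_linear[of H]] by blast
  have "norm (H *v z q) \<le> C * \<bar>K\<bar>" for q
  proof -
    have "norm (H *v z q) \<le> norm (z q) * \<bar>K\<bar>"
      using K[of "z q"] by (metis abs_ge_self mult_left_mono norm_ge_zero order_trans)
    also have "\<dots> \<le> C * \<bar>K\<bar>" using assms(2) by (intro mult_right_mono) auto
    finally show ?thesis .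
  qed
  from null[OF d this] have 1: "(\<lambda>q. d q \<bullet> (H *v z q)) \<longlonglongrightarrow> 0"
    by (simp add: inner_commute)
  have 2: "(\<lambda>q. z q \<bullet> (H *v d q)) \<longlonglongrightarrow> 0"
    using null[OF _ assms(2)] Hd by simp
  have 3: "(\<lambda>q. d q \<bullet> (H *v d q)) \<longlonglongrightarrow> 0 \<bullet> (H *v 0)"
    by (intro tendsto_inner d Hd)
  have "y q \<bullet> (H *v y q) = s + d q \<bullet> (H *v z q) + z q \<bullet> (H *v d q) + d q \<bullet> (H *v d q)" for q
  proof -
    have "y q = z q + d q" by (simp add: d_def)
    then show ?thesis
      by (simp add: matrix_vector_right_distrib inner_add_left inner_add_right assms(3))
  qed
  moreover have "(\<lambda>q. s + d q \<bullet> (H *v z q) + z q \<bullet> (H *v d q) + d q \<bullet> (H *v d q)) \<longlonglongrightarrow> s + 0 + 0 + 0"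
    using 3 by (intro tendsto_add tendsto_const 1 2) simp
  ultimately show ?thesis by simp
qed

context pentagram_chart
begin

lemma elliptic_alternative:
  assumes neg: "Discr P < 0"
  shows "elliptic_alternative P"
proof -
  define e where "e = det G / l"
  have "(3 - l)\<^sup>2 - 4 * e < 0"
    using neg unfolding Discr_eq e_def[symmetric]
    by (metis mult_less_0_iff not_less zero_le_power2)
  \<comment> \<open>The root with positive imaginary part of
    \<open>x\<^sup>2 - (3 - l) * x + e\<close>, the quadratic factor left by the root
    \<open>l\<close>.\<close>
  define l2 where "l2 = Complex ((3 - l) / 2) (sqrt (4 * e - (3 - l)\<^sup>2) / 2)"
  have im: "Im l2 \<noteq> 0" using \<open>(3 - l)\<^sup>2 - 4 * e < 0\<close> by (simp add: l2_def)
  have sum: "l2 + cnj l2 = of_real (3 - l)"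
    by (simp add: l2_def complex_eq_iff)
  have "(cmod l2)\<^sup>2 = e"
    using \<open>(3 - l)\<^sup>2 - 4 * e < 0\<close> by (simp add: cmod_power2 l2_def power_divide field_simps)
  then have prod: "l2 * cnj l2 = of_real (det G / l)"
    by (simp add: complex_norm_square[symmetric] e_def)
  have eigs: "complex_eigenvalues G = {of_real l, l2, cnj l2}"
    by (rule complex_eigenvalues_G[OF sum prod])
  have dom: "cmod l2 < l"
    by (rule dominant) (use eigs im in auto)
  define \<tau> where "\<tau> = cmod l2 / \<bar>l\<bar>"
  have \<tau>: "\<tau> > 0" "\<tau> < 1" "\<tau> = cmod l2 / l"
  proof -
    have "cmod l2 > 0" using im by auto
    then show "\<tau> > 0" "\<tau> < 1" "\<tau> = cmod l2 / l" using dom l by (simp_all add: \<tau>_def)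
  qed
  have \<tau>2: "\<tau>\<^sup>2 = det M"
    using l \<open>(cmod l2)\<^sup>2 = e\<close> by (simp add: \<tau>(3) power_divide det_M e_def power2_eq_square power3_eq_cube)
  have trM: "trace M = 2 * Re l2 / l"
    using l by (simp add: det_M trace_G_mat[OF o] l2_def field_simps)
  have "(trace M)\<^sup>2 < 4 * det M"
  proof -
    have "det M = e / l\<^sup>2"
      using l by (simp add: det_M e_def power2_eq_square power3_eq_cube)
    moreover have "(3 - l)\<^sup>2 / l\<^sup>2 < 4 * e / l\<^sup>2"
      using l \<open>(3 - l)\<^sup>2 - 4 * e < 0\<close> by (intro divide_strict_right_mono) simp_all
    ultimately show ?thesis
      by (simp add: det_M trace_G_mat[OF o] power_divide)
  qed
  then obtain H where H: "positive_definite_symmetric H" "transpose M ** H ** M = \<tau>\<^sup>2 *\<^sub>R H"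
    "\<And>H'. positive_definite_symmetric H' \<Longrightarrow> transpose M ** H' ** M = \<tau>\<^sup>2 *\<^sub>R H' \<Longrightarrow> \<exists>c>0. H' = c *\<^sub>R H"
    using invariant_ellipse[of M] unfolding \<tau>2 by metis
  define R where "R = (1 / \<tau>) *\<^sub>R M"
  have MR: "((*v) M ^^ q) x = \<tau> ^ q *\<^sub>R ((*v) R ^^ q) x" for q x
  proof (induction q)
    case (Suc q)
    have "M *v y = \<tau> *\<^sub>R (R *v y)" for y
      using \<tau>(1) by (simp add: R_def scaleR_matrix_vector_assoc[symmetric])
    then show ?case using Suc by (simp add: matrix_vector_mult_scaleR)
  qed simp
  have HM: "(M *v x) \<bullet> (H *v (M *v x)) = \<tau>\<^sup>2 * (x \<bullet> (H *v x))" for x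
  proof -
    have "(M *v x) \<bullet> z = (transpose M *v z) \<bullet> x" for z
      by (simp add: dot_lmul_matrix inner_commute[of z])
    then have "(M *v x) \<bullet> (H *v (M *v x)) = ((transpose M ** H ** M) *v x) \<bullet> x"
      by (simp only: matrix_vector_mul_assoc matrix_mul_assoc)
    then show ?thesis unfolding H(2) by (simp add: scaleR_matrix_vector_assoc[symmetric] inner_commute)
  qed
  have HR: "(R *v x) \<bullet> (H *v (R *v x)) = x \<bullet> (H *v x)" for x
    using HM[of x] \<tau>(1) by (simp add: R_def scaleR_matrix_vector_assoc[symmetric] matrix_vector_mult_scaleR power2_eq_square field_simps)
  have HRq: "((*v) R ^^ q) x \<bullet> (H *v ((*v) R ^^ q) x) = x \<bullet> (H *v x)" for q x
    by (induction q) (simp_all add: HR)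
  have "\<exists>C. \<forall>q. norm (((*v) R ^^ q) x) \<le> C" for x
    using norm_funpow_isometry_bound[OF H(1) HR] by blast
  then obtain C where C: "\<And>q x. norm (((*v) R ^^ q) x) \<le> C x" by metis
  have \<tau>q: "(\<lambda>q. \<tau> ^ q) \<longlonglongrightarrow> 0" using \<tau> by (simp add: LIMSEQ_power_zero)
  have lim: "(\<lambda>q. ((*v) M ^^ q) z) \<longlonglongrightarrow> 0" for z
    unfolding MR by (rule tendsto_bounded_scaleR_zero[OF \<tau>q C])
  define w where "w r i = \<xi> r $ i - (1/6) *\<^sub>R (\<Sum>j\<in>UNIV. \<xi> r $ j)" for r i
  have w_centroid: "w r i = \<xi> r $ i - centroid (\<xi> r)" for r i
    by (simp add: w_def centroid_def)
  have B: "\<bar>(1/2) * (\<Sum>i\<in>UNIV. det2 (w r i) (w r (i + 1)))\<bar> = area (\<xi> r)" for r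
    unfolding w_centroid by (rule area_diff[symmetric])
  have w_ne: "w r i \<noteq> 0" for r i
    using centroid_ne_vertex[OF oriented_\<xi>, of r i] by (simp add: w_centroid)
  have big_O: "(\<lambda>q. norm (affine_point (((*v) G ^^ q) (homog_lift ((pentagram ^^ r) P $ i)))
      - (X + \<tau> ^ q *\<^sub>R ((*v) R ^^ q) (\<xi> r $ i)))) \<in> O(\<lambda>q. \<tau> ^ (2 * q))"
    if r: "r \<in> {0, 1}" for r i
  proof -
    define y where "y q = ((*v) M ^^ q) (\<xi> r $ i)" for q
    obtain K where K: "K > 0" "\<And>x. \<bar>\<psi> x\<bar> \<le> K * norm x"
      using linear_bounded_pos[OF linear_\<psi>] by (metis real_norm_def)
    have y: "norm (y q) \<le> \<tau> ^ q * C (\<xi> r $ i)" for q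
      unfolding y_def MR using C[of q "\<xi> r $ i"] \<tau> by simp
    have small: "\<forall>\<^sub>F q in sequentially. correction r q i < 2"
      using correction_tendsto[OF lim] by (rule order_tendstoD) simp
    \<comment> \<open>The error is second order: the correction factor differs from 1 by at most
      twice \<open>\<bar>\<psi> (y q)\<bar>\<close>, hence by a multiple of
      \<open>norm (y q)\<close>, and it multiplies \<open>y q\<close>, itself of order
      \<open>\<tau> ^ q\<close>.\<close>
    have "\<forall>\<^sub>F q in sequentially. norm (correction r q i *\<^sub>R y q - y q) \<le> 2 * K * (C (\<xi> r $ i))\<^sup>2 * \<tau> ^ (2 * q)"
      using small
    proof eventually_elim
      case (elim q)
      have pos: "1 + \<psi> (y q) > 0" using iterate_nth(2)[OF r] by (simp add: y_def)
      have "correction r q i - 1 = - correction r q i * \<psi> (y q)"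
        using pos by (simp add: correction_def y_def[symmetric] field_simps)
      then have "correction r q i *\<^sub>R y q - y q = (- correction r q i * \<psi> (y q)) *\<^sub>R y q"
        by (metis scaleR_left_diff_distrib scaleR_one)
      then have "norm (correction r q i *\<^sub>R y q - y q) = \<bar>correction r q i\<bar> * \<bar>\<psi> (y q)\<bar> * norm (y q)"
        by (simp add: abs_mult)
      also have "\<bar>correction r q i\<bar> \<le> 2"
        using elim pos by (simp add: correction_def y_def)
      then have "\<bar>correction r q i\<bar> * \<bar>\<psi> (y q)\<bar> * norm (y q) \<le> 2 * (K * norm (y q)) * norm (y q)"
        using K by (intro mult_mono) auto
      also have "\<dots> = 2 * K * (norm (y q))\<^sup>2" by (simp add: power2_eq_square)
      also have "\<dots> \<le> 2 * K * (\<tau> ^ q * C (\<xi> r $ i))\<^sup>2"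
        using K y by (intro mult_left_mono power_mono) auto
      also have "\<dots> = 2 * K * (C (\<xi> r $ i))\<^sup>2 * \<tau> ^ (2 * q)"
        by (simp add: power_mult_distrib power_mult[symmetric] mult.commute)
      finally show ?case .
    qed
    then show ?thesis
      using \<tau> unfolding iterate_G_vertex(2)[OF r] MR[symmetric] y_def[symmetric]
      by (intro bigoI[of _ "2 * K * (C (\<xi> r $ i))\<^sup>2"]) simp
  qed
  define \<sigma> where "\<sigma> r = sqrt (area P / area (\<xi> r))" for r
  have areaP: "area P > 0" using area_pos[OF o] .
  have normalized_lim: "(\<lambda>q. (normalized_pentagram ^^ (2 * q + r)) P $ i - centroid P - \<sigma> r *\<^sub>R ((*v) R ^^ q) (w r i)) \<longlonglongrightarrow> 0"
    if r: "r \<in> {0, 1}" for r i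
  proof -
    define a where "a q = area ((pentagram ^^ (2 * q + r)) P) / det M ^ q" for q
    have a: "a \<longlonglongrightarrow> area (\<xi> r)"
      unfolding a_def by (rule area_iterate_tendsto[OF r lim])
    define \<rho> where "\<rho> q = sqrt (area P / a q)" for q
    have \<rho>: "\<rho> \<longlonglongrightarrow> \<sigma> r"
      unfolding \<rho>_def \<sigma>_def using area_\<xi>[of r] by (intro tendsto_intros a) auto
    \<comment> \<open>As \<open>det M = \<tau>\<^sup>2\<close>, the area quotient grows like
      \<open>\<tau> ^ (2 * q)\<close> decays, and its square root cancels the contraction
      \<open>\<tau> ^ q\<close> exactly.\<close>
    have sq: "sqrt (area P / area ((pentagram ^^ (2 * q + r)) P)) * \<tau> ^ q = \<rho> q" for q
    proof -
      have "\<rho> q = sqrt (area P / area ((pentagram ^^ (2 * q + r)) P) * (\<tau> ^ q)\<^sup>2)"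
        by (simp add: \<rho>_def a_def \<tau>2[symmetric] power_mult[symmetric] mult.commute)
      then show ?thesis using \<tau>(1) unfolding real_sqrt_mult by simp
    qed
    \<comment> \<open>Deviation from the limiting rotation at vertex \<open>j\<close>: a scalar
      tending to zero times a bounded \<open>R\<close>-orbit.\<close>
    define d where "d q j = (\<rho> q * correction r q j - \<sigma> r) *\<^sub>R ((*v) R ^^ q) (\<xi> r $ j)" for q j
    have d: "(\<lambda>q. d q j) \<longlonglongrightarrow> 0" for j
      unfolding d_def
    proof (rule tendsto_bounded_scaleR_zero[OF _ C])
      have "(\<lambda>q. \<rho> q * correction r q j - \<sigma> r) \<longlonglongrightarrow> \<sigma> r * 1 - \<sigma> r"
        by (intro tendsto_intros \<rho> correction_tendsto lim)
      then show "(\<lambda>q. \<rho> q * correction r q j - \<sigma> r) \<longlonglongrightarrow> 0" by simp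
    qed
    have Rw: "((*v) R ^^ q) (w r i) = ((*v) R ^^ q) (\<xi> r $ i) - (1/6) *\<^sub>R (\<Sum>j\<in>UNIV. ((*v) R ^^ q) (\<xi> r $ j))" for q
    proof -
      have "((*v) R ^^ q) (w r i) + ((*v) R ^^ q) ((1/6) *\<^sub>R (\<Sum>j\<in>UNIV. \<xi> r $ j)) = ((*v) R ^^ q) (\<xi> r $ i)"
        unfolding funpow_matrix_linear(1)[symmetric] w_def by simp
      then show ?thesis
        by (simp add: funpow_matrix_linear sum_6 algebra_simps)
    qed
    have "(normalized_pentagram ^^ (2 * q + r)) P $ i - centroid P - \<sigma> r *\<^sub>R ((*v) R ^^ q) (w r i)
      = d q i - (1/6) *\<^sub>R (\<Sum>j\<in>UNIV. d q j)" for q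
    proof -
      have "(normalized_pentagram ^^ (2 * q + r)) P $ i - centroid P =
        (\<rho> q * correction r q i) *\<^sub>R ((*v) R ^^ q) (\<xi> r $ i)
        - (1/6) *\<^sub>R (\<Sum>j\<in>UNIV. (\<rho> q * correction r q j) *\<^sub>R ((*v) R ^^ q) (\<xi> r $ j))"
        unfolding normalized_chart[OF r] MR sq[symmetric]
        by (simp add: scaleR_diff_right scaleR_sum_right mult_ac)
      then show ?thesis
        unfolding Rw d_def
        by (simp add: scaleR_left_diff_distrib sum_subtractf scaleR_diff_right scaleR_sum_right mult_ac)
    qed
    moreover have "(\<lambda>q. d q i - (1/6) *\<^sub>R (\<Sum>j\<in>UNIV. d q j)) \<longlonglongrightarrow> 0 - (1/6) *\<^sub>R (\<Sum>j\<in>(UNIV :: 6 set). 0)"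
      by (intro tendsto_intros d)
    ultimately show ?thesis by simp
  qed
  define level where "level r i = area P / area (\<xi> r) * (w r i \<bullet> (H *v w r i))" for r i
  have level_pos: "level r i > 0" for r i
    using H(1) w_ne[of r i] areaP area_\<xi>[of r] by (simp add: level_def positive_definite_symmetric_def)
  have \<sigma>2: "\<sigma> r * \<sigma> r = area P / area (\<xi> r)" for r
    using areaP area_\<xi>[of r] by (simp add: \<sigma>_def)
  have on_ellipse: "(\<sigma> r *\<^sub>R ((*v) R ^^ q) (w r i)) \<bullet> (H *v (\<sigma> r *\<^sub>R ((*v) R ^^ q) (w r i))) = level r i" for r q i
    by (simp add: matrix_vector_mult_scaleR HRq level_def \<sigma>2[symmetric])
  have form_lim: "(\<lambda>q. ((normalized_pentagram ^^ (2 * q + r)) P $ i - centroid P) \<bullet>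
      (H *v ((normalized_pentagram ^^ (2 * q + r)) P $ i - centroid P))) \<longlonglongrightarrow> level r i"
    if r: "r \<in> {0, 1}" for r i
  proof (rule tendsto_quadratic_form[OF normalized_lim[OF r] _ on_ellipse])
    show "norm (\<sigma> r *\<^sub>R ((*v) R ^^ q) (w r i)) \<le> \<bar>\<sigma> r\<bar> * C (w r i)" for q
      using C[of q "w r i"] by (simp add: mult_left_mono)
  qed
  have ellipse_lim: "(\<lambda>q. infdist ((normalized_pentagram ^^ (2 * q + r)) P $ i)
      {x. (x - centroid P) \<bullet> (H *v (x - centroid P)) = level r i}) \<longlonglongrightarrow> 0"
    if r: "r \<in> {0, 1}" for r i
  proof (rule Lim_null_comparison[OF _ tendsto_norm_zero[OF normalized_lim[OF r, of i]]], intro always_eventually allI)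
    fix q
    have "infdist ((normalized_pentagram ^^ (2 * q + r)) P $ i) {x. (x - centroid P) \<bullet> (H *v (x - centroid P)) = level r i}
      \<le> dist ((normalized_pentagram ^^ (2 * q + r)) P $ i) (centroid P + \<sigma> r *\<^sub>R ((*v) R ^^ q) (w r i))"
      by (rule infdist_le) (simp only: mem_Collect_eq add_diff_cancel_left' on_ellipse)
    then show "norm (infdist ((normalized_pentagram ^^ (2 * q + r)) P $ i) {x. (x - centroid P) \<bullet> (H *v (x - centroid P)) = level r i})
      \<le> norm ((normalized_pentagram ^^ (2 * q + r)) P $ i - centroid P - \<sigma> r *\<^sub>R ((*v) R ^^ q) (w r i))"
      by (simp add: dist_norm infdist_nonneg algebra_simps)
  qed
  have detR: "det R = 1"
    using \<tau>(1) \<tau>2 by (simp add: R_def det_2 power2_eq_square field_simps)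
  have eigR: "complex_eigenvalues R = {exp (\<i> * of_real \<theta>), exp (- (\<i> * of_real \<theta>))}"
    if \<theta>: "l2 / of_real l = of_real \<tau> * exp (\<i> * of_real \<theta>)" for \<theta>
  proof -
    have "Re (l2 / of_real l) = \<tau> * cos \<theta>"
      unfolding \<theta> by (simp add: Re_exp)
    then have "trace M = 2 * \<tau> * cos \<theta>"
      unfolding trM by simp
    then have "trace R = 2 * cos \<theta>"
      using \<tau>(1) by (simp add: R_def trace_def sum_2 field_simps)
    then have tr: "of_real (trace R) = exp (\<i> * of_real \<theta>) + exp (- (\<i> * of_real \<theta>))"
      by (simp add: exp_Euler exp_minus_Euler cos_of_real)
    have one: "exp (\<i> * of_real \<theta>) * exp (- (\<i> * of_real \<theta>)) = 1"
      by (simp flip: exp_add)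
    have "k\<^sup>2 - of_real (trace R) * k + of_real (det R) = (k - exp (\<i> * of_real \<theta>)) * (k - exp (- (\<i> * of_real \<theta>)))" for k
      unfolding detR tr using one by (simp add: power2_eq_square algebra_simps)
    then show ?thesis
      unfolding complex_eigenvalues_2 by auto
  qed
  have ev: "v1 $ 3 \<noteq> 0 \<and> v1 = v1 $ 3 *\<^sub>R v \<and> affine_point v1 = X" if "eigenvector G l v1" for v1
    using eigenvector_dominant[OF lim that] by (metis X_def affine_point_scaleR)
  have W: "real_invariant_subspace G l2 = {w. \<phi> \<bullet> w = 0}"
    by (rule real_invariant_subspace_G[OF sum prod im])
  have proj: "projection_along v1 {w. \<phi> \<bullet> w = 0} h \<noteq> 0"
    if v1: "eigenvector G l v1" and r: "r \<in> {0, 1}"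
      and h: "same_projective_point h (homog_lift ((pentagram ^^ r) P $ i))" for v1 r i h
  proof -
    obtain c where c: "c > 0" "homog_lift ((pentagram ^^ r) P $ i) = c *\<^sub>R base_lift r i"
      using base_lift_vertex[OF r] .
    obtain c' where "c' \<noteq> 0" "h = c' *\<^sub>R homog_lift ((pentagram ^^ r) P $ i)"
      using h unfolding same_projective_point_def by blast
    then have "\<phi> \<bullet> h \<noteq> 0"
      using c \<phi>_base_lift[of r i] by simp
    moreover have "projection_along v1 {w. \<phi> \<bullet> w = 0} h = (\<phi> \<bullet> h / (\<phi> \<bullet> v)) *\<^sub>R v"
      using hyperplane_facts(4)[of "v1 $ 3" h] ev[OF v1] by metis
    moreover have "v \<noteq> 0" using \<phi>v by auto
    ultimately show ?thesis using \<phi>v by simp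
  qed
  have split: "\<exists>!y. y \<in> span {v1} \<and> x - y \<in> {w. \<phi> \<bullet> w = 0}" if "eigenvector G l v1" for v1 x
    using hyperplane_facts(3)[of "v1 $ 3" x] ev[OF that] by metis
  have T2: "same_projective_point (homog_lift ((pentagram ^^ 2) P $ i)) (G *v homog_lift (P $ i))" for i
  proof -
    obtain c where "c > 0" "homog_lift ((pentagram ^^ 2) P $ i) = c *\<^sub>R (G *v homog_lift (P $ i))"
      using represents_even_odd_iterates(1)[OF o s, of 1] unfolding represents_def by auto
    moreover have "homog_lift x \<noteq> 0" for x
      by (metis homog_lift_nth(3) zero_index zero_neq_one)
    ultimately show ?thesis
      unfolding same_projective_point_def by (metis less_irrefl scaleR_zero_right)
  qed
  have iter: "pentagram_iterates_defined P"
    unfolding pentagram_iterates_defined_def using iterates_defined[OF o s] by (metis less_irrefl)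
  have inv: "invertible G"
    using det_G_mat_pos[OF o s] by (simp add: invertible_det_nz)
  show ?thesis
    unfolding elliptic_alternative_def Let_def
  proof (intro exI[of _ l] exI[of _ l2] conjI allI impI, goal_cases)
    case 1 show ?case by (rule eigs)
  next
    case 2 show ?case by (rule im)
  next
    case 3 show ?case using dom l by simp
  next
    case 4 show ?case by (rule inv)
  next
    case (5 i) show ?case by (rule T2)
  next
    case 6 show ?case by (rule iter)
  next
    case 7 show ?case by (rule normalized_iterates_defined[OF o s])
  next
    case (8 v1 \<theta>) then show ?case using ev by blast
  next
    case (9 v1 \<theta>) show ?case using \<tau>(2) by (simp only: \<tau>_def)
  next
    case (10 v1 \<theta>)
    then show ?case
      using ev has_derivative_affine_expression unfolding differentiable_def by metis
  next
    case (11 v1 \<theta>) show ?case unfolding W by (rule hyperplane_facts(1)[of 1]) simp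
  next
    case (12 v1 \<theta>) show ?case unfolding W by (rule hyperplane_facts(2)[of 1]) simp
  next
    case (13 v1 \<theta> x) then show ?case unfolding W using split by blast
  next
    case (14 v1 \<theta>) then show ?case unfolding W using proj by blast
  next
    case (15 v1 \<theta>) show ?case using iterate_G_vertex(1) by blast
  next
    case (16 v1 \<theta>)
    then have "affine_point v1 = X" "l2 / of_real l = of_real \<tau> * exp (\<i> * of_real \<theta>)"
      using ev by (auto simp: \<tau>_def)
    then show ?case
      using eigR by (simp only: jacobian_affine_expression R_def \<tau>_def)
  next
    case (17 v1 \<theta>)
    then have "affine_point v1 = X" using ev by blast
    then show ?case
      using detR by (simp only: jacobian_affine_expression R_def \<tau>_def)
  next
    case (18 v1 \<theta>)
    then have X1: "affine_point v1 = X" using ev by blast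
    show ?case
      unfolding X1 jacobian_affine_expression \<tau>_def[symmetric] R_def[symmetric]
      by (rule exI[of _ \<xi>], unfold vec_lambda_beta w_def[symmetric] B \<sigma>_def[symmetric],
          intro conjI ballI allI impI exI[of _ H], unfold level_def[symmetric],
          (rule big_O w_ne area_\<xi> normalized_lim H(1,2) form_lim level_pos ellipse_lim H(3)
            | assumption | erule conjunct1 conjunct2)+)
  qed
qed

end

section \<open>The real alternative\<close>

text \<open>Even and odd iterates follow different base hexagons, so limits are proved along each
  parity and joined here.\<close>

lemma filterlim_even_odd:
  assumes "\<And>r. r \<in> {0, 1} \<Longrightarrow> filterlim (\<lambda>q. f (2 * q + r)) F sequentially"
  shows "filterlim f F sequentially"
  unfolding filterlim_iff
proof (intro allI impI)
  fix Q assume "eventually Q F"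
  then have "\<forall>\<^sub>F q in sequentially. Q (f (2 * q + r))" if "r \<in> {0, 1}" for r
    using assms[OF that] unfolding filterlim_iff by blast
  from this[of 0] this[of 1] obtain N0 N1 where N: "\<And>q. q \<ge> N0 \<Longrightarrow> Q (f (2 * q))" "\<And>q. q \<ge> N1 \<Longrightarrow> Q (f (2 * q + 1))"
    unfolding eventually_sequentially by auto
  have "Q (f k)" if "k \<ge> 2 * (N0 + N1) + 1" for k
  proof (cases "even k")
    case True
    then obtain q where "k = 2 * q" by blast
    then show ?thesis using N(1)[of q] that by simp
  next
    case False
    then have "odd k" by simp
    then obtain q where "k = 2 * q + 1" using oddE by blast
    then show ?thesis using N(2)[of q] that by simp
  qed
  then show "\<forall>\<^sub>F k in sequentially. Q (f k)"
    unfolding eventually_sequentially by blast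
qed

lemma Max_range_tendsto_0:
  fixes f :: "nat \<Rightarrow> 'i::finite \<Rightarrow> real"
  assumes "\<And>i. (\<lambda>k. f k i) \<longlonglongrightarrow> 0" "\<And>k i. f k i \<ge> 0"
  shows "(\<lambda>k. Max (range (f k))) \<longlonglongrightarrow> 0"
proof (rule tendsto_sandwich[OF _ _ tendsto_const])
  have "Max (range (f k)) \<le> (\<Sum>i\<in>UNIV. f k i)" for k
    using assms(2) by (auto intro!: member_le_sum)
  then show "\<forall>\<^sub>F k in sequentially. Max (range (f k)) \<le> (\<Sum>i\<in>UNIV. f k i)" by simp
  have "Max (range (f k)) \<ge> 0" for k
    using assms(2)[of k undefined] Max_ge[of "range (f k)" "f k undefined"] by (auto intro: order_trans)
  then show "\<forall>\<^sub>F k in sequentially. Max (range (f k)) \<ge> 0" by simp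
  have "(\<lambda>k. \<Sum>i\<in>UNIV. f k i) \<longlonglongrightarrow> (\<Sum>i\<in>(UNIV :: 'i set). 0)"
    by (intro tendsto_sum assms(1))
  then show "(\<lambda>k. \<Sum>i\<in>UNIV. f k i) \<longlonglongrightarrow> 0" by simp
qed

lemma det2_cramer: "det2 a b *\<^sub>R z = det2 z b *\<^sub>R a + det2 a z *\<^sub>R b"
  by (simp add: det2_expand vec_eq_iff forall_2 algebra_simps)

lemma det2_linear:
  "det2 (x + y) z = det2 x z + det2 y z" "det2 z (x + y) = det2 z x + det2 z y"
  "det2 (k *\<^sub>R x) z = k * det2 x z" "det2 z (k *\<^sub>R x) = k * det2 z x"
  "det2 (x - y) z = det2 x z - det2 y z" "det2 z (x - y) = det2 z x - det2 z y"
  by (simp_all add: det2_expand algebra_simps)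

lemma eigenvectors_det2_ne_0:
  fixes A :: "real^2^2"
  assumes "A *v x = a *\<^sub>R x" "A *v y = b *\<^sub>R y" "a \<noteq> b" "x \<noteq> 0" "y \<noteq> 0"
  shows "det2 x y \<noteq> 0"
proof
  assume "det2 x y = 0"
  then have *: "det2 z y *\<^sub>R x + det2 x z *\<^sub>R y = 0" for z
    using det2_cramer[of x y z] by simp
  have "(b - a) *\<^sub>R (det2 x z *\<^sub>R y) = 0" for z
  proof -
    have "A *v (det2 z y *\<^sub>R x + det2 x z *\<^sub>R y) = 0"
      unfolding * by simp
    then have "a *\<^sub>R (det2 z y *\<^sub>R x) + b *\<^sub>R (det2 x z *\<^sub>R y) = 0"
      by (simp add: matrix_vector_right_distrib matrix_vector_mult_scaleR assms mult.commute)
    moreover have "det2 z y *\<^sub>R x = - (det2 x z *\<^sub>R y)"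
      using *[of z] by (simp add: eq_neg_iff_add_eq_0)
    ultimately show ?thesis by (simp add: algebra_simps)
  qed
  then have "det2 x z = 0" for z using assms by simp
  from this[of "axis 1 1"] this[of "axis 2 1"] have "x $ 2 = 0" "x $ 1 = 0"
    by (simp_all add: det2_expand axis_def)
  then show False using assms(4) by (simp add: vec_eq_iff forall_2)
qed

context pentagram_chart
begin

text \<open>A positive discriminant makes the subdominant roots real, distinct and different from
  \<open>l\<close>; \<open>F_inv P \<noteq> 0\<close> excludes that they are opposite, so their
  moduli differ. Dominance of \<open>l\<close> is inherited from the cone argument.\<close>

lemma real_spectrum:
  assumes "Discr P > 0" "F_inv P \<noteq> 0"
  obtains \<mu>2 \<mu>3 where "complex_eigenvalues G = {of_real l, of_real \<mu>2, of_real \<mu>3}"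
    "l > \<bar>\<mu>2\<bar>" "\<bar>\<mu>2\<bar> > \<bar>\<mu>3\<bar>" "\<mu>2 * \<mu>3 = det G / l"
proof -
  note result = that
  define e where "e = det G / l"
  define t where "t = 3 - l"
  have D: "Discr P = (t\<^sup>2 - 4 * e) * (l\<^sup>2 - l * t + e)\<^sup>2"
    unfolding Discr_eq t_def e_def ..
  then have d: "t\<^sup>2 - 4 * e > 0" and ne: "l\<^sup>2 - l * t + e \<noteq> 0"
    using assms(1) by (auto simp: zero_less_mult_iff)
  define a where "a = (t + sqrt (t\<^sup>2 - 4 * e)) / 2"
  define b where "b = (t - sqrt (t\<^sup>2 - 4 * e)) / 2"
  have ab: "a + b = t" "a * b = e"
  proof -
    show "a + b = t" by (simp add: a_def b_def field_simps)
    have "a * b = (t\<^sup>2 - (sqrt (t\<^sup>2 - 4 * e))\<^sup>2) / 4"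
      by (simp add: a_def b_def power2_eq_square algebra_simps)
    also have "(sqrt (t\<^sup>2 - 4 * e))\<^sup>2 = t\<^sup>2 - 4 * e" using d by simp
    finally show "a * b = e" by simp
  qed
  have "a \<noteq> b" using d by (simp add: a_def b_def)
  moreover have "t \<noteq> 0" using assms(2) unfolding F_inv_eq t_def by auto
  then have "a \<noteq> - b" using ab(1) by auto
  ultimately have abs_ne: "\<bar>a\<bar> \<noteq> \<bar>b\<bar>" by (auto simp: abs_eq_iff)
  have main: thesis if xy: "x + y = t" "x * y = e" "\<bar>x\<bar> > \<bar>y\<bar>" for x y
  proof -
    have eigs: "complex_eigenvalues G = {of_real l, of_real x, of_real y}"
      using xy(1,2) by (intro complex_eigenvalues_G) (simp_all add: t_def e_def flip: of_real_add of_real_mult)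
    have "(l - x) * (l - y) \<noteq> 0"
    proof -
      have "(l - x) * (l - y) = l\<^sup>2 - l * (x + y) + x * y" by (simp add: power2_eq_square algebra_simps)
      then show ?thesis using xy ne by simp
    qed
    then have "x \<noteq> l" by auto
    then have "cmod (of_real x) < l"
      by (intro dominant) (auto simp: eigs)
    then have "l > \<bar>x\<bar>" by simp
    show ?thesis
      by (rule result[OF eigs \<open>l > \<bar>x\<bar>\<close> xy(3)]) (simp add: xy(2) e_def)
  qed
  show thesis
  proof (cases "\<bar>a\<bar> > \<bar>b\<bar>")
    case True
    then show ?thesis using main ab by blast
  next
    case False
    then have "\<bar>b\<bar> > \<bar>a\<bar>" using abs_ne by simp
    then show ?thesis using main[of b a] ab by (simp add: add.commute mult.commute)
  qed
qed

end

section \<open>The eigenbasis of the derivative and its two rates\<close>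

locale real_pentagram_chart = pentagram_chart +
  fixes \<mu>2 \<mu>3 :: real and x2 x3 :: "real^3"
  assumes eig2: "eigenvector G \<mu>2 x2" and eig3: "eigenvector G \<mu>3 x3"
    and order: "l > \<bar>\<mu>2\<bar>" "\<bar>\<mu>2\<bar> > \<bar>\<mu>3\<bar>" and prod: "\<mu>2 * \<mu>3 = det G / l"
begin

definition u2 :: "real^2" where "u2 = \<pi> x2"
definition u3 :: "real^2" where "u3 = \<pi> x3"
definition \<nu>2 :: real where "\<nu>2 = \<mu>2 / l"
definition \<nu>3 :: real where "\<nu>3 = \<mu>3 / l"
definition \<alpha> :: "real^2 \<Rightarrow> real" where "\<alpha> z = det2 z u3 / det2 u2 u3"
definition \<beta> :: "real^2 \<Rightarrow> real" where "\<beta> z = det2 u2 z / det2 u2 u3"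

lemma \<pi>_eigenvector:
  assumes "eigenvector G m x" "m \<noteq> l"
  shows "\<pi> x \<noteq> 0" "M *v \<pi> x = (m / l) *\<^sub>R \<pi> x"
proof -
  have Gx: "G *v x = m *\<^sub>R x" "x \<noteq> 0" using assms(1) by (auto simp: eigenvector_def)
  have "(l - m) * (\<phi> \<bullet> x) = 0"
    using \<phi>[of x] unfolding Gx(1) inner_scaleR_right left_diff_distrib by linarith
  then show "\<pi> x \<noteq> 0"
    using \<pi>_\<phi>_eq_0[of x] Gx(2) assms(2) by auto
  have "l *\<^sub>R (M *v \<pi> x) = m *\<^sub>R \<pi> x"
    unfolding \<pi>_G[symmetric] Gx by (simp add: \<pi>_linear)
  then show "M *v \<pi> x = (m / l) *\<^sub>R \<pi> x"
    using l by (simp add: vec_eq_iff field_simps)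
qed

lemma M_u: "M *v u2 = \<nu>2 *\<^sub>R u2" "M *v u3 = \<nu>3 *\<^sub>R u3" "u2 \<noteq> 0" "u3 \<noteq> 0"
  using \<pi>_eigenvector[OF eig2] \<pi>_eigenvector[OF eig3] order
  by (auto simp: u2_def u3_def \<nu>2_def \<nu>3_def)

lemma \<nu>: "\<bar>\<nu>2\<bar> < 1" "\<bar>\<nu>3\<bar> < \<bar>\<nu>2\<bar>" "\<bar>\<nu>2\<bar> * \<bar>\<nu>3\<bar> = det M" "\<nu>3 \<noteq> 0"
proof -
  show "\<bar>\<nu>2\<bar> < 1" "\<bar>\<nu>3\<bar> < \<bar>\<nu>2\<bar>"
    using order l by (simp_all add: \<nu>2_def \<nu>3_def divide_strict_right_mono)
  have "\<nu>2 * \<nu>3 = det M"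
    using prod l by (simp add: \<nu>2_def \<nu>3_def det_M power3_eq_cube)
  then show "\<bar>\<nu>2\<bar> * \<bar>\<nu>3\<bar> = det M" "\<nu>3 \<noteq> 0"
    using det_M_pos by (auto simp flip: abs_mult)
qed

lemma det2_u: "det2 u2 u3 \<noteq> 0"
  using eigenvectors_det2_ne_0[OF M_u(1,2) _ M_u(3,4)] \<nu>(2) by auto

lemma decompose: "z = \<alpha> z *\<^sub>R u2 + \<beta> z *\<^sub>R u3"
proof -
  have "(1 / det2 u2 u3) *\<^sub>R (det2 u2 u3 *\<^sub>R z) = \<alpha> z *\<^sub>R u2 + \<beta> z *\<^sub>R u3"
    unfolding det2_cramer[of u2 u3 z] by (simp add: \<alpha>_def \<beta>_def scaleR_add_right)
  then show ?thesis using det2_u by simp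
qed

lemma funpow_M: "((*v) M ^^ q) z = (\<nu>2 ^ q * \<alpha> z) *\<^sub>R u2 + (\<nu>3 ^ q * \<beta> z) *\<^sub>R u3"
proof (induction q)
  case 0
  show ?case using decompose[of z] by simp
next
  case (Suc q)
  then show ?case
    by (simp add: matrix_vector_right_distrib matrix_vector_mult_scaleR M_u mult_ac)
qed

lemma funpow_M_tendsto_0: "(\<lambda>q. ((*v) M ^^ q) z) \<longlonglongrightarrow> 0"
proof -
  have p: "(\<lambda>q. \<nu>2 ^ q) \<longlonglongrightarrow> 0" "(\<lambda>q. \<nu>3 ^ q) \<longlonglongrightarrow> 0"
    using \<nu> by (auto intro!: LIMSEQ_power_zero)
  have "(\<lambda>q. (\<nu>2 ^ q * \<alpha> z) *\<^sub>R u2 + (\<nu>3 ^ q * \<beta> z) *\<^sub>R u3) \<longlonglongrightarrow> (0 * \<alpha> z) *\<^sub>R u2 + (0 * \<beta> z) *\<^sub>R u3"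
    by (intro tendsto_add tendsto_scaleR tendsto_mult tendsto_const p)
  then show ?thesis by (simp add: funpow_M)
qed

definition scale :: "nat \<Rightarrow> nat \<Rightarrow> real" where
  "scale r q = sqrt (area P / area ((pentagram ^^ (2 * q + r)) P))"

definition along :: "nat \<Rightarrow> nat \<Rightarrow> 6 \<Rightarrow> real" where
  "along r q i = correction r q i * \<alpha> (\<xi> r $ i) - (1/6) * (\<Sum>j\<in>UNIV. correction r q j * \<alpha> (\<xi> r $ j))"

definition across :: "nat \<Rightarrow> nat \<Rightarrow> 6 \<Rightarrow> real" where
  "across r q i = correction r q i * \<beta> (\<xi> r $ i) - (1/6) * (\<Sum>j\<in>UNIV. correction r q j * \<beta> (\<xi> r $ j))"

lemma normalized_decompose:
  assumes "r \<in> {0, 1}"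
  shows "(normalized_pentagram ^^ (2 * q + r)) P $ i - centroid P =
    (scale r q * \<nu>2 ^ q * along r q i) *\<^sub>R u2 + (scale r q * \<nu>3 ^ q * across r q i) *\<^sub>R u3"
  unfolding normalized_chart[OF assms] scale_def[symmetric] funpow_M along_def across_def
  by (simp add: sum_6 scaleR_add_right scaleR_diff_right scaleR_diff_left scaleR_add_left algebra_simps)

text \<open>Normalization divides lengths by the geometric mean of \<open>\<bar>\<nu>2\<bar>\<close>
  and \<open>\<bar>\<nu>3\<bar>\<close> at each double step. Relative to this mean the two rates are
  \<open>1 / \<kappa>\<close> and \<kappa>.\<close>

definition \<kappa> :: real where "\<kappa> = sqrt (\<bar>\<nu>3\<bar> / \<bar>\<nu>2\<bar>)"

lemma \<kappa>: "0 < \<kappa>" "\<kappa> < 1"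
  using \<nu> by (simp_all add: \<kappa>_def)

lemma scale_tendsto:
  assumes r: "r \<in> {0, 1}"
  obtains \<rho> \<rho>0 where "\<rho> \<longlonglongrightarrow> \<rho>0" "\<rho>0 > 0" "\<And>q. \<rho> q > 0" "\<And>q. \<bar>scale r q * \<nu>3 ^ q\<bar> = \<rho> q * \<kappa> ^ q"
    "\<And>q. \<bar>scale r q * \<nu>2 ^ q\<bar> = \<rho> q * (1 / \<kappa>) ^ q"
proof -
  define a where "a q = area ((pentagram ^^ (2 * q + r)) P) / det M ^ q" for q
  have a: "a \<longlonglongrightarrow> area (\<xi> r)"
    unfolding a_def by (rule area_iterate_tendsto[OF r funpow_M_tendsto_0])
  have area: "area P > 0" "area ((pentagram ^^ k) P) > 0" for k
    using area_pos[OF o] iterates_defined(2)[OF o s] by auto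
  define \<rho> where "\<rho> q = sqrt (area P / a q)" for q
  define g where "g = sqrt (\<bar>\<nu>2\<bar> * \<bar>\<nu>3\<bar>)"
  have g: "g > 0" "\<bar>\<nu>3\<bar> = g * \<kappa>" "\<bar>\<nu>2\<bar> = g * (1 / \<kappa>)"
  proof -
    have p: "\<bar>\<nu>2\<bar> > 0" "\<bar>\<nu>3\<bar> > 0" using \<nu> by auto
    then show "g > 0" by (simp add: g_def)
    have "g * \<kappa> = sqrt (\<bar>\<nu>3\<bar>\<^sup>2)"
      unfolding g_def \<kappa>_def real_sqrt_mult[symmetric] using p by (simp add: power2_eq_square)
    then show 3: "\<bar>\<nu>3\<bar> = g * \<kappa>" by simp
    have "g * g = \<bar>\<nu>2\<bar> * \<bar>\<nu>3\<bar>" using p by (simp add: g_def)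
    then have "g * g = \<bar>\<nu>2\<bar> * (g * \<kappa>)" using 3 by simp
    then show "\<bar>\<nu>2\<bar> = g * (1 / \<kappa>)" using \<open>g > 0\<close> \<kappa>(1) by (simp add: field_simps)
  qed
  have scale: "scale r q = \<rho> q / g ^ q" for q
  proof -
    have "area P / area ((pentagram ^^ (2 * q + r)) P) = (area P / a q) / (\<bar>\<nu>2\<bar> * \<bar>\<nu>3\<bar>) ^ q"
      using det_M_pos by (simp add: a_def \<nu>(3))
    then show ?thesis
      by (simp only: scale_def \<rho>_def g_def real_sqrt_divide real_sqrt_power)
  qed
  have \<rho>_pos: "\<rho> q > 0" for q
    using area det_M_pos by (simp add: \<rho>_def a_def)
  have "\<rho> \<longlonglongrightarrow> sqrt (area P / area (\<xi> r))"
    unfolding \<rho>_def using area_\<xi>[of r] by (intro tendsto_intros a) auto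
  moreover have "sqrt (area P / area (\<xi> r)) > 0" using area area_\<xi>[of r] by simp
  moreover have "\<bar>scale r q * \<nu>3 ^ q\<bar> = \<rho> q * \<kappa> ^ q" "\<bar>scale r q * \<nu>2 ^ q\<bar> = \<rho> q * (1 / \<kappa>) ^ q" for q
    unfolding scale abs_mult power_abs g(2,3) power_mult_distrib using \<rho>_pos[of q] g(1)
    by (simp_all add: abs_divide)
  ultimately show ?thesis using that \<rho>_pos by blast
qed

lemma along_across_tendsto:
  "(\<lambda>q. along r q i) \<longlonglongrightarrow> \<alpha> (\<xi> r $ i) - (1/6) * (\<Sum>j\<in>UNIV. \<alpha> (\<xi> r $ j))"
  "(\<lambda>q. across r q i) \<longlonglongrightarrow> \<beta> (\<xi> r $ i) - (1/6) * (\<Sum>j\<in>UNIV. \<beta> (\<xi> r $ j))"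
proof -
  note c = correction_tendsto[OF funpow_M_tendsto_0]
  have "(\<lambda>q. along r q i) \<longlonglongrightarrow> 1 * \<alpha> (\<xi> r $ i) - (1/6) * (\<Sum>j\<in>UNIV. 1 * \<alpha> (\<xi> r $ j))"
    unfolding along_def by (intro tendsto_intros c)
  then show "(\<lambda>q. along r q i) \<longlonglongrightarrow> \<alpha> (\<xi> r $ i) - (1/6) * (\<Sum>j\<in>UNIV. \<alpha> (\<xi> r $ j))" by simp
  have "(\<lambda>q. across r q i) \<longlonglongrightarrow> 1 * \<beta> (\<xi> r $ i) - (1/6) * (\<Sum>j\<in>UNIV. 1 * \<beta> (\<xi> r $ j))"
    unfolding across_def by (intro tendsto_intros c)
  then show "(\<lambda>q. across r q i) \<longlonglongrightarrow> \<beta> (\<xi> r $ i) - (1/6) * (\<Sum>j\<in>UNIV. \<beta> (\<xi> r $ j))" by simp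
qed

lemma across_term_tendsto_0:
  assumes r: "r \<in> {0, 1}"
  shows "(\<lambda>q. scale r q * \<nu>3 ^ q * across r q i) \<longlonglongrightarrow> 0"
proof -
  obtain \<rho> \<rho>0 where \<rho>: "\<rho> \<longlonglongrightarrow> \<rho>0" "\<And>q. \<bar>scale r q * \<nu>3 ^ q\<bar> = \<rho> q * \<kappa> ^ q"
    using scale_tendsto[OF r] by metis
  have "(\<lambda>q. \<kappa> ^ q) \<longlonglongrightarrow> 0" using \<kappa> by (simp add: LIMSEQ_power_zero)
  from tendsto_mult[OF \<rho>(1) this] have "(\<lambda>q. \<bar>scale r q * \<nu>3 ^ q\<bar>) \<longlonglongrightarrow> 0"
    unfolding \<rho>(2) by simp
  then have "(\<lambda>q. scale r q * \<nu>3 ^ q) \<longlonglongrightarrow> 0"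
    by (simp add: tendsto_rabs_zero_iff)
  from tendsto_mult[OF this along_across_tendsto(2)] show ?thesis by simp
qed

lemma infdist_tendsto_0:
  assumes u: "u2 = k *\<^sub>R u" and r: "r \<in> {0, 1}"
  shows "(\<lambda>q. infdist ((normalized_pentagram ^^ (2 * q + r)) P $ i) (range (\<lambda>t. centroid P + t *\<^sub>R u))) \<longlonglongrightarrow> 0"
proof (rule Lim_null_comparison)
  show "(\<lambda>q. \<bar>scale r q * \<nu>3 ^ q * across r q i\<bar> * norm u3) \<longlonglongrightarrow> 0"
    using tendsto_mult[OF tendsto_rabs[OF across_term_tendsto_0[OF r, of i]] tendsto_const[of "norm u3"]] by simp
  have "infdist ((normalized_pentagram ^^ (2 * q + r)) P $ i) (range (\<lambda>t. centroid P + t *\<^sub>R u))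
    \<le> \<bar>scale r q * \<nu>3 ^ q * across r q i\<bar> * norm u3" for q
  proof -
    define c where "c = scale r q * \<nu>2 ^ q * along r q i"
    have "infdist ((normalized_pentagram ^^ (2 * q + r)) P $ i) (range (\<lambda>t. centroid P + t *\<^sub>R u))
      \<le> dist ((normalized_pentagram ^^ (2 * q + r)) P $ i) (centroid P + (c * k) *\<^sub>R u)"
      by (rule infdist_le) blast
    also have "\<dots> = norm ((normalized_pentagram ^^ (2 * q + r)) P $ i - centroid P - c *\<^sub>R u2)"
      by (simp add: dist_norm u diff_diff_eq)
    also have "\<dots> = \<bar>scale r q * \<nu>3 ^ q * across r q i\<bar> * norm u3"
      unfolding normalized_decompose[OF r] c_def by (simp only: add_diff_cancel_left' norm_scaleR)
    finally show ?thesis .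
  qed
  then show "\<forall>\<^sub>F q in sequentially. norm (infdist ((normalized_pentagram ^^ (2 * q + r)) P $ i) (range (\<lambda>t. centroid P + t *\<^sub>R u)))
    \<le> \<bar>scale r q * \<nu>3 ^ q * across r q i\<bar> * norm u3"
    by (simp add: infdist_nonneg)
qed

text \<open>Otherwise all vertices of \<open>\<xi> r\<close> would lie on a line parallel to
  \<open>u3\<close>, against the strict orientation of three of them.\<close>

lemma \<alpha>_not_constant: "\<exists>i j. \<alpha> (\<xi> r $ i) \<noteq> \<alpha> (\<xi> r $ j)"
proof (rule ccontr)
  assume "\<not> ?thesis"
  then have const: "\<alpha> (\<xi> r $ i) = \<alpha> (\<xi> r $ j)" for i j by blast
  have "\<xi> r $ i - \<xi> r $ j = (\<beta> (\<xi> r $ i) - \<beta> (\<xi> r $ j)) *\<^sub>R u3" for i j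
  proof -
    have "\<xi> r $ i - \<xi> r $ j = (\<alpha> (\<xi> r $ i) *\<^sub>R u2 + \<beta> (\<xi> r $ i) *\<^sub>R u3) - (\<alpha> (\<xi> r $ j) *\<^sub>R u2 + \<beta> (\<xi> r $ j) *\<^sub>R u3)"
      by (rule arg_cong2[where f = "(-)", OF decompose decompose])
    then show ?thesis
      unfolding const[of i j] by (simp add: scaleR_left_diff_distrib)
  qed
  then have "det2 (\<xi> r $ 1 - \<xi> r $ 0) (\<xi> r $ 2 - \<xi> r $ 0) = 0"
    by (simp add: det2_linear(3,4)) (simp add: det2_expand)
  then show False
    using oriented_triples(1)[OF oriented_\<xi>, of r 0] unfolding det3_homog_lift by simp
qed

lemma diameter_tendsto:
  assumes r: "r \<in> {0, 1}"
  shows "filterlim (\<lambda>q. diameter (range (\<lambda>i. (normalized_pentagram ^^ (2 * q + r)) P $ i))) at_top sequentially"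
proof -
  obtain i j where ij: "\<alpha> (\<xi> r $ i) \<noteq> \<alpha> (\<xi> r $ j)" using \<alpha>_not_constant by blast
  obtain \<rho> \<rho>0 where \<rho>: "\<rho> \<longlonglongrightarrow> \<rho>0" "\<rho>0 > 0" "\<And>q. \<bar>scale r q * \<nu>2 ^ q\<bar> = \<rho> q * (1 / \<kappa>) ^ q"
    using scale_tendsto[OF r] by metis
  \<comment> \<open>Reverse triangle inequality for two vertices with different limits along
    \<open>u2\<close>: the \<open>u2\<close> part grows like \<open>(1 / \<kappa>) ^ q\<close>, the
    \<open>u3\<close> part tends to zero.\<close>
  define lower where "lower q = - (\<bar>scale r q * \<nu>3 ^ q * across r q i - scale r q * \<nu>3 ^ q * across r q j\<bar> * norm u3)
    + (\<rho> q * (\<bar>along r q i - along r q j\<bar> * norm u2)) * (1 / \<kappa>) ^ q" for q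
  have "(\<lambda>q. \<rho> q * (\<bar>along r q i - along r q j\<bar> * norm u2)) \<longlonglongrightarrow>
    \<rho>0 * (\<bar>(\<alpha> (\<xi> r $ i) - (1/6) * (\<Sum>j\<in>UNIV. \<alpha> (\<xi> r $ j))) - (\<alpha> (\<xi> r $ j) - (1/6) * (\<Sum>j\<in>UNIV. \<alpha> (\<xi> r $ j)))\<bar> * norm u2)"
    by (intro tendsto_intros \<rho>(1) along_across_tendsto)
  moreover have "\<rho>0 * (\<bar>(\<alpha> (\<xi> r $ i) - (1/6) * (\<Sum>j\<in>UNIV. \<alpha> (\<xi> r $ j))) - (\<alpha> (\<xi> r $ j) - (1/6) * (\<Sum>j\<in>UNIV. \<alpha> (\<xi> r $ j)))\<bar> * norm u2) > 0"
    using \<rho>(2) ij M_u(3) by simp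
  moreover have "filterlim (\<lambda>q. (1 / \<kappa>) ^ q) at_top sequentially"
    using \<kappa> by (intro filterlim_at_infinity_imp_filterlim_at_top filterlim_realpow_sequentially_gt1) simp_all
  ultimately have grow: "filterlim (\<lambda>q. (\<rho> q * (\<bar>along r q i - along r q j\<bar> * norm u2)) * (1 / \<kappa>) ^ q) at_top sequentially"
    by (rule filterlim_tendsto_pos_mult_at_top)
  have "(\<lambda>q. - (\<bar>scale r q * \<nu>3 ^ q * across r q i - scale r q * \<nu>3 ^ q * across r q j\<bar> * norm u3)) \<longlonglongrightarrow> - (\<bar>0 - 0\<bar> * norm u3)"
    by (intro tendsto_intros across_term_tendsto_0 r)
  from filterlim_tendsto_add_at_top[OF this grow] have "filterlim lower at_top sequentially"
    unfolding lower_def .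
  moreover have "lower q \<le> diameter (range (\<lambda>i. (normalized_pentagram ^^ (2 * q + r)) P $ i))" for q
  proof -
    define y where "y i = (normalized_pentagram ^^ (2 * q + r)) P $ i" for i
    have "y i - y j = (y i - centroid P) - (y j - centroid P)" by simp
    also have "\<dots> = (scale r q * \<nu>2 ^ q * (along r q i - along r q j)) *\<^sub>R u2
      - (- (scale r q * \<nu>3 ^ q * across r q i - scale r q * \<nu>3 ^ q * across r q j)) *\<^sub>R u3"
      unfolding y_def normalized_decompose[OF r] by (simp add: algebra_simps)
    finally have "norm (y i - y j) \<ge> norm ((scale r q * \<nu>2 ^ q * (along r q i - along r q j)) *\<^sub>R u2)
      - norm ((- (scale r q * \<nu>3 ^ q * across r q i - scale r q * \<nu>3 ^ q * across r q j)) *\<^sub>R u3)"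
      by (metis norm_triangle_ineq2)
    also have "norm ((scale r q * \<nu>2 ^ q * (along r q i - along r q j)) *\<^sub>R u2) =
      (\<rho> q * (\<bar>along r q i - along r q j\<bar> * norm u2)) * (1 / \<kappa>) ^ q"
      unfolding norm_scaleR abs_mult[of _ "along r q i - along r q j"] \<rho>(3) by (simp only: mult_ac)
    finally have "lower q \<le> dist (y i) (y j)"
      unfolding lower_def dist_norm by (simp add: abs_minus_commute)
    also have "\<dots> \<le> diameter (range y)"
      by (intro diameter_bounded_bound finite_imp_bounded) auto
    finally show ?thesis by (simp add: y_def[abs_def])
  qed
  ultimately show ?thesis
    by (rule filterlim_at_top_mono[OF _ always_eventually[OF allI]])
qed

end

context pentagram_chart
begin

lemma real_alternative:
  assumes "Discr P > 0" "F_inv P \<noteq> 0"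
  shows "real_alternative P"
proof -
  obtain \<mu>2 \<mu>3 where \<mu>: "complex_eigenvalues G = {of_real l, of_real \<mu>2, of_real \<mu>3}"
    "l > \<bar>\<mu>2\<bar>" "\<bar>\<mu>2\<bar> > \<bar>\<mu>3\<bar>" "\<mu>2 * \<mu>3 = det G / l"
    by (rule real_spectrum[OF assms], rule that)
  obtain x3 where x3: "eigenvector G \<mu>3 x3"
    by (rule complex_eigenvalue_eigenvector[of \<mu>3 G]) (use \<mu>(1) in auto)
  have main: "(v1 $ 3 \<noteq> 0 \<or> v2 $ 3 \<noteq> 0) \<and>
        (\<forall>u. line_direction v1 v2 u \<longrightarrow>
          (\<lambda>k. Max (range (\<lambda>i. infdist ((normalized_pentagram ^^ k) P $ i)
                                    (range (\<lambda>t. centroid P + t *\<^sub>R u))))) \<longlonglongrightarrow> 0 \<and>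
          filterlim (\<lambda>k. diameter (range (\<lambda>i. (normalized_pentagram ^^ k) P $ i)))
            at_top sequentially)"
    if v1: "eigenvector G l v1" and v2: "eigenvector G \<mu>2 v2" for v1 v2
  proof -
    interpret real_pentagram_chart P s l \<phi> v \<mu>2 \<mu>3 v2 x3
      using v2 x3 \<mu>(2-4) by unfold_locales
    note e = eigenvector_dominant[OF funpow_M_tendsto_0 v1]
    have "(\<lambda>k. Max (range (\<lambda>i. infdist ((normalized_pentagram ^^ k) P $ i) (range (\<lambda>t. centroid P + t *\<^sub>R u))))) \<longlonglongrightarrow> 0"
      if u: "line_direction v1 v2 u" for u
    proof -
      define u0 :: "real^3" where "u0 = vector [u $ 1, u $ 2, 0]"
      have "u \<noteq> 0" "u0 \<in> span {v1, v2}"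
        using u by (simp_all add: line_direction_def u0_def)
      then obtain k where "u0 - k *\<^sub>R v1 \<in> span {v2}"
        using span_breakdown_eq[of u0 v1 "{v2}"] by blast
      then obtain m where "u0 - k *\<^sub>R v1 = m *\<^sub>R v2"
        by (auto simp: span_singleton)
      then have "u0 = k *\<^sub>R v1 + m *\<^sub>R v2"
        by (simp add: algebra_simps)
      moreover have "\<pi> v1 = 0"
        by (subst e(2)) (simp add: \<pi>_def vec_eq_iff forall_2)
      moreover have "\<pi> u0 = u"
        by (simp add: \<pi>_def u0_def vec_eq_iff forall_2)
      \<comment> \<open>Applying \<pi> removes the multiple of \<open>v1\<close>, so every direction
        of the line through the two eigenpoints is a multiple of \<open>u2\<close>; \<open>m\<close>
        is nonzero because \<open>u\<close> is.\<close>
      ultimately have "u = m *\<^sub>R u2"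
        by (simp add: \<pi>_linear u2_def)
      then have "u2 = (1 / m) *\<^sub>R u"
        using \<open>u \<noteq> 0\<close> by auto
      show ?thesis
      proof (rule filterlim_even_odd, rule Max_range_tendsto_0)
        show "(\<lambda>q. infdist ((normalized_pentagram ^^ (2 * q + r)) P $ i) (range (\<lambda>t. centroid P + t *\<^sub>R u))) \<longlonglongrightarrow> 0"
          if "r \<in> {0, 1}" for r i
          by (rule infdist_tendsto_0[OF \<open>u2 = (1 / m) *\<^sub>R u\<close> that])
      qed (rule infdist_nonneg)
    qed
    moreover have "filterlim (\<lambda>k. diameter (range (\<lambda>i. (normalized_pentagram ^^ k) P $ i))) at_top sequentially"
      by (rule filterlim_even_odd[OF diameter_tendsto])
    ultimately show ?thesis using e(1) by blast
  qed
  have "\<bar>l\<bar> > \<bar>\<mu>2\<bar>" using \<mu>(2) by simp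
  show ?thesis
    unfolding real_alternative_def
  proof (rule conjI, goal_cases)
    case 1
    show ?case by (rule normalized_iterates_defined[OF o s])
  next
    case 2
    show ?case
      by (rule exI[of _ l], rule exI[of _ \<mu>2], rule exI[of _ \<mu>3], intro conjI allI impI \<mu>(1,3) \<open>\<bar>l\<bar> > \<bar>\<mu>2\<bar>\<close>)
        (use main in blast)+
  qed
qed

end

section \<open>Openness and density\<close>

text \<open>The denominators of Glick's operator, one for each vertex.\<close>

definition corner :: "hexagon \<Rightarrow> 6 \<Rightarrow> real" where
  "corner P j = det3 (homog_lift (P $ (j - 1))) (homog_lift (P $ j)) (homog_lift (P $ (j + 1)))"

lemma G_mat_minus_1_nth:
  "(G_mat P - mat 1) $ i $ k = (if i = k then 2 else 0)
    - (\<Sum>j\<in>UNIV. (det3 (homog_lift (P $ (j - 1))) (axis k 1) (homog_lift (P $ (j + 1))) / corner P j) * homog_lift (P $ j) $ i)"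
  by (simp add: G_mat_nth corner_def mat_nth)

lemma corner_ne_0: "P \<in> convex_hexagons \<Longrightarrow> corner P j \<noteq> 0"
  unfolding convex_hexagons_iff corner_def
  using oriented_triples(1)[of _ "\<lambda>i. homog_lift (P $ i)" "j - 1"] by force

lemma S_inv_expand: "S_inv P = (1/2) * (\<Sum>i\<in>UNIV. \<Sum>k\<in>UNIV. (G_mat P - mat 1) $ i $ k * (G_mat P - mat 1) $ k $ i)"
  by (simp add: S_inv_def trace_def matrix_matrix_mult_def)

lemma bounded_linear_coordinate: "bounded_linear (\<lambda>P :: hexagon. P $ j $ k)"
  by (rule bounded_linear_compose[OF bounded_linear_vec_nth bounded_linear_vec_nth])

lemma continuous_on_homog_lift_nth: "continuous_on A (\<lambda>P :: hexagon. homog_lift (P $ j) $ m)"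
  using exhaust_3[of m] linear_continuous_on[OF bounded_linear_coordinate, of A j] by auto

lemma continuous_on_Discr_F:
  "continuous_on convex_hexagons Discr" "continuous_on convex_hexagons F_inv"
proof -
  note intros = continuous_on_diff continuous_on_add continuous_on_mult continuous_on_const continuous_on_sum
    continuous_on_divide continuous_on_homog_lift_nth
  have det: "continuous_on convex_hexagons (\<lambda>P. det3 (a P) (b P) (c P))"
    if "\<And>m. continuous_on convex_hexagons (\<lambda>P. a P $ m)" "\<And>m. continuous_on convex_hexagons (\<lambda>P. b P $ m)"
      "\<And>m. continuous_on convex_hexagons (\<lambda>P. c P $ m)" for a b c :: "hexagon \<Rightarrow> real^3"
    unfolding det3_expand by (intro intros that)
  have corner: "continuous_on convex_hexagons (\<lambda>P. corner P j)" for j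
    unfolding corner_def by (intro intros det)
  have G: "continuous_on convex_hexagons (\<lambda>P. (G_mat P - mat 1) $ i $ k)" for i k
    unfolding G_mat_minus_1_nth by (intro intros det corner ballI corner_ne_0)
  have S: "continuous_on convex_hexagons S_inv"
    unfolding S_inv_expand by (intro intros G)
  have R: "continuous_on convex_hexagons R_inv"
    unfolding R_inv_def det_3 by (intro intros G)
  show "continuous_on convex_hexagons Discr"
    unfolding Discr_def by (intro continuous_intros S R)
  show "continuous_on convex_hexagons F_inv"
    unfolding F_inv_def by (intro continuous_intros S R)
qed

lemma openin_U6: "openin (top_of_set convex_hexagons) U6"
proof -
  have "U6 = (convex_hexagons \<inter> Discr -` {..<0}) \<union>
    ((convex_hexagons \<inter> Discr -` {0<..}) \<inter> (convex_hexagons \<inter> F_inv -` (- {0})))"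
    by (auto simp: U6_def)
  also have "openin (top_of_set convex_hexagons) \<dots>"
    by (intro openin_Un openin_Int continuous_openin_preimage_gen continuous_on_Discr_F) auto
  finally show ?thesis .
qed

text \<open>Finitely many strict polynomial inequalities. Openness in the full space allows the
  density argument to perturb in any direction.\<close>

lemma open_convex_hexagons: "open convex_hexagons"
proof -
  have imp: "open {P. c \<longrightarrow> Q P}" if "open {P. Q P}" for c and Q :: "hexagon \<Rightarrow> bool"
    using that by (cases c) auto
  have "open {P :: hexagon. \<forall>i j. j \<noteq> i \<longrightarrow> j \<noteq> i + 1 \<longrightarrow> s * det2 (P $ (i + 1) - P $ i) (P $ j - P $ i) > 0}" for s
    unfolding Collect_all_eq det2_expand
    by (intro open_INT finite ballI imp open_Collect_less continuous_intros)
  from open_Un[OF this[of 1] this[of "-1"]] show ?thesis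
    by (simp add: convex_hexagons_def Collect_disj_eq)
qed

section \<open>The exceptional set as the zero set of a polynomial\<close>

definition scaled_G :: "hexagon \<Rightarrow> 3 \<Rightarrow> 3 \<Rightarrow> real" where
  "scaled_G P i k = (if i = k then 2 else 0) * (\<Prod>j\<in>UNIV. corner P j)
    - (\<Sum>j\<in>UNIV. det3 (homog_lift (P $ (j - 1))) (axis k 1) (homog_lift (P $ (j + 1)))
        * (\<Prod>m\<in>UNIV - {j}. corner P m) * homog_lift (P $ j) $ i)"

definition scaled_S :: "hexagon \<Rightarrow> real" where
  "scaled_S P = (1/2) * (\<Sum>i\<in>UNIV. \<Sum>k\<in>UNIV. scaled_G P i k * scaled_G P k i)"

definition scaled_R :: "hexagon \<Rightarrow> real" where
  "scaled_R P = det (\<chi> i k. scaled_G P i k)"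

text \<open>Clearing denominators turns the exceptional set into the zero set of a polynomial, so that a line through
  the sample hexagon below meets it in finitely many points.\<close>

definition obstruction :: "hexagon \<Rightarrow> real" where
  "obstruction P = (\<Prod>j\<in>UNIV. corner P j) * (4 * scaled_S P ^ 3 - 27 * scaled_R P ^ 2) *
    (scaled_R P + 2 * scaled_S P * (\<Prod>j\<in>UNIV. corner P j) - 8 * (\<Prod>j\<in>UNIV. corner P j) ^ 3)"

text \<open>With \<open>D\<close> the product of the corners, \<open>scaled_S\<close> and
  \<open>scaled_R\<close> carry \<open>D\<^sup>2\<close> and \<open>D ^ 3\<close>, so the
  discriminant factor contributes \<open>D ^ 6\<close> and the other one \<open>D ^ 3\<close>. The
  leading \<open>D\<close> completes the exponent 10 and makes both sides vanish at degenerate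
  corners.\<close>

lemma obstruction_eq: "obstruction P = (\<Prod>j\<in>UNIV. corner P j) ^ 10 * Discr P * F_inv P"
proof (cases "\<exists>j. corner P j = 0")
  case True
  then have "(\<Prod>j\<in>UNIV. corner P j) = 0" by (simp add: prod_zero_iff)
  then show ?thesis by (simp only: obstruction_def mult_zero_left power_zero_numeral)
next
  case False
  define D where "D = (\<Prod>j\<in>UNIV. corner P j)"
  have D: "(\<Prod>m\<in>UNIV - {j}. corner P m) = D / corner P j" for j
    using False by (simp add: D_def prod.remove[of UNIV j])
  have G: "scaled_G P i k = D * (G_mat P - mat 1) $ i $ k" for i k
    unfolding scaled_G_def G_mat_minus_1_nth D D_def[symmetric]
    by (simp add: right_diff_distrib sum_distrib_left mult_ac)
  have S: "scaled_S P = D\<^sup>2 * S_inv P"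
    unfolding scaled_S_def S_inv_expand G by (simp add: sum_distrib_left power2_eq_square mult_ac)
  have R: "scaled_R P = D ^ 3 * R_inv P"
    unfolding scaled_R_def R_inv_def det_3 vec_lambda_beta G by (simp add: power3_eq_cube algebra_simps)
  show ?thesis
    unfolding obstruction_def D_def[symmetric] S R Discr_def F_inv_def
    by (simp add: power2_eq_square power3_eq_cube algebra_simps eval_nat_numeral)
qed

lemma real_polynomial_function_obstruction: "real_polynomial_function obstruction"
proof -
  have coord: "real_polynomial_function (\<lambda>P :: hexagon. homog_lift (P $ j) $ m)" for j m
  proof -
    show ?thesis
      using exhaust_3[of m] real_polynomial_function.intros(1)[OF bounded_linear_coordinate, of j]
        real_polynomial_function.intros(2)[of 1] by auto
  qed
  have det: "real_polynomial_function (\<lambda>P. det3 (a P) (b P) (c P))"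
    if "\<And>m. real_polynomial_function (\<lambda>P. a P $ m)" "\<And>m. real_polynomial_function (\<lambda>P. b P $ m)"
      "\<And>m. real_polynomial_function (\<lambda>P. c P $ m)" for a b c :: "hexagon \<Rightarrow> real^3"
    unfolding det3_expand
    by (intro real_polynomial_function_diff real_polynomial_function.intros(3,4) that)
  note intros = real_polynomial_function_diff real_polynomial_function.intros(2-4) real_polynomial_function_sum real_polynomial_function_prod
    real_polynomial_function_power det coord finite
  have corner: "real_polynomial_function (\<lambda>P. corner P j)" for j
    unfolding corner_def by (intro intros)
  have G: "real_polynomial_function (\<lambda>P. scaled_G P i k)" for i k
    unfolding scaled_G_def by (intro intros corner)
  have S: "real_polynomial_function scaled_S"
    unfolding scaled_S_def by (intro intros G)
  have R: "real_polynomial_function scaled_R"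
    unfolding scaled_R_def det_3 vec_lambda_beta by (intro intros G)
  show ?thesis
    unfolding obstruction_def by (intro intros corner S R)
qed

lemma finite_zeros_real_polynomial_function:
  fixes f :: "real \<Rightarrow> real"
  assumes "real_polynomial_function f" "f a \<noteq> 0"
  shows "finite {t. f t = 0}"
proof -
  obtain c n where f: "f = (\<lambda>x. \<Sum>i\<le>n. c i * x ^ i)"
    using assms(1) unfolding real_polynomial_function_iff_sum by blast
  then have "\<exists>i\<le>n. c i \<noteq> 0"
    using assms(2) by (auto intro: sum.neutral)
  then show ?thesis
    unfolding f polyfun_finite_roots .
qed

text \<open>Not convex, as its corners have mixed signs. It is chosen so that no corner vanishes and
  \<open>G_mat P - mat 1\<close> is upper triangular with diagonal \<open>-1\<close>,
  \<open>0\<close>, \<open>1\<close>, whence \<open>S_inv\<close> is 1 and \<open>R_inv\<close> is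
  0.\<close>

definition sample_hexagon :: hexagon where
  "sample_hexagon = (\<chi> i. if i = 0 then vector [1, 0] else if i = 1 then vector [0, 0] else if i = 2 then vector [1, -1]
    else if i = 3 then vector [0, -1] else if i = 4 then vector [0, 1] else vector [1, 1])"

lemma obstruction_sample: "obstruction sample_hexagon \<noteq> 0"
proof -
  define P where "P = sample_hexagon"
  have P: "P $ 0 = vector [1, 0]" "P $ 1 = vector [0, 0]" "P $ 2 = vector [1, -1]"
    "P $ 3 = vector [0, -1]" "P $ 4 = vector [0, 1]" "P $ 5 = vector [1, 1]"
    by (simp_all add: P_def sample_hexagon_def)
  have shift: "(0 :: 6) - 1 = 5" "(1 :: 6) - 1 = 0" "(2 :: 6) - 1 = 1" "(3 :: 6) - 1 = 2" "(4 :: 6) - 1 = 3" "(5 :: 6) - 1 = 4"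
    "(0 :: 6) + 1 = 1" "(1 :: 6) + 1 = 2" "(2 :: 6) + 1 = 3" "(3 :: 6) + 1 = 4" "(4 :: 6) + 1 = 5" "(5 :: 6) + 1 = 0"
    by simp_all
  have c: "corner P 0 = -1" "corner P 1 = 1" "corner P 2 = -1" "corner P 3 = -2" "corner P 4 = -2" "corner P 5 = -1"
    unfolding corner_def shift P by (simp_all add: det3_expand homog_lift_def)
  have G: "(G_mat P - mat 1) $ i $ k = (if i = k then 2 else 0)
    - (\<Sum>j\<in>UNIV. (det3 (homog_lift (P $ (j - 1))) (axis k 1) (homog_lift (P $ (j + 1))) / corner P j) * homog_lift (P $ j) $ i)" for i k
    by (rule G_mat_minus_1_nth)
  have entries: "(G_mat P - mat 1) $ 1 $ 1 = -1" "(G_mat P - mat 1) $ 1 $ 2 = 0" "(G_mat P - mat 1) $ 1 $ 3 = 1"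
    "(G_mat P - mat 1) $ 2 $ 1 = 0" "(G_mat P - mat 1) $ 2 $ 2 = 0" "(G_mat P - mat 1) $ 2 $ 3 = 1"
    "(G_mat P - mat 1) $ 3 $ 1 = 0" "(G_mat P - mat 1) $ 3 $ 2 = 0" "(G_mat P - mat 1) $ 3 $ 3 = 1"
    unfolding G sum_6 shift P c by (simp_all add: det3_expand axis_def)
  have "S_inv P = 1"
    unfolding S_inv_expand sum_3 entries by simp
  moreover have "R_inv P = 0"
    unfolding R_inv_def det_3 entries by simp
  moreover have "(\<Prod>j\<in>UNIV. corner P j) \<noteq> 0"
    using c exhaust_6 by (auto simp: prod_zero_iff) (metis (full_types) c exhaust_6 neg_equal_0_iff_equal zero_neq_numeral zero_neq_one)
  ultimately show ?thesis
    unfolding P_def[symmetric] obstruction_eq by (simp add: Discr_def F_inv_def)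
qed

lemma closure_of_U6: "top_of_set convex_hexagons closure_of U6 = convex_hexagons"
proof -
  have "P \<in> closure U6" if P: "P \<in> convex_hexagons" for P
    unfolding closure_approachable
  proof (intro allI impI)
    fix \<epsilon> :: real assume "\<epsilon> > 0"
    define line where "line t = P + t *\<^sub>R (sample_hexagon - P)" for t :: real
    have "polynomial_function line"
      unfolding line_def
      by (intro polynomial_function_add polynomial_function_const polynomial_function_bounded_linear bounded_linear_scaleR_left)
    then have "real_polynomial_function (obstruction \<circ> line)"
      by (rule real_polynomial_function_compose[OF _ real_polynomial_function_obstruction])
    moreover have "(obstruction \<circ> line) 1 \<noteq> 0"
      using obstruction_sample by (simp add: line_def)
    ultimately have fin: "finite {t. (obstruction \<circ> line) t = 0}"
      by (rule finite_zeros_real_polynomial_function)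
    have "isCont line 0"
      unfolding line_def by (intro continuous_intros)
    moreover have "open (convex_hexagons \<inter> ball P \<epsilon>)" "line 0 \<in> convex_hexagons \<inter> ball P \<epsilon>"
      using P \<open>\<epsilon> > 0\<close> by (auto simp: open_convex_hexagons line_def)
    ultimately have "\<forall>\<^sub>F t in at 0. line t \<in> convex_hexagons \<inter> ball P \<epsilon>"
      unfolding isCont_def by (rule topological_tendstoD)
    \<comment> \<open>The filter \<open>at 0\<close> leaves out \<open>t = 0\<close>, so
      \<open>P\<close> itself may be exceptional; finitely many zeros cannot accumulate
      there.\<close>
    moreover have "\<forall>\<^sub>F t in at 0. t \<notin> {t. (obstruction \<circ> line) t = 0}"
      using islimpt_finite[OF fin, of 0] unfolding islimpt_iff_eventually by simp
    ultimately have "\<forall>\<^sub>F t in at (0 :: real). line t \<in> convex_hexagons \<inter> ball P \<epsilon> \<and> t \<notin> {t. (obstruction \<circ> line) t = 0}"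
      by (rule eventually_conj)
    then obtain t where t: "line t \<in> convex_hexagons" "dist (line t) P < \<epsilon>" "obstruction (line t) \<noteq> 0"
      using eventually_happens[of _ "at (0 :: real)"] by (auto simp: dist_commute)
    then have "line t \<in> U6"
      unfolding U6_def obstruction_eq by auto
    then show "\<exists>y\<in>U6. dist y P < \<epsilon>" using t(2) by blast
  qed
  moreover have "U6 \<subseteq> convex_hexagons" by (auto simp: U6_def)
  ultimately show ?thesis
    by (auto simp: closure_of_subtopology euclidean_closure_of Int_absorb1)
qed

theorem theorem6p9:
  shows "openin (top_of_set convex_hexagons) U6 \<and>
    top_of_set convex_hexagons closure_of U6 = convex_hexagons \<and>
    (\<forall>P\<in>U6.
      (Discr P > 0 \<longrightarrow> real_alternative P) \<and>
      (Discr P < 0 \<longrightarrow> elliptic_alternative P) \<and>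
      (real_alternative P \<and> \<not> elliptic_alternative P \<or>
       \<not> real_alternative P \<and> elliptic_alternative P))"
proof (intro conjI ballI openin_U6 closure_of_U6)
  fix P assume P: "P \<in> U6"
  then have convex: "P \<in> convex_hexagons" by (auto simp: U6_def)
  obtain s l \<phi> v where chart: "pentagram_chart P s l \<phi> v"
    by (rule pentagram_chart_exists[OF convex], rule that)
  show real: "Discr P > 0 \<longrightarrow> real_alternative P"
    using pentagram_chart.real_alternative[OF chart] P by (auto simp: U6_def)
  show elliptic: "Discr P < 0 \<longrightarrow> elliptic_alternative P"
    using pentagram_chart.elliptic_alternative[OF chart] by blast
  \<comment> \<open>The spectrum alone separates the alternatives: it is real in one and contains a
    non-real number in the other.\<close>
  have "\<not> (real_alternative P \<and> elliptic_alternative P)"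
  proof
    assume "real_alternative P \<and> elliptic_alternative P"
    then obtain \<mu>1 \<mu>2 \<mu>3 l1 :: real and l2 where "complex_eigenvalues (G_mat P) = {of_real \<mu>1, of_real \<mu>2, of_real \<mu>3}"
      "complex_eigenvalues (G_mat P) = {of_real l1, l2, cnj l2}" "Im l2 \<noteq> 0"
      unfolding real_alternative_def elliptic_alternative_def by blast
    then have "l2 \<in> {of_real \<mu>1, of_real \<mu>2, of_real \<mu>3}" by blast
    then show False using \<open>Im l2 \<noteq> 0\<close> by auto
  qed
  then show "real_alternative P \<and> \<not> elliptic_alternative P \<or> \<not> real_alternative P \<and> elliptic_alternative P"
    using real elliptic P by (auto simp: U6_def)
qed

end
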